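(* Let $\mathcal{B}\xrightarrow{u}\mathcal{C}\xrightarrow{v}\mathcal{D}\xrightarrow{+1}\mathcal{B}[1]$ be a distinguished triangle in $D(X)$, let $\mathcal{F}$ be an object of $D(X)$ and let $k$ be an integer. Let $\beta:\mathcal{E}xt^k(\mathcal{F},\mathcal{C})\to\mathcal{E}xt^k(\mathcal{F},\mathcal{D})$ be the morphism of sheaves induced by $v$. Then there is a long exact cohomology sequence $$\cdots\to H^q(X,\mathrm{Ker}(\beta))\to H^q(X,\mathcal{E}xt^k(\mathcal{F},\mathcal{C}))\to H^q(X,\mathrm{Im}(\beta))\to H^{q+1}(X,\mathrm{Ker}(\beta))\to\cdots$$
   Context: $X$ is a compact Kähler manifold of dimension $n$, and $D(X)$ is the bounded derived category of coherent sheaves on $X$. $\mathfrak{Sh}$ is the category of sheaves of $\mathbb{C}$-vector spaces on $X$, and $R\mathcal{H}om(\cdot,\cdot):D(X)^{\mathrm{op}}\times D(X)\to D(\mathfrak{Sh})$ is the derived functor of the sheaf Hom functor. $\mathcal{E}xt^k(\mathcal{F},\mathcal{G})=H^kR\mathcal{H}om(\mathcal{F},\mathcal{G})$, an object of $\mathfrak{Sh}$; kernels and images are taken in $\mathfrak{Sh}$. *)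

theory Defs
  imports "HOL-Analysis.Analysis" "HOL-Algebra.AbelCoset" "HOL-Algebra.Module"
begin

section \<open>Compact Kaehler manifolds\<close>

text \<open>
  The model space \<open>C^n\<close> is the set of functions \<open>nat \<Rightarrow> complex\<close> that vanish
  from index \<open>n\<close> on (so \<open>n = 0\<close> is allowed), with the topology induced by the product topology.
\<close>

definition Cspace :: "nat \<Rightarrow> (nat \<Rightarrow> complex) set" where
  "Cspace n = {z. \<forall>i\<ge>n. z i = 0}"

definition Cnorm :: "nat \<Rightarrow> (nat \<Rightarrow> complex) \<Rightarrow> real" where
  "Cnorm n z = sqrt (\<Sum>i<n. (cmod (z i))\<^sup>2)"

text \<open>The \<open>C\<close>-linear form with coefficients \<open>a\<close> is the complex Frechet derivative of \<open>f\<close> at \<open>z\<close>.\<close>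

definition has_complex_differential ::
    "nat \<Rightarrow> ((nat \<Rightarrow> complex) \<Rightarrow> complex) \<Rightarrow> (nat \<Rightarrow> complex) \<Rightarrow> (nat \<Rightarrow> complex) \<Rightarrow> bool" where
  "has_complex_differential n f z a \<longleftrightarrow>
     (\<forall>e>0. \<exists>d>0. \<forall>h\<in>Cspace n. Cnorm n h < d \<longrightarrow>
        cmod (f (\<lambda>i. z i + h i) - f z - (\<Sum>i<n. a i * h i)) \<le> e * Cnorm n h)"

definition holomorphic_in ::
    "nat \<Rightarrow> (nat \<Rightarrow> complex) set \<Rightarrow> ((nat \<Rightarrow> complex) \<Rightarrow> complex) \<Rightarrow> bool" where
  "holomorphic_in n S f \<longleftrightarrow> (\<forall>z\<in>S. \<exists>a. has_complex_differential n f z a)"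

text \<open>Real directional derivatives, and functions of class \<open>C^k\<close> in the real sense.\<close>

definition along :: "(nat \<Rightarrow> complex) \<Rightarrow> (nat \<Rightarrow> complex) \<Rightarrow> real \<Rightarrow> (nat \<Rightarrow> complex)" where
  "along z v t = (\<lambda>i. z i + of_real t * v i)"

primrec class_C ::
    "nat \<Rightarrow> nat \<Rightarrow> (nat \<Rightarrow> complex) set \<Rightarrow> ((nat \<Rightarrow> complex) \<Rightarrow> complex) \<Rightarrow> bool" where
  "class_C n 0 S f \<longleftrightarrow> continuous_on S f"
| "class_C n (Suc k) S f \<longleftrightarrow> continuous_on S f \<and>
     (\<forall>v\<in>Cspace n. \<exists>g. (\<forall>z\<in>S. ((\<lambda>t. f (along z v t)) has_vector_derivative g z) (at 0)) \<and>
        class_C n k S g)"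

definition smooth_in ::
    "nat \<Rightarrow> (nat \<Rightarrow> complex) set \<Rightarrow> ((nat \<Rightarrow> complex) \<Rightarrow> complex) \<Rightarrow> bool" where
  "smooth_in n S f \<longleftrightarrow> (\<forall>k. class_C n k S f)"

type_synonym 'a chart = "'a set \<times> ('a \<Rightarrow> nat \<Rightarrow> complex)"

abbreviation chart_inv :: "'a chart \<Rightarrow> (nat \<Rightarrow> complex) \<Rightarrow> 'a" where
  "chart_inv c \<equiv> inv_into (fst c) (snd c)"

record 'a atlas_space =
  mdim :: nat
  mtop :: "'a topology"
  atlas :: "'a chart set"

definition complex_manifold :: "'a atlas_space \<Rightarrow> bool" where
  "complex_manifold M \<longleftrightarrow>
     Hausdorff_space (mtop M) \<and>
     topspace (mtop M) = (\<Union>c\<in>atlas M. fst c) \<and>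
     (\<forall>c\<in>atlas M. openin (mtop M) (fst c) \<and>
        openin (top_of_set (Cspace (mdim M))) (snd c ` fst c) \<and>
        homeomorphic_map (subtopology (mtop M) (fst c)) (top_of_set (snd c ` fst c)) (snd c)) \<and>
     (\<forall>c\<in>atlas M. \<forall>c'\<in>atlas M. \<forall>i<mdim M.
        holomorphic_in (mdim M) (snd c ` (fst c \<inter> fst c')) (\<lambda>z. snd c' (chart_inv c z) i))"

definition hermitian_form ::
    "nat \<Rightarrow> (nat \<Rightarrow> nat \<Rightarrow> complex) \<Rightarrow> (nat \<Rightarrow> complex) \<Rightarrow> (nat \<Rightarrow> complex) \<Rightarrow> complex" where
  "hermitian_form n h u v = (\<Sum>i<n. \<Sum>j<n. h i j * u i * cnj (v j))"

text \<open>
  A Hermitian metric is given by its matrix \<open>H c z\<close> at the point \<open>z\<close> of the image of each chart \<open>c\<close>.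
\<close>

definition hermitian_metric ::
    "'a atlas_space \<Rightarrow> ('a chart \<Rightarrow> (nat \<Rightarrow> complex) \<Rightarrow> nat \<Rightarrow> nat \<Rightarrow> complex) \<Rightarrow> bool" where
  "hermitian_metric M H \<longleftrightarrow> (let n = mdim M in
     (\<forall>c\<in>atlas M. \<forall>i<n. \<forall>j<n. smooth_in n (snd c ` fst c) (\<lambda>z. H c z i j)) \<and>
     (\<forall>c\<in>atlas M. \<forall>z\<in>snd c ` fst c.
        (\<forall>i<n. \<forall>j<n. H c z j i = cnj (H c z i j)) \<and>
        (\<forall>v\<in>Cspace n. v \<noteq> (\<lambda>_. 0) \<longrightarrow> Re (hermitian_form n (H c z) v v) > 0)) \<and>
     (\<forall>c\<in>atlas M. \<forall>c'\<in>atlas M. \<forall>p\<in>fst c \<inter> fst c'. \<forall>A.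
        (\<forall>i<n. has_complex_differential n (\<lambda>z. snd c' (chart_inv c z) i) (snd c p) (A i)) \<longrightarrow>
        (\<forall>u\<in>Cspace n. \<forall>v\<in>Cspace n.
           hermitian_form n (H c (snd c p)) u v =
           hermitian_form n (H c' (snd c' p)) (\<lambda>i. \<Sum>l<n. A i l * u l) (\<lambda>i. \<Sum>l<n. A i l * v l))))"

text \<open>
  The fundamental form is \<open>\<omega> = - Im h\<close>.  Since \<open>u\<close>, \<open>v\<close>, \<open>w\<close> below are constant vector fields
  in the chart, the cyclic sum is \<open>(d\<omega>)(u, v, w)\<close>.
\<close>

definition fundamental_form ::
    "nat \<Rightarrow> (nat \<Rightarrow> nat \<Rightarrow> complex) \<Rightarrow> (nat \<Rightarrow> complex) \<Rightarrow> (nat \<Rightarrow> complex) \<Rightarrow> real" where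
  "fundamental_form n h u v = - Im (hermitian_form n h u v)"

definition kaehler_metric ::
    "'a atlas_space \<Rightarrow> ('a chart \<Rightarrow> (nat \<Rightarrow> complex) \<Rightarrow> nat \<Rightarrow> nat \<Rightarrow> complex) \<Rightarrow> bool" where
  "kaehler_metric M H \<longleftrightarrow> hermitian_metric M H \<and>
     (let D = (\<lambda>c z u v w.
        vector_derivative (\<lambda>t. fundamental_form (mdim M) (H c (along z u t)) v w) (at 0))
      in \<forall>c\<in>atlas M. \<forall>z\<in>snd c ` fst c.
        \<forall>u\<in>Cspace (mdim M). \<forall>v\<in>Cspace (mdim M). \<forall>w\<in>Cspace (mdim M).
          D c z u v w + D c z v w u + D c z w u v = 0)"

definition compact_kaehler_manifold :: "'a atlas_space \<Rightarrow> bool" where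
  "compact_kaehler_manifold M \<longleftrightarrow>
     complex_manifold M \<and> compact_space (mtop M) \<and> (\<exists>H. kaehler_metric M H)"


section \<open>Ringed spaces and (pre)sheaves of modules\<close>

record ('a, 'r) ringed_space =
  base :: "'a topology"
  ring_of :: "'a set \<Rightarrow> 'r ring"
  ring_res :: "'a set \<Rightarrow> 'a set \<Rightarrow> 'r \<Rightarrow> 'r"

text \<open>Functions on \<open>U\<close> are represented extensionally, i.e. with value \<open>undefined\<close> outside \<open>U\<close>.\<close>

definition holomorphic_on_manifold :: "'a atlas_space \<Rightarrow> 'a set \<Rightarrow> ('a \<Rightarrow> complex) \<Rightarrow> bool" where
  "holomorphic_on_manifold M U f \<longleftrightarrow>
     (\<forall>c\<in>atlas M. holomorphic_in (mdim M) (snd c ` (U \<inter> fst c)) (\<lambda>z. f (chart_inv c z)))"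

definition hol_ring :: "'a atlas_space \<Rightarrow> 'a set \<Rightarrow> ('a \<Rightarrow> complex) ring" where
  "hol_ring M U =
     \<lparr>carrier = {f \<in> extensional U. holomorphic_on_manifold M U f},
      mult = (\<lambda>f g. \<lambda>x\<in>U. f x * g x), one = (\<lambda>x\<in>U. 1),
      zero = (\<lambda>x\<in>U. 0), add = (\<lambda>f g. \<lambda>x\<in>U. f x + g x)\<rparr>"

definition hol_space :: "'a atlas_space \<Rightarrow> ('a, 'a \<Rightarrow> complex) ringed_space" where
  "hol_space M = \<lparr>base = mtop M, ring_of = hol_ring M, ring_res = (\<lambda>U V f. restrict f V)\<rparr>"

definition complex_ring :: "complex ring" where
  "complex_ring = \<lparr>carrier = UNIV, mult = (*), one = 1, zero = 0, add = (+)\<rparr>"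

text \<open>Sheaves of \<open>C\<close>-vector spaces on \<open>T\<close> are sheaves of modules on \<open>const_space T\<close>.\<close>

definition const_space :: "'a topology \<Rightarrow> ('a, complex) ringed_space" where
  "const_space T = \<lparr>base = T, ring_of = (\<lambda>U. complex_ring), ring_res = (\<lambda>U V c. c)\<rparr>"

record ('a, 'r, 'm) presheaf =
  sec :: "'a set \<Rightarrow> ('r, 'm) module"
  res :: "'a set \<Rightarrow> 'a set \<Rightarrow> 'm \<Rightarrow> 'm"

abbreviation sections :: "('a, 'r, 'm) presheaf \<Rightarrow> 'a set \<Rightarrow> 'm set" where
  "sections F U \<equiv> carrier (sec F U)"

definition is_presheaf :: "('a, 'r) ringed_space \<Rightarrow> ('a, 'r, 'm) presheaf \<Rightarrow> bool" where
  "is_presheaf X F \<longleftrightarrow>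
     (\<forall>U. openin (base X) U \<longrightarrow> Module.module (ring_of X U) (sec F U) \<and>
        (\<forall>s\<in>sections F U. res F U U s = s)) \<and>
     (\<forall>U V. openin (base X) U \<and> openin (base X) V \<and> V \<subseteq> U \<longrightarrow>
        (\<forall>s\<in>sections F U. res F U V s \<in> sections F V) \<and>
        (\<forall>s\<in>sections F U. \<forall>t\<in>sections F U.
           res F U V (s \<oplus>\<^bsub>sec F U\<^esub> t) = res F U V s \<oplus>\<^bsub>sec F V\<^esub> res F U V t) \<and>
        (\<forall>a\<in>carrier (ring_of X U). \<forall>s\<in>sections F U.
           res F U V (a \<odot>\<^bsub>sec F U\<^esub> s) = ring_res X U V a \<odot>\<^bsub>sec F V\<^esub> res F U V s) \<and>
        (\<forall>W. openin (base X) W \<and> W \<subseteq> V \<longrightarrow>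
           (\<forall>s\<in>sections F U. res F V W (res F U V s) = res F U W s)))"

definition is_sheaf :: "('a, 'r) ringed_space \<Rightarrow> ('a, 'r, 'm) presheaf \<Rightarrow> bool" where
  "is_sheaf X F \<longleftrightarrow> is_presheaf X F \<and>
     (\<forall>\<U> s. (\<forall>U\<in>\<U>. openin (base X) U \<and> s U \<in> sections F U) \<and>
        (\<forall>U\<in>\<U>. \<forall>V\<in>\<U>. res F U (U \<inter> V) (s U) = res F V (U \<inter> V) (s V)) \<longrightarrow>
        (\<exists>!t. t \<in> sections F (\<Union>\<U>) \<and> (\<forall>U\<in>\<U>. res F (\<Union>\<U>) U t = s U)))"

definition is_zero_sheaf :: "('a, 'r) ringed_space \<Rightarrow> ('a, 'r, 'm) presheaf \<Rightarrow> bool" where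
  "is_zero_sheaf X F \<longleftrightarrow> (\<forall>U. openin (base X) U \<longrightarrow> sections F U = {\<zero>\<^bsub>sec F U\<^esub>})"

type_synonym ('a, 'm, 'k) sheaf_map = "'a set \<Rightarrow> 'm \<Rightarrow> 'k"

definition linear_map ::
    "'r ring \<Rightarrow> ('r, 'm) module \<Rightarrow> ('r, 'k) module \<Rightarrow> ('m \<Rightarrow> 'k) \<Rightarrow> bool" where
  "linear_map R M N f \<longleftrightarrow>
     (\<forall>s\<in>carrier M. f s \<in> carrier N) \<and>
     (\<forall>s\<in>carrier M. \<forall>t\<in>carrier M. f (s \<oplus>\<^bsub>M\<^esub> t) = f s \<oplus>\<^bsub>N\<^esub> f t) \<and>
     (\<forall>a\<in>carrier R. \<forall>s\<in>carrier M. f (a \<odot>\<^bsub>M\<^esub> s) = a \<odot>\<^bsub>N\<^esub> f s)"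

text \<open>Morphisms \<open>F|U \<longrightarrow> G|U\<close>.\<close>

definition is_hom_on :: "('a, 'r) ringed_space \<Rightarrow> 'a set \<Rightarrow>
    ('a, 'r, 'm) presheaf \<Rightarrow> ('a, 'r, 'k) presheaf \<Rightarrow> ('a, 'm, 'k) sheaf_map \<Rightarrow> bool" where
  "is_hom_on X U F G \<phi> \<longleftrightarrow>
     (\<forall>V. openin (base X) V \<and> V \<subseteq> U \<longrightarrow>
        linear_map (ring_of X V) (sec F V) (sec G V) (\<phi> V) \<and>
        (\<forall>W. openin (base X) W \<and> W \<subseteq> V \<longrightarrow>
           (\<forall>s\<in>sections F V. \<phi> W (res F V W s) = res G V W (\<phi> V s))))"

definition is_hom :: "('a, 'r) ringed_space \<Rightarrow>
    ('a, 'r, 'm) presheaf \<Rightarrow> ('a, 'r, 'k) presheaf \<Rightarrow> ('a, 'm, 'k) sheaf_map \<Rightarrow> bool" where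
  "is_hom X F G \<phi> \<longleftrightarrow> is_hom_on X (topspace (base X)) F G \<phi>"

definition is_injective_hom :: "('a, 'r) ringed_space \<Rightarrow>
    ('a, 'r, 'm) presheaf \<Rightarrow> ('a, 'r, 'k) presheaf \<Rightarrow> ('a, 'm, 'k) sheaf_map \<Rightarrow> bool" where
  "is_injective_hom X F G \<phi> \<longleftrightarrow> is_hom X F G \<phi> \<and>
     (\<forall>U. openin (base X) U \<longrightarrow> inj_on (\<phi> U) (sections F U))"


section \<open>Coherent modules\<close>

text \<open>\<open>G\<close> need only be defined on the open subsets of \<open>U\<close>.\<close>

definition finite_type_on :: "('a, 'r) ringed_space \<Rightarrow> 'a set \<Rightarrow> ('a, 'r, 'm) presheaf \<Rightarrow> bool" where
  "finite_type_on X U G \<longleftrightarrow>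
     (\<forall>x\<in>U. \<exists>V m s. openin (base X) V \<and> x \<in> V \<and> V \<subseteq> U \<and> (\<forall>i<(m::nat). s i \<in> sections G V) \<and>
        (\<forall>W t. openin (base X) W \<and> W \<subseteq> V \<and> t \<in> sections G W \<longrightarrow>
           (\<forall>y\<in>W. \<exists>W' a. openin (base X) W' \<and> y \<in> W' \<and> W' \<subseteq> W \<and>
              (\<forall>i<m. a i \<in> carrier (ring_of X W')) \<and>
              res G W W' t = finsum (sec G W') (\<lambda>i. a i \<odot>\<^bsub>sec G W'\<^esub> res G V W' (s i)) {..<m})))"

text \<open>The kernel of the morphism \<open>O^m|U \<longrightarrow> F|U\<close> given by the sections \<open>s 0, \<dots>, s (m - 1)\<close> of \<open>F\<close> over \<open>U\<close>.\<close>

definition relation_sheaf :: "('a, 'r) ringed_space \<Rightarrow> 'a set \<Rightarrow> ('a, 'r, 'm) presheaf \<Rightarrow>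
    nat \<Rightarrow> (nat \<Rightarrow> 'm) \<Rightarrow> ('a, 'r, nat \<Rightarrow> 'r) presheaf" where
  "relation_sheaf X U F m s =
     \<lparr>sec = (\<lambda>V. \<lparr>
        carrier = {a \<in> {..<m} \<rightarrow>\<^sub>E carrier (ring_of X V).
          finsum (sec F V) (\<lambda>i. a i \<odot>\<^bsub>sec F V\<^esub> res F U V (s i)) {..<m} = \<zero>\<^bsub>sec F V\<^esub>},
        mult = undefined, one = undefined,
        zero = (\<lambda>i\<in>{..<m}. \<zero>\<^bsub>ring_of X V\<^esub>),
        add = (\<lambda>a b. \<lambda>i\<in>{..<m}. a i \<oplus>\<^bsub>ring_of X V\<^esub> b i),
        smult = (\<lambda>r a. \<lambda>i\<in>{..<m}. r \<otimes>\<^bsub>ring_of X V\<^esub> a i)\<rparr>),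
      res = (\<lambda>V W a. \<lambda>i\<in>{..<m}. ring_res X V W (a i))\<rparr>"

definition coherent :: "('a, 'r) ringed_space \<Rightarrow> ('a, 'r, 'm) presheaf \<Rightarrow> bool" where
  "coherent X F \<longleftrightarrow> is_sheaf X F \<and> finite_type_on X (topspace (base X)) F \<and>
     (\<forall>U m s. openin (base X) U \<and> (\<forall>i<m. s i \<in> sections F U) \<longrightarrow>
        finite_type_on X U (relation_sheaf X U F m s))"


section \<open>Quotients, stalks and sheafification\<close>

text \<open>The ring multiplication contained in the record type of modules is irrelevant.\<close>

definition quot_mod :: "('r, 'm) module \<Rightarrow> 'm set \<Rightarrow> ('r, 'm set) module" where
  "quot_mod M N =
     \<lparr>carrier = a_rcosets\<^bsub>M\<^esub> N, mult = undefined, one = undefined, zero = N,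
      add = (\<lambda>A B. A <+>\<^bsub>M\<^esub> B),
      smult = (\<lambda>c A. \<Union>s\<in>A. N +>\<^bsub>M\<^esub> (c \<odot>\<^bsub>M\<^esub> s))\<rparr>"

text \<open>
  Here and below, a map on equivalence classes is written as the union, over all representatives,
  of the classes of the images; when the map is well defined all these classes coincide.
\<close>

definition quot_map :: "('r, 'k) module \<Rightarrow> 'k set \<Rightarrow> ('m \<Rightarrow> 'k) \<Rightarrow> 'm set \<Rightarrow> 'k set" where
  "quot_map M' N' f A = (\<Union>s\<in>A. N' +>\<^bsub>M'\<^esub> f s)"

type_synonym ('a, 'm) germ = "('a set \<times> 'm) set"

definition germ :: "'a topology \<Rightarrow> ('a, 'r, 'm) presheaf \<Rightarrow> 'a \<Rightarrow> 'a set \<Rightarrow> 'm \<Rightarrow> ('a, 'm) germ" where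
  "germ T F x U s = {(V, t). openin T V \<and> x \<in> V \<and> t \<in> sections F V \<and>
     (\<exists>W. openin T W \<and> x \<in> W \<and> W \<subseteq> U \<inter> V \<and> res F U W s = res F V W t)}"

definition stalk :: "'a topology \<Rightarrow> ('a, complex, 'm) presheaf \<Rightarrow> 'a \<Rightarrow> (complex, ('a, 'm) germ) module" where
  "stalk T F x =
     \<lparr>carrier = {germ T F x U s |U s. openin T U \<and> x \<in> U \<and> s \<in> sections F U},
      mult = undefined, one = undefined,
      zero = germ T F x (topspace T) \<zero>\<^bsub>sec F (topspace T)\<^esub>,
      add = (\<lambda>\<gamma> \<gamma>'. \<Union>(U, s)\<in>\<gamma>. \<Union>(V, t)\<in>\<gamma>'.
        germ T F x (U \<inter> V) (res F U (U \<inter> V) s \<oplus>\<^bsub>sec F (U \<inter> V)\<^esub> res F V (U \<inter> V) t)),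
      smult = (\<lambda>c \<gamma>. \<Union>(U, s)\<in>\<gamma>. germ T F x U (c \<odot>\<^bsub>sec F U\<^esub> s))\<rparr>"

definition stalk_map :: "'a topology \<Rightarrow> ('a, complex, 'k) presheaf \<Rightarrow> ('a, 'm, 'k) sheaf_map \<Rightarrow>
    'a \<Rightarrow> ('a, 'm) germ \<Rightarrow> ('a, 'k) germ" where
  "stalk_map T G \<phi> x \<gamma> = (\<Union>(U, s)\<in>\<gamma>. germ T G x U (\<phi> U s))"

text \<open>Sections of the associated sheaf are families of germs that are locally induced by sections of \<open>F\<close>.\<close>

definition sheafify :: "'a topology \<Rightarrow> ('a, complex, 'm) presheaf \<Rightarrow>
    ('a, complex, 'a \<Rightarrow> ('a, 'm) germ) presheaf" where
  "sheafify T F =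
     \<lparr>sec = (\<lambda>U. \<lparr>
        carrier = {\<sigma> \<in> extensional U. \<forall>x\<in>U. \<exists>V s. openin T V \<and> x \<in> V \<and> V \<subseteq> U \<and>
          s \<in> sections F V \<and> (\<forall>y\<in>V. \<sigma> y = germ T F y V s)},
        mult = undefined, one = undefined,
        zero = (\<lambda>x\<in>U. \<zero>\<^bsub>stalk T F x\<^esub>),
        add = (\<lambda>\<sigma> \<tau>. \<lambda>x\<in>U. \<sigma> x \<oplus>\<^bsub>stalk T F x\<^esub> \<tau> x),
        smult = (\<lambda>c \<sigma>. \<lambda>x\<in>U. c \<odot>\<^bsub>stalk T F x\<^esub> \<sigma> x)\<rparr>),
      res = (\<lambda>U V \<sigma>. restrict \<sigma> V)\<rparr>"

definition sheafify_map :: "'a topology \<Rightarrow> ('a, complex, 'k) presheaf \<Rightarrow> ('a, 'm, 'k) sheaf_map \<Rightarrow>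
    ('a, 'a \<Rightarrow> ('a, 'm) germ, 'a \<Rightarrow> ('a, 'k) germ) sheaf_map" where
  "sheafify_map T G \<phi> U \<sigma> = (\<lambda>x\<in>U. stalk_map T G \<phi> x (\<sigma> x))"

text \<open>Kernel and image in the category of sheaves.\<close>

definition ker_sheaf :: "('a, 'r, 'm) presheaf \<Rightarrow> ('a, 'r, 'k) presheaf \<Rightarrow> ('a, 'm, 'k) sheaf_map \<Rightarrow>
    ('a, 'r, 'm) presheaf" where
  "ker_sheaf F G \<phi> =
     F\<lparr>sec := \<lambda>U. (sec F U)\<lparr>carrier := {s \<in> sections F U. \<phi> U s = \<zero>\<^bsub>sec G U\<^esub>}\<rparr>\<rparr>"

definition im_sheaf :: "'a topology \<Rightarrow> ('a, 'r, 'm) presheaf \<Rightarrow> ('a, 'r, 'k) presheaf \<Rightarrow>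
    ('a, 'm, 'k) sheaf_map \<Rightarrow> ('a, 'r, 'k) presheaf" where
  "im_sheaf T F G \<phi> =
     G\<lparr>sec := \<lambda>U. (sec G U)\<lparr>carrier := {t \<in> sections G U.
        \<forall>x\<in>U. \<exists>V s. openin T V \<and> x \<in> V \<and> V \<subseteq> U \<and> s \<in> sections F V \<and> \<phi> V s = res G U V t}\<rparr>\<rparr>"


section \<open>Complexes of sheaves\<close>

record ('a, 'r, 'm) sheaf_complex =
  ob :: "int \<Rightarrow> ('a, 'r, 'm) presheaf"
  dif :: "int \<Rightarrow> ('a, 'm, 'm) sheaf_map"

type_synonym ('a, 'm, 'k) chain_map = "int \<Rightarrow> ('a, 'm, 'k) sheaf_map"

definition is_complex :: "('a, 'r) ringed_space \<Rightarrow> ('a, 'r, 'm) sheaf_complex \<Rightarrow> bool" where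
  "is_complex X K \<longleftrightarrow>
     (\<forall>k. is_sheaf X (ob K k) \<and> is_hom X (ob K k) (ob K (k + 1)) (dif K k) \<and>
        (\<forall>U. openin (base X) U \<longrightarrow> (\<forall>s\<in>sections (ob K k) U.
           dif K (k + 1) U (dif K k U s) = \<zero>\<^bsub>sec (ob K (k + 2)) U\<^esub>)))"

definition is_chain_map :: "('a, 'r) ringed_space \<Rightarrow> ('a, 'r, 'm) sheaf_complex \<Rightarrow>
    ('a, 'r, 'k) sheaf_complex \<Rightarrow> ('a, 'm, 'k) chain_map \<Rightarrow> bool" where
  "is_chain_map X K L f \<longleftrightarrow>
     (\<forall>k. is_hom X (ob K k) (ob L k) (f k) \<and>
        (\<forall>U. openin (base X) U \<longrightarrow> (\<forall>s\<in>sections (ob K k) U.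
           f (k + 1) U (dif K k U s) = dif L k U (f k U s))))"

definition chain_comp :: "('a, 'k, 'l) chain_map \<Rightarrow> ('a, 'm, 'k) chain_map \<Rightarrow> ('a, 'm, 'l) chain_map"
    (infixr "\<circ>\<^sub>c" 70) where
  "g \<circ>\<^sub>c f = (\<lambda>k U s. g k U (f k U s))"

definition chain_id :: "('a, 'm, 'm) chain_map" where
  "chain_id = (\<lambda>k U s. s)"

definition homotopic :: "('a, 'r) ringed_space \<Rightarrow> ('a, 'r, 'm) sheaf_complex \<Rightarrow>
    ('a, 'r, 'k) sheaf_complex \<Rightarrow> ('a, 'm, 'k) chain_map \<Rightarrow> ('a, 'm, 'k) chain_map \<Rightarrow> bool" where
  "homotopic X K L f g \<longleftrightarrow>
     (\<exists>h. (\<forall>k. is_hom X (ob K k) (ob L (k - 1)) (h k)) \<and>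
        (\<forall>k U. openin (base X) U \<longrightarrow> (\<forall>s\<in>sections (ob K k) U.
           f k U s \<ominus>\<^bsub>sec (ob L k) U\<^esub> g k U s =
           dif L (k - 1) U (h k U s) \<oplus>\<^bsub>sec (ob L k) U\<^esub> h (k + 1) U (dif K k U s))))"

text \<open>\<open>K[1]\<close> has the differential \<open>-d\<close>.\<close>

definition shift :: "('a, 'r, 'm) sheaf_complex \<Rightarrow> ('a, 'r, 'm) sheaf_complex" where
  "shift K = \<lparr>ob = (\<lambda>k. ob K (k + 1)),
     dif = (\<lambda>k U s. \<ominus>\<^bsub>sec (ob K (k + 2)) U\<^esub> dif K (k + 1) U s)\<rparr>"

definition shift_map :: "('a, 'm, 'k) chain_map \<Rightarrow> ('a, 'm, 'k) chain_map" where
  "shift_map f = (\<lambda>k. f (k + 1))"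

definition sum_mod :: "('r, 'm) module \<Rightarrow> ('r, 'k) module \<Rightarrow> ('r, 'm \<times> 'k) module" where
  "sum_mod M N = \<lparr>carrier = carrier M \<times> carrier N, mult = undefined, one = undefined,
     zero = (\<zero>\<^bsub>M\<^esub>, \<zero>\<^bsub>N\<^esub>),
     add = (\<lambda>(s, t) (s', t'). (s \<oplus>\<^bsub>M\<^esub> s', t \<oplus>\<^bsub>N\<^esub> t')),
     smult = (\<lambda>c (s, t). (c \<odot>\<^bsub>M\<^esub> s, c \<odot>\<^bsub>N\<^esub> t))\<rparr>"

definition cone :: "('a, 'r, 'm) sheaf_complex \<Rightarrow> ('a, 'r, 'k) sheaf_complex \<Rightarrow>
    ('a, 'm, 'k) chain_map \<Rightarrow> ('a, 'r, 'm \<times> 'k) sheaf_complex" where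
  "cone P Q \<phi> =
     \<lparr>ob = (\<lambda>k. \<lparr>sec = (\<lambda>U. sum_mod (sec (ob P (k + 1)) U) (sec (ob Q k) U)),
                  res = (\<lambda>U V (p, q). (res (ob P (k + 1)) U V p, res (ob Q k) U V q))\<rparr>),
      dif = (\<lambda>k U (p, q). (\<ominus>\<^bsub>sec (ob P (k + 2)) U\<^esub> dif P (k + 1) U p,
                            \<phi> (k + 1) U p \<oplus>\<^bsub>sec (ob Q (k + 1)) U\<^esub> dif Q k U q))\<rparr>"

text \<open>
  The cohomology sheaf of degree \<open>k\<close> of a complex of sheaves of \<open>C\<close>-vector spaces is the sheaf
  associated with \<open>U \<mapsto> H^k(K(U))\<close>.
\<close>

definition cocycle_mod :: "('a, 'r, 'm) sheaf_complex \<Rightarrow> int \<Rightarrow> 'a set \<Rightarrow> ('r, 'm) module" where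
  "cocycle_mod K k U = (sec (ob K k) U)
     \<lparr>carrier := {s \<in> sections (ob K k) U. dif K k U s = \<zero>\<^bsub>sec (ob K (k + 1)) U\<^esub>}\<rparr>"

definition coboundaries :: "('a, 'r, 'm) sheaf_complex \<Rightarrow> int \<Rightarrow> 'a set \<Rightarrow> 'm set" where
  "coboundaries K k U = dif K (k - 1) U ` sections (ob K (k - 1)) U"

definition coh_presheaf :: "('a, 'r, 'm) sheaf_complex \<Rightarrow> int \<Rightarrow> ('a, 'r, 'm set) presheaf" where
  "coh_presheaf K k =
     \<lparr>sec = (\<lambda>U. quot_mod (cocycle_mod K k U) (coboundaries K k U)),
      res = (\<lambda>U V. quot_map (cocycle_mod K k V) (coboundaries K k V) (res (ob K k) U V))\<rparr>"

definition coh_sheaf :: "'a topology \<Rightarrow> ('a, complex, 'm) sheaf_complex \<Rightarrow> int \<Rightarrow>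
    ('a, complex, 'a \<Rightarrow> ('a, 'm set) germ) presheaf" where
  "coh_sheaf T K k = sheafify T (coh_presheaf K k)"

definition coh_sheaf_map :: "'a topology \<Rightarrow> ('a, complex, 'k) sheaf_complex \<Rightarrow>
    ('a, 'm, 'k) chain_map \<Rightarrow> int \<Rightarrow>
    ('a, 'a \<Rightarrow> ('a, 'm set) germ, 'a \<Rightarrow> ('a, 'k set) germ) sheaf_map" where
  "coh_sheaf_map T L f k = sheafify_map T (coh_presheaf L k)
     (\<lambda>U. quot_map (cocycle_mod L k U) (coboundaries L k U) (f k U))"

text \<open>
  A complex of modules over a sheaf of complex-valued functions, regarded as a complex of sheaves
  of \<open>C\<close>-vector spaces.
\<close>

definition forget :: "('a, 'a \<Rightarrow> complex, 'm) presheaf \<Rightarrow> ('a, complex, 'm) presheaf" where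
  "forget F =
     \<lparr>sec = (\<lambda>U. \<lparr>carrier = sections F U, mult = mult (sec F U), one = one (sec F U),
        zero = zero (sec F U), add = add (sec F U),
        smult = (\<lambda>c s. (\<lambda>x\<in>U. c) \<odot>\<^bsub>sec F U\<^esub> s)\<rparr>),
      res = res F\<rparr>"

definition forget_complex ::
    "('a, 'a \<Rightarrow> complex, 'm) sheaf_complex \<Rightarrow> ('a, complex, 'm) sheaf_complex" where
  "forget_complex K = \<lparr>ob = (\<lambda>k. forget (ob K k)), dif = dif K\<rparr>"

definition quasi_iso :: "('a, 'a \<Rightarrow> complex) ringed_space \<Rightarrow> ('a, 'a \<Rightarrow> complex, 'm) sheaf_complex \<Rightarrow>
    ('a, 'a \<Rightarrow> complex, 'k) sheaf_complex \<Rightarrow> ('a, 'm, 'k) chain_map \<Rightarrow> bool" where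
  "quasi_iso X K L f \<longleftrightarrow> is_chain_map X K L f \<and>
     (\<forall>k U. openin (base X) U \<longrightarrow>
        bij_betw (coh_sheaf_map (base X) (forget_complex L) f k U)
          (sections (coh_sheaf (base X) (forget_complex K) k) U)
          (sections (coh_sheaf (base X) (forget_complex L) k) U))"


section \<open>The bounded derived category of coherent sheaves\<close>

text \<open>
  All sections of the modules considered live in one type \<open>'m\<close>, which plays the role of a universe;
  a type whose cardinality \<open>\<kappa>\<close> satisfies \<open>\<kappa>^c = \<kappa>\<close> for the cardinality \<open>c\<close> of the continuum,
  such as \<open>real set\<close>, has room for all coherent sheaves, mapping cones and injective resolutions.
  A morphism \<open>K \<longrightarrow> L\<close> is represented by a roof \<open>K \<longleftarrow> Z \<longrightarrow> L\<close> whose left leg is a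
  quasi-isomorphism; \<open>roof_eq\<close> is equality of the represented morphisms.
\<close>

definition derived_object ::
    "('a, 'a \<Rightarrow> complex) ringed_space \<Rightarrow> ('a, 'a \<Rightarrow> complex, 'm) sheaf_complex \<Rightarrow> bool" where
  "derived_object X K \<longleftrightarrow> is_complex X K \<and> (\<forall>k. coherent X (ob K k)) \<and>
     (\<exists>N. \<forall>k. \<bar>k\<bar> > N \<longrightarrow> is_zero_sheaf X (ob K k))"

record ('a, 'm) roof =
  apex :: "('a, 'a \<Rightarrow> complex, 'm) sheaf_complex"
  bwd :: "('a, 'm, 'm) chain_map"
  fwd :: "('a, 'm, 'm) chain_map"

definition is_roof :: "('a, 'a \<Rightarrow> complex) ringed_space \<Rightarrow> ('a, 'a \<Rightarrow> complex, 'm) sheaf_complex \<Rightarrow>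
    ('a, 'a \<Rightarrow> complex, 'm) sheaf_complex \<Rightarrow> ('a, 'm) roof \<Rightarrow> bool" where
  "is_roof X K L r \<longleftrightarrow> derived_object X K \<and> derived_object X L \<and> derived_object X (apex r) \<and>
     quasi_iso X (apex r) K (bwd r) \<and> is_chain_map X (apex r) L (fwd r)"

definition roof_eq :: "('a, 'a \<Rightarrow> complex) ringed_space \<Rightarrow> ('a, 'a \<Rightarrow> complex, 'm) sheaf_complex \<Rightarrow>
    ('a, 'a \<Rightarrow> complex, 'm) sheaf_complex \<Rightarrow> ('a, 'm) roof \<Rightarrow> ('a, 'm) roof \<Rightarrow> bool" where
  "roof_eq X K L r r' \<longleftrightarrow> is_roof X K L r \<and> is_roof X K L r' \<and>
     (\<exists>(Z :: ('a, 'a \<Rightarrow> complex, 'm) sheaf_complex) a b.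
        derived_object X Z \<and> is_chain_map X Z (apex r) a \<and> is_chain_map X Z (apex r') b \<and>
        quasi_iso X Z K (bwd r \<circ>\<^sub>c a) \<and>
        homotopic X Z K (bwd r \<circ>\<^sub>c a) (bwd r' \<circ>\<^sub>c b) \<and>
        homotopic X Z L (fwd r \<circ>\<^sub>c a) (fwd r' \<circ>\<^sub>c b))"

text \<open>\<open>g\<close> after \<open>f\<close> equals \<open>r\<close>, for \<open>f : K \<longrightarrow> L\<close> and \<open>g : L \<longrightarrow> N\<close>.\<close>

definition roof_comp :: "('a, 'a \<Rightarrow> complex) ringed_space \<Rightarrow> ('a, 'a \<Rightarrow> complex, 'm) sheaf_complex \<Rightarrow>
    ('a, 'a \<Rightarrow> complex, 'm) sheaf_complex \<Rightarrow> ('a, 'a \<Rightarrow> complex, 'm) sheaf_complex \<Rightarrow>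
    ('a, 'm) roof \<Rightarrow> ('a, 'm) roof \<Rightarrow> ('a, 'm) roof \<Rightarrow> bool" where
  "roof_comp X K L N g f r \<longleftrightarrow> is_roof X K L f \<and> is_roof X L N g \<and>
     (\<exists>(Z :: ('a, 'a \<Rightarrow> complex, 'm) sheaf_complex) a b.
        derived_object X Z \<and> quasi_iso X Z (apex f) a \<and> is_chain_map X Z (apex g) b \<and>
        homotopic X Z L (fwd f \<circ>\<^sub>c a) (bwd g \<circ>\<^sub>c b) \<and>
        roof_eq X K N \<lparr>apex = Z, bwd = bwd f \<circ>\<^sub>c a, fwd = fwd g \<circ>\<^sub>c b\<rparr> r)"

definition roof_of :: "('a, 'a \<Rightarrow> complex, 'm) sheaf_complex \<Rightarrow> ('a, 'm, 'm) chain_map \<Rightarrow> ('a, 'm) roof" where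
  "roof_of K f = \<lparr>apex = K, bwd = chain_id, fwd = f\<rparr>"

definition shift_roof :: "('a, 'm) roof \<Rightarrow> ('a, 'm) roof" where
  "shift_roof r = \<lparr>apex = shift (apex r), bwd = shift_map (bwd r), fwd = shift_map (fwd r)\<rparr>"

definition roof_iso :: "('a, 'a \<Rightarrow> complex) ringed_space \<Rightarrow> ('a, 'a \<Rightarrow> complex, 'm) sheaf_complex \<Rightarrow>
    ('a, 'a \<Rightarrow> complex, 'm) sheaf_complex \<Rightarrow> ('a, 'm) roof \<Rightarrow> bool" where
  "roof_iso X K L f \<longleftrightarrow>
     (\<exists>g. roof_comp X K L K g f (roof_of K chain_id) \<and> roof_comp X L K L f g (roof_of L chain_id))"

definition roof_square :: "('a, 'a \<Rightarrow> complex) ringed_space \<Rightarrow>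
    ('a, 'a \<Rightarrow> complex, 'm) sheaf_complex \<Rightarrow> ('a, 'a \<Rightarrow> complex, 'm) sheaf_complex \<Rightarrow>
    ('a, 'a \<Rightarrow> complex, 'm) sheaf_complex \<Rightarrow> ('a, 'a \<Rightarrow> complex, 'm) sheaf_complex \<Rightarrow>
    ('a, 'm) roof \<Rightarrow> ('a, 'm) roof \<Rightarrow> ('a, 'm) roof \<Rightarrow> ('a, 'm) roof \<Rightarrow> bool" where
  "roof_square X K L K' L' f a b f' \<longleftrightarrow>
     (\<exists>r. roof_comp X K L L' b f r \<and> roof_comp X K K' L' f' a r)"

text \<open>
  A standard triangle \<open>P \<longrightarrow> Q \<longrightarrow> K \<longrightarrow> P[1]\<close>: the complex \<open>K\<close> is isomorphic by \<open>\<theta>\<close> to the mapping cone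
  of \<open>\<phi>\<close>, and \<open>\<iota>\<close>, \<open>\<pi>\<close> correspond to the inclusion and the projection.  The detour over
  \<open>K\<close> is needed because the cone has sections in \<open>'m \<times> 'm\<close>.
\<close>

definition standard_triangle :: "('a, 'a \<Rightarrow> complex) ringed_space \<Rightarrow>
    ('a, 'a \<Rightarrow> complex, 'm) sheaf_complex \<Rightarrow> ('a, 'a \<Rightarrow> complex, 'm) sheaf_complex \<Rightarrow>
    ('a, 'a \<Rightarrow> complex, 'm) sheaf_complex \<Rightarrow>
    ('a, 'm, 'm) chain_map \<Rightarrow> ('a, 'm, 'm) chain_map \<Rightarrow> ('a, 'm, 'm) chain_map \<Rightarrow> bool" where
  "standard_triangle X P Q K \<phi> \<iota> \<pi> \<longleftrightarrow>
     derived_object X P \<and> derived_object X Q \<and> derived_object X K \<and>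
     is_chain_map X P Q \<phi> \<and> is_chain_map X Q K \<iota> \<and> is_chain_map X K (shift P) \<pi> \<and>
     (\<exists>\<theta>. is_chain_map X K (cone P Q \<phi>) \<theta> \<and>
        (\<forall>k U. openin (base X) U \<longrightarrow>
           bij_betw (\<theta> k U) (sections (ob K k) U) (sections (ob (cone P Q \<phi>) k) U) \<and>
           (\<forall>q\<in>sections (ob Q k) U. \<theta> k U (\<iota> k U q) = (\<zero>\<^bsub>sec (ob P (k + 1)) U\<^esub>, q)) \<and>
           (\<forall>s\<in>sections (ob K k) U. \<pi> k U s = fst (\<theta> k U s))))"

definition distinguished_triangle :: "('a, 'a \<Rightarrow> complex) ringed_space \<Rightarrow>
    ('a, 'a \<Rightarrow> complex, 'm) sheaf_complex \<Rightarrow> ('a, 'a \<Rightarrow> complex, 'm) sheaf_complex \<Rightarrow>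
    ('a, 'a \<Rightarrow> complex, 'm) sheaf_complex \<Rightarrow>
    ('a, 'm) roof \<Rightarrow> ('a, 'm) roof \<Rightarrow> ('a, 'm) roof \<Rightarrow> bool" where
  "distinguished_triangle X B C D u v w \<longleftrightarrow>
     is_roof X B C u \<and> is_roof X C D v \<and> is_roof X D (shift B) w \<and>
     (\<exists>P Q K \<phi> \<iota> \<pi> a b c. standard_triangle X P Q K \<phi> \<iota> \<pi> \<and>
        roof_iso X B P a \<and> roof_iso X C Q b \<and> roof_iso X D K c \<and>
        roof_square X B C P Q u a b (roof_of P \<phi>) \<and>
        roof_square X C D Q K v b c (roof_of Q \<iota>) \<and>
        roof_square X D (shift B) K (shift P) w c (shift_roof a) (roof_of K \<pi>))"


section \<open>The derived sheaf Hom functor\<close>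

definition restr_hom :: "'a topology \<Rightarrow> ('a, 'r, 'm) presheaf \<Rightarrow> 'a set \<Rightarrow>
    ('a, 'm, 'k) sheaf_map \<Rightarrow> ('a, 'm, 'k) sheaf_map" where
  "restr_hom T F U \<phi> = (\<lambda>V s. if openin T V \<and> V \<subseteq> U \<and> s \<in> sections F V then \<phi> V s else undefined)"

definition hom_mod :: "('a, 'a \<Rightarrow> complex) ringed_space \<Rightarrow> ('a, 'a \<Rightarrow> complex, 'm) presheaf \<Rightarrow>
    ('a, 'a \<Rightarrow> complex, 'k) presheaf \<Rightarrow> 'a set \<Rightarrow> (complex, ('a, 'm, 'k) sheaf_map) module" where
  "hom_mod X F G U =
     \<lparr>carrier = {\<phi>. is_hom_on X U F G \<phi> \<and> restr_hom (base X) F U \<phi> = \<phi>},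
      mult = undefined, one = undefined,
      zero = restr_hom (base X) F U (\<lambda>V s. \<zero>\<^bsub>sec G V\<^esub>),
      add = (\<lambda>\<phi> \<psi>. restr_hom (base X) F U (\<lambda>V s. \<phi> V s \<oplus>\<^bsub>sec G V\<^esub> \<psi> V s)),
      smult = (\<lambda>c \<phi>. restr_hom (base X) F U (\<lambda>V s. (\<lambda>x\<in>V. c) \<odot>\<^bsub>sec G V\<^esub> \<phi> V s))\<rparr>"

definition sheaf_hom :: "('a, 'a \<Rightarrow> complex) ringed_space \<Rightarrow> ('a, 'a \<Rightarrow> complex, 'm) presheaf \<Rightarrow>
    ('a, 'a \<Rightarrow> complex, 'k) presheaf \<Rightarrow> ('a, complex, ('a, 'm, 'k) sheaf_map) presheaf" where
  "sheaf_hom X F G = \<lparr>sec = hom_mod X F G, res = (\<lambda>U V. restr_hom (base X) F V)\<rparr>"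

definition signed :: "('r, 'm) module \<Rightarrow> int \<Rightarrow> 'm \<Rightarrow> 'm" where
  "signed M n x = (if even n then x else \<ominus>\<^bsub>M\<^esub> x)"

text \<open>
  The degree \<open>n\<close> term is the product over \<open>p\<close> of the sheaves \<open>Hom(F^p, G^(p+n))\<close>, and
  \<open>d \<Phi> = d \<circ> \<Phi> - (-1)^n \<Phi> \<circ> d\<close>.
\<close>

definition hom_complex :: "('a, 'a \<Rightarrow> complex) ringed_space \<Rightarrow> ('a, 'a \<Rightarrow> complex, 'm) sheaf_complex \<Rightarrow>
    ('a, 'a \<Rightarrow> complex, 'k) sheaf_complex \<Rightarrow> ('a, complex, ('a, 'm, 'k) chain_map) sheaf_complex" where
  "hom_complex X F G =
     \<lparr>ob = (\<lambda>n. \<lparr>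
        sec = (\<lambda>U. let H = (\<lambda>p. sec (sheaf_hom X (ob F p) (ob G (p + n))) U) in
          \<lparr>carrier = {\<Phi>. \<forall>p. \<Phi> p \<in> carrier (H p)},
           mult = undefined, one = undefined,
           zero = (\<lambda>p. \<zero>\<^bsub>H p\<^esub>),
           add = (\<lambda>\<Phi> \<Psi> p. \<Phi> p \<oplus>\<^bsub>H p\<^esub> \<Psi> p),
           smult = (\<lambda>c \<Phi> p. c \<odot>\<^bsub>H p\<^esub> \<Phi> p)\<rparr>),
        res = (\<lambda>U V \<Phi> p. res (sheaf_hom X (ob F p) (ob G (p + n))) U V (\<Phi> p))\<rparr>),
      dif = (\<lambda>n U \<Phi> p. restr_hom (base X) (ob F p) U (\<lambda>V s.
        dif G (p + n) V (\<Phi> p V s) \<ominus>\<^bsub>sec (ob G (p + n + 1)) V\<^esub>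
        signed (sec (ob G (p + n + 1)) V) n (\<Phi> (p + 1) V (dif F p V s))))\<rparr>"

definition hom_complex_map :: "('a, 'a \<Rightarrow> complex) ringed_space \<Rightarrow>
    ('a, 'a \<Rightarrow> complex, 'm) sheaf_complex \<Rightarrow> ('a, 'k, 'l) chain_map \<Rightarrow>
    ('a, ('a, 'm, 'k) chain_map, ('a, 'm, 'l) chain_map) chain_map" where
  "hom_complex_map X F f =
     (\<lambda>n U \<Phi> p. restr_hom (base X) (ob F p) U (\<lambda>V s. f (p + n) V (\<Phi> p V s)))"

definition injective_module :: "('a, 'r) ringed_space \<Rightarrow> ('a, 'r, 'm) presheaf \<Rightarrow> bool" where
  "injective_module X I \<longleftrightarrow> is_sheaf X I \<and>
     (\<forall>(F :: ('a, 'r, 'm) presheaf) (G :: ('a, 'r, 'm) presheaf) \<mu> f.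
        is_sheaf X F \<and> is_sheaf X G \<and> is_injective_hom X F G \<mu> \<and> is_hom X F I f \<longrightarrow>
        (\<exists>g. is_hom X G I g \<and>
           (\<forall>U. openin (base X) U \<longrightarrow> (\<forall>s\<in>sections F U. g U (\<mu> U s) = f U s))))"

definition injective_resolution :: "('a, 'a \<Rightarrow> complex) ringed_space \<Rightarrow>
    ('a, 'a \<Rightarrow> complex, 'm) sheaf_complex \<Rightarrow> ('a, 'a \<Rightarrow> complex, 'm) sheaf_complex \<Rightarrow>
    ('a, 'm, 'm) chain_map \<Rightarrow> bool" where
  "injective_resolution X C I i \<longleftrightarrow> is_complex X I \<and> (\<forall>k. injective_module X (ob I k)) \<and>
     (\<exists>N. \<forall>k<N. is_zero_sheaf X (ob I k)) \<and> quasi_iso X C I i"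

text \<open>
  The chain map \<open>v'\<close> represents the morphism \<open>v : C \<longrightarrow> D\<close> on injective resolutions
  \<open>i : C \<longrightarrow> I\<close> and \<open>j : D \<longrightarrow> J\<close>; it is unique up to homotopy.
\<close>

definition lifts_to_resolutions :: "('a, 'a \<Rightarrow> complex) ringed_space \<Rightarrow>
    ('a, 'a \<Rightarrow> complex, 'm) sheaf_complex \<Rightarrow> ('a, 'm, 'm) chain_map \<Rightarrow>
    ('a, 'a \<Rightarrow> complex, 'm) sheaf_complex \<Rightarrow> ('a, 'm, 'm) chain_map \<Rightarrow>
    ('a, 'm) roof \<Rightarrow> ('a, 'm, 'm) chain_map \<Rightarrow> bool" where
  "lifts_to_resolutions X I i J j v v' \<longleftrightarrow> is_chain_map X I J v' \<and>
     homotopic X (apex v) J (v' \<circ>\<^sub>c i \<circ>\<^sub>c bwd v) (j \<circ>\<^sub>c fwd v)"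

text \<open>
  \<open>RHom(F, C)\<close> is computed by \<open>hom_complex X F I\<close> for an injective resolution \<open>I\<close> of \<open>C\<close>, and
  \<open>RHom(F, v)\<close> by composition with a lift \<open>v'\<close> of \<open>v\<close>.
\<close>

definition Ext_sheaf :: "('a, 'a \<Rightarrow> complex) ringed_space \<Rightarrow> int \<Rightarrow>
    ('a, 'a \<Rightarrow> complex, 'm) sheaf_complex \<Rightarrow> ('a, 'a \<Rightarrow> complex, 'm) sheaf_complex \<Rightarrow>
    ('a, complex, 'a \<Rightarrow> ('a, ('a, 'm, 'm) chain_map set) germ) presheaf" where
  "Ext_sheaf X k F I = coh_sheaf (base X) (hom_complex X F I) k"

definition Ext_map :: "('a, 'a \<Rightarrow> complex) ringed_space \<Rightarrow> int \<Rightarrow>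
    ('a, 'a \<Rightarrow> complex, 'm) sheaf_complex \<Rightarrow> ('a, 'a \<Rightarrow> complex, 'm) sheaf_complex \<Rightarrow>
    ('a, 'm, 'm) chain_map \<Rightarrow>
    ('a, 'a \<Rightarrow> ('a, ('a, 'm, 'm) chain_map set) germ,
         'a \<Rightarrow> ('a, ('a, 'm, 'm) chain_map set) germ) sheaf_map" where
  "Ext_map X k F J v' = coh_sheaf_map (base X) (hom_complex X F J) (hom_complex_map X F v') k"


section \<open>Sheaf cohomology\<close>

text \<open>
  \<open>H^q(T, A)\<close> is the cohomology of the global sections of the canonical flasque (Godement) resolution
  \<open>A^[0] \<longrightarrow> A^[1] \<longrightarrow> \<dots>\<close>, where \<open>A^[0]\<close> is the sheaf of discontinuous sections of \<open>A\<close> and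
  \<open>A^[q] = (A^[q-1])^[0]\<close>.  In the simplicial description of that resolution a global section of
  \<open>A^[q]\<close> is represented by a function sending \<open>[x0, \<dots>, xq]\<close> to a germ of \<open>A\<close> at \<open>xq\<close>, where
  only points \<open>x1 \<in> V [x0]\<close>, \<dots>, \<open>xq \<in> V [x0, \<dots>, x(q-1)]\<close> in sufficiently small
  neighbourhoods \<open>V [x0, \<dots>, xj]\<close> of \<open>xj\<close> matter (relation \<open>gcochain_eq\<close>), and
  \<open>(d f) [x0, \<dots>, x(q+1)]\<close> is the sum over \<open>j \<le> q\<close> of the terms \<open>(-1)^j f [x0, \<dots>, x(q+1)]\<close> with \<open>xj\<close> omitted,
  plus \<open>(-1)^(q+1) f [x0, \<dots>, xq]\<close> propagated to \<open>x(q+1)\<close>.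
\<close>

definition glists :: "'a topology \<Rightarrow> nat \<Rightarrow> 'a list set" where
  "glists T q = {xs. length xs = Suc q \<and> set xs \<subseteq> topspace T}"

definition gcochains :: "'a topology \<Rightarrow> ('a, complex, 'm) presheaf \<Rightarrow> nat \<Rightarrow>
    (complex, 'a list \<Rightarrow> ('a, 'm) germ) module" where
  "gcochains T A q =
     \<lparr>carrier = (\<Pi>\<^sub>E xs\<in>glists T q. carrier (stalk T A (last xs))),
      mult = undefined, one = undefined,
      zero = (\<lambda>xs\<in>glists T q. \<zero>\<^bsub>stalk T A (last xs)\<^esub>),
      add = (\<lambda>f g. \<lambda>xs\<in>glists T q. f xs \<oplus>\<^bsub>stalk T A (last xs)\<^esub> g xs),
      smult = (\<lambda>c f. \<lambda>xs\<in>glists T q. c \<odot>\<^bsub>stalk T A (last xs)\<^esub> f xs)\<rparr>"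

definition gcochain_eq :: "'a topology \<Rightarrow> nat \<Rightarrow>
    ('a list \<Rightarrow> ('a, 'm) germ) \<Rightarrow> ('a list \<Rightarrow> ('a, 'm) germ) \<Rightarrow> bool" where
  "gcochain_eq T q f g \<longleftrightarrow>
     (\<exists>V. (\<forall>ys. ys \<noteq> [] \<and> set ys \<subseteq> topspace T \<longrightarrow> openin T (V ys) \<and> last ys \<in> V ys) \<and>
        (\<forall>xs\<in>glists T q. (\<forall>j<q. xs ! Suc j \<in> V (take (Suc j) xs)) \<longrightarrow> f xs = g xs))"

definition propagate :: "'a topology \<Rightarrow> ('a, complex, 'm) presheaf \<Rightarrow> ('a, 'm) germ \<Rightarrow> 'a \<Rightarrow> ('a, 'm) germ" where
  "propagate T A \<gamma> y =
     (let (U, s) = (SOME p. p \<in> \<gamma>) in if y \<in> U then germ T A y U s else \<zero>\<^bsub>stalk T A y\<^esub>)"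

definition gdiff :: "'a topology \<Rightarrow> ('a, complex, 'm) presheaf \<Rightarrow> nat \<Rightarrow>
    ('a list \<Rightarrow> ('a, 'm) germ) \<Rightarrow> ('a list \<Rightarrow> ('a, 'm) germ)" where
  "gdiff T A q f = (\<lambda>xs\<in>glists T (Suc q). let S = stalk T A (last xs) in
     finsum S (\<lambda>j. signed S (int j) (f (take j xs @ drop (Suc j) xs))) {..q}
     \<oplus>\<^bsub>S\<^esub> signed S (int (Suc q)) (propagate T A (f (butlast xs)) (last xs)))"

definition gcocycles :: "'a topology \<Rightarrow> ('a, complex, 'm) presheaf \<Rightarrow> nat \<Rightarrow>
    (complex, 'a list \<Rightarrow> ('a, 'm) germ) module" where
  "gcocycles T A q = (gcochains T A q)\<lparr>carrier := {f \<in> carrier (gcochains T A q).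
     gcochain_eq T (Suc q) (gdiff T A q f) \<zero>\<^bsub>gcochains T A (Suc q)\<^esub>}\<rparr>"

definition gcoboundaries :: "'a topology \<Rightarrow> ('a, complex, 'm) presheaf \<Rightarrow> nat \<Rightarrow>
    ('a list \<Rightarrow> ('a, 'm) germ) set" where
  "gcoboundaries T A q = {f \<in> carrier (gcochains T A q).
     case q of 0 \<Rightarrow> gcochain_eq T 0 f \<zero>\<^bsub>gcochains T A 0\<^esub>
     | Suc p \<Rightarrow> \<exists>g\<in>carrier (gcochains T A p). gcochain_eq T q f (gdiff T A p g)}"

definition sheaf_cohomology :: "'a topology \<Rightarrow> ('a, complex, 'm) presheaf \<Rightarrow> nat \<Rightarrow>
    (complex, ('a list \<Rightarrow> ('a, 'm) germ) set) module" where
  "sheaf_cohomology T A q = quot_mod (gcocycles T A q) (gcoboundaries T A q)"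

definition sheaf_cohomology_map :: "'a topology \<Rightarrow> ('a, complex, 'k) presheaf \<Rightarrow> ('a, 'm, 'k) sheaf_map \<Rightarrow>
    nat \<Rightarrow> ('a list \<Rightarrow> ('a, 'm) germ) set \<Rightarrow> ('a list \<Rightarrow> ('a, 'k) germ) set" where
  "sheaf_cohomology_map T A' \<phi> q = quot_map (gcocycles T A' q) (gcoboundaries T A' q)
     (\<lambda>f. \<lambda>xs\<in>glists T q. stalk_map T A' \<phi> (last xs) (f xs))"


section \<open>Long exact sequences\<close>

definition exact_at :: "('r, 'm) module \<Rightarrow> ('r, 'k) module \<Rightarrow> ('r, 'l) module \<Rightarrow>
    ('m \<Rightarrow> 'k) \<Rightarrow> ('k \<Rightarrow> 'l) \<Rightarrow> bool" where
  "exact_at M N P f g \<longleftrightarrow> f ` carrier M = {y \<in> carrier N. g y = \<zero>\<^bsub>P\<^esub>}"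

text \<open>
  The sequence
  \<open>0 \<longrightarrow> A 0 \<longrightarrow> B 0 \<longrightarrow> C 0 \<longrightarrow> A 1 \<longrightarrow> B 1 \<longrightarrow> \<dots>\<close> of complex vector spaces with maps
  \<open>f q : A q \<longrightarrow> B q\<close>, \<open>g q : B q \<longrightarrow> C q\<close> and \<open>\<delta> q : C q \<longrightarrow> A (q + 1)\<close> is exact.
\<close>

definition long_exact_sequence :: "(nat \<Rightarrow> (complex, 'l) module) \<Rightarrow> (nat \<Rightarrow> (complex, 'm) module) \<Rightarrow>
    (nat \<Rightarrow> (complex, 'k) module) \<Rightarrow> (nat \<Rightarrow> 'l \<Rightarrow> 'm) \<Rightarrow> (nat \<Rightarrow> 'm \<Rightarrow> 'k) \<Rightarrow> (nat \<Rightarrow> 'k \<Rightarrow> 'l) \<Rightarrow> bool" where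
  "long_exact_sequence A B C f g \<delta> \<longleftrightarrow>
     (\<forall>q. Module.module complex_ring (A q) \<and> Module.module complex_ring (B q) \<and>
        Module.module complex_ring (C q)) \<and>
     (\<forall>q. linear_map complex_ring (A q) (B q) (f q) \<and>
        linear_map complex_ring (B q) (C q) (g q) \<and>
        linear_map complex_ring (C q) (A (Suc q)) (\<delta> q)) \<and>
     inj_on (f 0) (carrier (A 0)) \<and>
     (\<forall>q. exact_at (A q) (B q) (C q) (f q) (g q) \<and>
        exact_at (B q) (C q) (A (Suc q)) (g q) (\<delta> q) \<and>
        exact_at (C q) (A (Suc q)) (B (Suc q)) (\<delta> q) (f (Suc q)))"

end

theory Submission
  imports Defs
begin

text \<open>
  The sequence is the cohomology sequence of the short exact sequence of sheaves
  \<open>0 \<rightarrow> Ker \<beta> \<rightarrow> Ext(F, C) \<rightarrow> Im \<beta> \<rightarrow> 0\<close>.  Godement cochains depend only on the stalks, so that stalkwise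
  exactness makes the cochain modules exact, and the snake lemma applies.  Two points need care.
  Cochains, and with them all identities between cochains, are only defined up to shrinking of
  neighbourhoods; the snake lemma is therefore proved for complexes with a congruence in place of equality.
  The differential squares to zero because it satisfies
  \<open>(d f)(x, ys) = f(ys) - (d f(x, \<cdot>))(ys)\<close>, which turns the simplicial identities into an induction.
  That \<open>\<beta>\<close> is a morphism of sheaves of complex vector spaces rests on constant functions being
  holomorphic, and on the Hom complex of complexes of modules being a complex.
\<close>

section \<open>Complex vector spaces\<close>

text \<open>The failure of strict identities has a single source: \<open>propagate\<close> continues
  a germ to nearby points by a representative picked with \<open>SOME\<close>, and by zero outside
  its domain. Linearity, naturality and the composition law of these continuations therefore hold
  only near the point, while all other terms of the differential behave strictly. Recursion on the
  first point of a list leaves the propagated term for the end, so each identity comes down to lists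
  of one or two points, that is, to a statement about \<open>propagate\<close> alone. Cochains are
  arbitrary functions with values in stalks, so preimages can be chosen list by list: stalkwise
  exactness passes to cochains without gluing and without an acyclicity argument. Exactness on
  stalks in turn is close to the definitions: membership in the image is local liftability, and a
  germ killed by \<beta> is represented on a smaller open set by a section of the kernel.\<close>

lemma complex_ring_simps [simp]:
  "carrier complex_ring = UNIV" "\<zero>\<^bsub>complex_ring\<^esub> = 0" "\<one>\<^bsub>complex_ring\<^esub> = 1"
  "a \<oplus>\<^bsub>complex_ring\<^esub> b = a + b" "a \<otimes>\<^bsub>complex_ring\<^esub> b = a * b"
  by (simp_all add: complex_ring_def)

lemma cring_complex_ring: "cring complex_ring"
proof (intro cringI abelian_groupI comm_monoidI)
  fix x :: complex
  assume "x \<in> carrier complex_ring"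
  show "\<exists>y\<in>carrier complex_ring. y \<oplus>\<^bsub>complex_ring\<^esub> x = \<zero>\<^bsub>complex_ring\<^esub>"
    by (intro bexI[of _ "- x"]) auto
qed (auto simp: algebra_simps)

abbreviation complex_module :: "(complex, 'm) module \<Rightarrow> bool" where
  "complex_module \<equiv> Module.module complex_ring"

text \<open>The law \<open>0 \<odot> x = \<zero>\<close> stands in for additive inverses: with
  distributivity it makes \<open>(-1) \<odot> x\<close> an inverse of \<open>x\<close>. This suits
  quotients, stalks and function modules, whose records come with scalars but without an explicit
  negation.\<close>

lemma complex_moduleI:
  fixes M (structure)
  assumes "\<zero> \<in> carrier M"
    and "\<And>x y. x \<in> carrier M \<Longrightarrow> y \<in> carrier M \<Longrightarrow> x \<oplus> y \<in> carrier M"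
    and smult: "\<And>a x. x \<in> carrier M \<Longrightarrow> a \<odot> x \<in> carrier M"
    and "\<And>x y z. x \<in> carrier M \<Longrightarrow> y \<in> carrier M \<Longrightarrow> z \<in> carrier M \<Longrightarrow> (x \<oplus> y) \<oplus> z = x \<oplus> (y \<oplus> z)"
    and "\<And>x y. x \<in> carrier M \<Longrightarrow> y \<in> carrier M \<Longrightarrow> x \<oplus> y = y \<oplus> x"
    and "\<And>x. x \<in> carrier M \<Longrightarrow> \<zero> \<oplus> x = x"
    and distr: "\<And>a b x. x \<in> carrier M \<Longrightarrow> (a + b) \<odot> x = a \<odot> x \<oplus> b \<odot> x"
    and "\<And>a x y. x \<in> carrier M \<Longrightarrow> y \<in> carrier M \<Longrightarrow> a \<odot> (x \<oplus> y) = a \<odot> x \<oplus> a \<odot> y"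
    and "\<And>a b x. x \<in> carrier M \<Longrightarrow> (a * b) \<odot> x = a \<odot> (b \<odot> x)"
    and one: "\<And>x. x \<in> carrier M \<Longrightarrow> 1 \<odot> x = x"
    and null: "\<And>x. x \<in> carrier M \<Longrightarrow> 0 \<odot> x = \<zero>"
  shows "complex_module M"
proof (intro moduleI cring_complex_ring abelian_groupI)
  fix x
  assume x: "x \<in> carrier M"
  have "(-1) \<odot> x \<oplus> x = \<zero>"
    using distr[OF x, of "-1" 1] one[OF x] null[OF x] by simp
  then show "\<exists>y\<in>carrier M. y \<oplus> x = \<zero>"
    using smult[OF x] by blast
qed (use assms in auto)

lemma (in Module.module) smult_minus_one:
  "x \<in> carrier M \<Longrightarrow> (\<ominus> \<one>) \<odot>\<^bsub>M\<^esub> x = \<ominus>\<^bsub>M\<^esub> x"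
  by (simp add: smult_l_minus)

lemma complex_module_minus:
  assumes "complex_module M" "x \<in> carrier M"
  shows "\<ominus>\<^bsub>M\<^esub> x = (-1) \<odot>\<^bsub>M\<^esub> x"
proof -
  interpret Module.module complex_ring M by fact
  have "\<ominus>\<^bsub>complex_ring\<^esub> \<one>\<^bsub>complex_ring\<^esub> = -1"
    by (rule R.minus_equality) auto
  then show ?thesis using smult_minus_one[OF assms(2)] by simp
qed

lemma complex_submodule:
  assumes "complex_module M" "N \<subseteq> carrier M" "\<zero>\<^bsub>M\<^esub> \<in> N"
    and "\<And>x y. x \<in> N \<Longrightarrow> y \<in> N \<Longrightarrow> x \<oplus>\<^bsub>M\<^esub> y \<in> N"
    and "\<And>a x. x \<in> N \<Longrightarrow> a \<odot>\<^bsub>M\<^esub> x \<in> N"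
  shows "complex_module (M\<lparr>carrier := N\<rparr>)"
proof -
  interpret Module.module complex_ring M by fact
  have N: "x \<in> carrier M" if "x \<in> N" for x using assms(2) that by blast
  show ?thesis
    by (rule complex_moduleI)
      (use assms(3-5) smult_l_null smult_one in
        \<open>auto simp: N M.a_ac smult_r_distr smult_assoc1[simplified] smult_l_distr[simplified]\<close>)
qed

lemma linear_map_minus:
  assumes "complex_module M" "complex_module N" "linear_map complex_ring M N f" "x \<in> carrier M"
  shows "f (\<ominus>\<^bsub>M\<^esub> x) = \<ominus>\<^bsub>N\<^esub> f x"
  using assms by (simp add: linear_map_def complex_module_minus)

text \<open>Over an arbitrary ring, because it is applied both to complex linear maps and to maps
  that are linear over the sections of a structure sheaf.\<close>

lemma linear_map_zero:
  assumes "Module.module R M" "Module.module R N" "linear_map R M N f"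
  shows "f \<zero>\<^bsub>M\<^esub> = \<zero>\<^bsub>N\<^esub>"
proof -
  interpret M: Module.module R M by fact
  interpret N: Module.module R N by fact
  have closed: "f \<zero>\<^bsub>M\<^esub> \<in> carrier N"
    using assms(3) M.M.zero_closed unfolding linear_map_def by blast
  have "f (\<zero>\<^bsub>M\<^esub> \<oplus>\<^bsub>M\<^esub> \<zero>\<^bsub>M\<^esub>) = f \<zero>\<^bsub>M\<^esub> \<oplus>\<^bsub>N\<^esub> f \<zero>\<^bsub>M\<^esub>"
    using assms(3) M.M.zero_closed unfolding linear_map_def by blast
  then show ?thesis using N.M.add.l_cancel_one'[OF closed closed] by simp
qed

text \<open>Differences are written as \<open>x\<close> plus \<open>-1\<close> times
  \<open>y\<close>. The additive inverse of a record is defined by a description that ranges over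
  its carrier, so the term changes when the carrier is cut down to cocycles; the scalar multiple
  does not, and linear maps pass through it directly.\<close>

lemma complex_module_add_cancel:
  assumes "complex_module M" "x \<in> carrier M" "y \<in> carrier M"
  shows "x \<oplus>\<^bsub>M\<^esub> (-1) \<odot>\<^bsub>M\<^esub> x = \<zero>\<^bsub>M\<^esub>" "(x \<oplus>\<^bsub>M\<^esub> (-1) \<odot>\<^bsub>M\<^esub> y) \<oplus>\<^bsub>M\<^esub> y = x"
    "x \<oplus>\<^bsub>M\<^esub> (-1) \<odot>\<^bsub>M\<^esub> (x \<oplus>\<^bsub>M\<^esub> (-1) \<odot>\<^bsub>M\<^esub> y) = y"
proof -
  interpret Module.module complex_ring M by fact
  show "x \<oplus>\<^bsub>M\<^esub> (-1) \<odot>\<^bsub>M\<^esub> x = \<zero>\<^bsub>M\<^esub>" "(x \<oplus>\<^bsub>M\<^esub> (-1) \<odot>\<^bsub>M\<^esub> y) \<oplus>\<^bsub>M\<^esub> y = x"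
    using assms by (simp_all add: M.a_assoc M.l_neg M.r_neg flip: complex_module_minus[OF assms(1)])
  show "x \<oplus>\<^bsub>M\<^esub> (-1) \<odot>\<^bsub>M\<^esub> (x \<oplus>\<^bsub>M\<^esub> (-1) \<odot>\<^bsub>M\<^esub> y) = y"
    using assms by (simp add: M.minus_add M.r_neg flip: complex_module_minus[OF assms(1)] M.a_assoc)
qed

lemma complex_module_smult:
  assumes "complex_module M" "x \<in> carrier M"
  shows "1 \<odot>\<^bsub>M\<^esub> x = x" "0 \<odot>\<^bsub>M\<^esub> x = \<zero>\<^bsub>M\<^esub>" "c \<odot>\<^bsub>M\<^esub> \<zero>\<^bsub>M\<^esub> = \<zero>\<^bsub>M\<^esub>" "a \<odot>\<^bsub>M\<^esub> (b \<odot>\<^bsub>M\<^esub> x) = (a * b) \<odot>\<^bsub>M\<^esub> x"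
proof -
  interpret Module.module complex_ring M by fact
  have *: "a \<odot>\<^bsub>M\<^esub> (b \<odot>\<^bsub>M\<^esub> x) = (a * b) \<odot>\<^bsub>M\<^esub> x" for a b
    using smult_assoc1[of a b x] assms(2) by simp
  show "a \<odot>\<^bsub>M\<^esub> (b \<odot>\<^bsub>M\<^esub> x) = (a * b) \<odot>\<^bsub>M\<^esub> x" by (rule *)
  show "1 \<odot>\<^bsub>M\<^esub> x = x" "0 \<odot>\<^bsub>M\<^esub> x = \<zero>\<^bsub>M\<^esub>" "c \<odot>\<^bsub>M\<^esub> \<zero>\<^bsub>M\<^esub> = \<zero>\<^bsub>M\<^esub>"
    using smult_one[OF assms(2)] smult_l_null[OF assms(2)] smult_r_null[of c] by simp_all
qed

text \<open>The evaluations embed \<open>M\<close> into the product of the \<open>N i\<close>, so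
  every module law may be tested at each index. Cochains, sections of associated sheaves, sections
  of Hom sheaves and products are all handled in this way.\<close>

lemma complex_module_of_evaluation:
  assumes N: "\<And>i. i \<in> I \<Longrightarrow> complex_module (N i)"
    and e: "\<And>i x. i \<in> I \<Longrightarrow> x \<in> carrier M \<Longrightarrow> e i x \<in> carrier (N i)"
    and zero: "\<zero>\<^bsub>M\<^esub> \<in> carrier M" "\<And>i. i \<in> I \<Longrightarrow> e i \<zero>\<^bsub>M\<^esub> = \<zero>\<^bsub>N i\<^esub>"
    and add: "\<And>x y. x \<in> carrier M \<Longrightarrow> y \<in> carrier M \<Longrightarrow> x \<oplus>\<^bsub>M\<^esub> y \<in> carrier M"
      "\<And>i x y. i \<in> I \<Longrightarrow> x \<in> carrier M \<Longrightarrow> y \<in> carrier M \<Longrightarrow> e i (x \<oplus>\<^bsub>M\<^esub> y) = e i x \<oplus>\<^bsub>N i\<^esub> e i y"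
    and smult: "\<And>c x. x \<in> carrier M \<Longrightarrow> c \<odot>\<^bsub>M\<^esub> x \<in> carrier M"
      "\<And>i c x. i \<in> I \<Longrightarrow> x \<in> carrier M \<Longrightarrow> e i (c \<odot>\<^bsub>M\<^esub> x) = c \<odot>\<^bsub>N i\<^esub> e i x"
    and eqI: "\<And>x y. x \<in> carrier M \<Longrightarrow> y \<in> carrier M \<Longrightarrow> (\<And>i. i \<in> I \<Longrightarrow> e i x = e i y) \<Longrightarrow> x = y"
  shows "complex_module M"
proof -
  note G = N[THEN Module.module.axioms(2), THEN abelian_group.axioms(1)]
  note simps = zero add smult e abelian_monoid.a_ac[OF G] abelian_monoid.l_zero[OF G]
    abelian_monoid.r_zero[OF G] Module.module.smult_r_distr[OF N]
    Module.module.smult_l_distr[OF N, simplified] Module.module.smult_assoc1[OF N, simplified]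
    Module.module.smult_one[OF N, simplified] Module.module.smult_l_null[OF N, simplified]
  show ?thesis by (rule complex_moduleI) (assumption | rule zero add smult | rule eqI; simp add: simps)+
qed

text \<open>The effect of one unfolding of a differential on the combination \<open>c\<close> times
  the first argument plus the second: \<open>e = -1\<close> occurs in the recursion of the Godement
  differential, \<open>e = hom_sign n\<close> in the differential of the Hom complex.\<close>

lemma complex_module_rearrange:
  assumes "complex_module M" "x \<in> carrier M" "y \<in> carrier M" "x' \<in> carrier M" "y' \<in> carrier M"
  shows "c \<odot>\<^bsub>M\<^esub> x \<oplus>\<^bsub>M\<^esub> x' \<oplus>\<^bsub>M\<^esub> e \<odot>\<^bsub>M\<^esub> (c \<odot>\<^bsub>M\<^esub> y \<oplus>\<^bsub>M\<^esub> y') =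
    c \<odot>\<^bsub>M\<^esub> (x \<oplus>\<^bsub>M\<^esub> e \<odot>\<^bsub>M\<^esub> y) \<oplus>\<^bsub>M\<^esub> (x' \<oplus>\<^bsub>M\<^esub> e \<odot>\<^bsub>M\<^esub> y')"
proof -
  interpret Module.module complex_ring M by fact
  show ?thesis
    using assms smult_assoc1[of e c y] smult_assoc1[of c e y]
    by (simp add: smult_r_distr M.a_ac mult.commute)
qed

lemma linear_mapI:
  assumes "complex_module M" "complex_module N" "\<And>x. x \<in> carrier M \<Longrightarrow> f x \<in> carrier N"
    and comb: "\<And>c x y. x \<in> carrier M \<Longrightarrow> y \<in> carrier M \<Longrightarrow>
      f (c \<odot>\<^bsub>M\<^esub> x \<oplus>\<^bsub>M\<^esub> y) = c \<odot>\<^bsub>N\<^esub> f x \<oplus>\<^bsub>N\<^esub> f y"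
  shows "linear_map complex_ring M N f"
proof -
  interpret M: Module.module complex_ring M by fact
  interpret N: Module.module complex_ring N by fact
  have one: "x \<in> carrier M \<Longrightarrow> 1 \<odot>\<^bsub>M\<^esub> x = x" "y \<in> carrier N \<Longrightarrow> 1 \<odot>\<^bsub>N\<^esub> y = y" for x y
    using M.smult_one N.smult_one by simp_all
  have null: "(-1) \<odot>\<^bsub>M\<^esub> \<zero>\<^bsub>M\<^esub> = \<zero>\<^bsub>M\<^esub>" using M.smult_r_null[of "-1"] by simp
  \<comment> \<open>With both arguments zero and \<open>c = -1\<close>, the hypothesis reads
    \<open>f 0 = - f 0 + f 0\<close>.\<close>
  have zero: "f \<zero>\<^bsub>M\<^esub> = \<zero>\<^bsub>N\<^esub>"
    using comb[OF M.M.zero_closed M.M.zero_closed, of "-1"] assms(3)[OF M.M.zero_closed]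
    by (simp add: null N.M.l_neg flip: complex_module_minus[OF assms(2)])
  show ?thesis
    using assms(3) comb[of _ _ 1] comb[OF _ M.M.zero_closed] M.smult_closed N.smult_closed
    by (simp add: linear_map_def one zero)
qed

section \<open>Quotients of complex vector spaces and the maps between them\<close>

locale quotient_module = Module.module complex_ring M for M :: "(complex, 'm) module" (structure) +
  fixes N
  assumes N_sub: "N \<subseteq> carrier M" and N_zero: "\<zero> \<in> N"
    and N_add: "x \<in> N \<Longrightarrow> y \<in> N \<Longrightarrow> x \<oplus> y \<in> N"
    and N_smult: "x \<in> N \<Longrightarrow> a \<odot> x \<in> N"
begin

abbreviation "cls x \<equiv> N +> x"

lemma module_M: "complex_module M" ..

lemma subgroup: "abelian_subgroup N M"
proof (rule abelian_subgroupI3)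
  show "additive_subgroup N M"
  proof
    show "N \<subseteq> carrier (add_monoid M)" using N_sub by simp
    fix x assume "x \<in> N"
    then have "\<ominus> x \<in> N"
      using N_smult[of x "-1"] N_sub complex_module_minus[OF module_M, of x] by auto
    then show "inv\<^bsub>add_monoid M\<^esub> x \<in> N" by (simp add: a_inv_def)
  qed (use N_zero N_add in auto)
qed (rule M.abelian_group_axioms)

sublocale abelian_subgroup N M by (rule subgroup)

lemma cls_eq_iff: "x \<in> carrier M \<Longrightarrow> y \<in> carrier M \<Longrightarrow> cls x = cls y \<longleftrightarrow> x \<ominus> y \<in> N"
  using a_rcos_module[of y x] a_repr_independence'[of x y] a_rcos_self[of x]
  unfolding a_minus_def by metis

lemma cls_eqI: "x \<in> carrier M \<Longrightarrow> y \<in> carrier M \<Longrightarrow> x \<ominus> y \<in> N \<Longrightarrow> cls x = cls y"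
  by (simp add: cls_eq_iff)

lemma cls_zero: "cls \<zero> = N"
  using N_sub M.a_coset_add_zero by blast

lemma cls_eq_zero_iff: "x \<in> carrier M \<Longrightarrow> cls x = N \<longleftrightarrow> x \<in> N"
  using a_rcos_self[of x] M.a_coset_join2[OF _ a_subgroup, of x] by auto

lemma in_clsD:
  assumes "x \<in> carrier M" "y \<in> cls x"
  shows "y \<in> carrier M" "cls y = cls x"
  using a_elemrcos_carrier[OF assms] a_repr_independence'[OF assms(2,1)] by simp_all

lemma self_in_cls: "x \<in> carrier M \<Longrightarrow> x \<in> cls x"
  by (rule a_rcos_self)

lemma carrier_quot: "carrier (quot_mod M N) = cls ` carrier M"
  by (auto simp: quot_mod_def A_RCOSETS_def' )

lemma add_quot: "x \<in> carrier M \<Longrightarrow> y \<in> carrier M \<Longrightarrow> cls x \<oplus>\<^bsub>quot_mod M N\<^esub> cls y = cls (x \<oplus> y)"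
  by (simp add: quot_mod_def a_rcos_sum)

lemma zero_quot: "\<zero>\<^bsub>quot_mod M N\<^esub> = cls \<zero>"
  by (simp add: quot_mod_def cls_zero)

text \<open>\<open>quot_mod\<close> defines the multiple as a union over all representatives. For
  \<open>y\<close> in the class of \<open>x\<close> the difference of the multiples is
  \<open>c\<close> times an element of \<open>N\<close>, so all cosets in the union coincide, and
  the union is nonempty because \<open>x\<close> lies in its own class.\<close>

lemma smult_quot:
  assumes x: "x \<in> carrier M"
  shows "c \<odot>\<^bsub>quot_mod M N\<^esub> cls x = cls (c \<odot> x)"
proof -
  have "cls (c \<odot> y) = cls (c \<odot> x)" if y: "y \<in> cls x" for y
  proof -
    have y': "y \<in> carrier M" "y \<ominus> x \<in> N"
      using in_clsD[OF x y] x by (auto simp: cls_eq_iff)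
    have "c \<odot> y \<ominus> c \<odot> x = c \<odot> (y \<ominus> x)"
      using y' x by (simp add: a_minus_def smult_r_distr smult_r_minus)
    then show ?thesis using y' x by (intro cls_eqI) (auto intro: N_smult)
  qed
  then have "(\<Union>y\<in>cls x. cls (c \<odot> y)) = cls (c \<odot> x)"
    using self_in_cls[OF x] by (intro SUP_eq_const) blast+
  then show ?thesis by (simp add: quot_mod_def)
qed

lemma complex_module_quot: "complex_module (quot_mod M N)"
  by (rule complex_moduleI)
    (auto simp: carrier_quot zero_quot add_quot smult_quot M.a_ac
       smult_r_distr smult_l_distr[simplified] smult_assoc1[simplified] smult_one[simplified]
       smult_l_null[simplified])

end

lemma (in quotient_module) cls_eq_iff_diff:
  "x \<in> carrier M \<Longrightarrow> y \<in> carrier M \<Longrightarrow> cls x = cls y \<longleftrightarrow> x \<oplus> (-1) \<odot> y \<in> N"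
  by (simp add: cls_eq_iff a_minus_def complex_module_minus[OF module_M])

lemma (in quotient_module) cls_eq_zero_quot_iff:
  "x \<in> carrier M \<Longrightarrow> cls x = \<zero>\<^bsub>quot_mod M N\<^esub> \<longleftrightarrow> x \<in> N"
  by (simp add: quot_mod_def cls_eq_zero_iff)

locale quotient_module_map = M: quotient_module M N + M': quotient_module M' N'
  for M :: "(complex, 'm) module" and N and M' :: "(complex, 'k) module" and N' +
  fixes f
  assumes f_linear: "linear_map complex_ring M M' f"
    and f_N: "x \<in> N \<Longrightarrow> f x \<in> N'"
begin

lemma f_closed: "x \<in> carrier M \<Longrightarrow> f x \<in> carrier M'"
  using f_linear by (simp add: linear_map_def)

lemma f_diff:
  "x \<in> carrier M \<Longrightarrow> y \<in> carrier M \<Longrightarrow> f (x \<ominus>\<^bsub>M\<^esub> y) = f x \<ominus>\<^bsub>M'\<^esub> f y"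
  using linear_map_minus[OF M.module_M M'.module_M f_linear] f_linear
  by (simp add: a_minus_def linear_map_def)

lemma quot_map_cls:
  assumes x: "x \<in> carrier M"
  shows "quot_map M' N' f (M.cls x) = M'.cls (f x)"
proof -
  have "M'.cls (f y) = M'.cls (f x)" if y: "y \<in> M.cls x" for y
    using M.in_clsD[OF x y] x f_N by (intro M'.cls_eqI) (auto simp: f_closed M.cls_eq_iff simp flip: f_diff)
  then show ?thesis
    unfolding quot_map_def using M.self_in_cls[OF x] by (intro SUP_eq_const) blast+
qed

lemma linear_map_quot: "linear_map complex_ring (quot_mod M N) (quot_mod M' N') (quot_map M' N' f)"
  using f_linear
  by (auto simp: linear_map_def M.carrier_quot M'.carrier_quot quot_map_cls f_closed
      M.add_quot M'.add_quot M.smult_quot M'.smult_quot)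

end

lemma linear_map_quotI:
  assumes "quotient_module M N" "quotient_module M' N'"
    and "\<And>x. x \<in> carrier M \<Longrightarrow> f (N +>\<^bsub>M\<^esub> x) \<in> carrier (quot_mod M' N')"
    and "\<And>x y. x \<in> carrier M \<Longrightarrow> y \<in> carrier M \<Longrightarrow>
      f ((N +>\<^bsub>M\<^esub> x) \<oplus>\<^bsub>quot_mod M N\<^esub> (N +>\<^bsub>M\<^esub> y)) = f (N +>\<^bsub>M\<^esub> x) \<oplus>\<^bsub>quot_mod M' N'\<^esub> f (N +>\<^bsub>M\<^esub> y)"
    and "\<And>c x. x \<in> carrier M \<Longrightarrow>
      f (c \<odot>\<^bsub>quot_mod M N\<^esub> (N +>\<^bsub>M\<^esub> x)) = c \<odot>\<^bsub>quot_mod M' N'\<^esub> f (N +>\<^bsub>M\<^esub> x)"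
  shows "linear_map complex_ring (quot_mod M N) (quot_mod M' N') f"
  using assms by (simp add: linear_map_def quotient_module.carrier_quot)

text \<open>The abstract form of a connecting homomorphism.\<close>

lemma linear_map_of_relation:
  assumes "quotient_module M N" "quotient_module M' N'"
    and closed: "\<And>x y. r x y \<Longrightarrow> x \<in> carrier M \<and> y \<in> carrier M'"
    and total: "\<And>x. x \<in> carrier M \<Longrightarrow> \<exists>y. r x y"
    and add: "\<And>x y x' y'. r x y \<Longrightarrow> r x' y' \<Longrightarrow> r (x \<oplus>\<^bsub>M\<^esub> x') (y \<oplus>\<^bsub>M'\<^esub> y')"
    and smult: "\<And>c x y. r x y \<Longrightarrow> r (c \<odot>\<^bsub>M\<^esub> x) (c \<odot>\<^bsub>M'\<^esub> y)"
    and null: "\<And>x y. r x y \<Longrightarrow> x \<in> N \<Longrightarrow> y \<in> N'"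
  shows "\<exists>\<delta>. linear_map complex_ring (quot_mod M N) (quot_mod M' N') \<delta> \<and>
    (\<forall>x y. r x y \<longrightarrow> \<delta> (N +>\<^bsub>M\<^esub> x) = N' +>\<^bsub>M'\<^esub> y)"
proof -
  interpret M: quotient_module M N by fact
  interpret M': quotient_module M' N' by fact
  \<comment> \<open>The choice is made once per class \<open>X\<close>, among all pairs of
    \<open>r\<close> whose first component represents \<open>X\<close>.\<close>
  define \<delta> where "\<delta> X = (SOME Y. \<exists>x y. r x y \<and> X = M.cls x \<and> Y = M'.cls y)" for X
  \<comment> \<open>Closure under differences reduces independence of the choices to
    \<open>null\<close>: two pairs over the same class differ by a pair whose first component lies
    in \<open>N\<close>.\<close>
  have diff: "r (x \<ominus>\<^bsub>M\<^esub> x') (y \<ominus>\<^bsub>M'\<^esub> y')" if "r x y" "r x' y'" for x x' y y'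
    using add[OF that(1) smult[OF that(2), of "-1"]] closed[OF that(1)] closed[OF that(2)]
    by (simp add: a_minus_def complex_module_minus M.module_M M'.module_M)
  have \<delta>: "\<delta> (M.cls x) = M'.cls y" if xy: "r x y" for x y
  proof -
    have "\<exists>x' y'. r x' y' \<and> M.cls x = M.cls x' \<and> \<delta> (M.cls x) = M'.cls y'"
      unfolding \<delta>_def by (rule someI_ex) (use xy in blast)
    then obtain x' y' where *: "r x' y'" "M.cls x = M.cls x'" "\<delta> (M.cls x) = M'.cls y'"
      by blast
    then have "x' \<ominus>\<^bsub>M\<^esub> x \<in> N"
      using closed[OF xy] closed[OF *(1)] M.cls_eq_iff[of x' x] by auto
    then show ?thesis
      using null[OF diff[OF *(1) xy]] closed[OF xy] closed[OF *(1)] * M'.cls_eq_iff[of y' y] by simp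
  qed
  have "linear_map complex_ring (quot_mod M N) (quot_mod M' N') \<delta>"
  proof (rule linear_map_quotI[OF assms(1,2)])
    fix x assume x: "x \<in> carrier M"
    obtain y where y: "r x y" using total[OF x] by blast
    then show "\<delta> (M.cls x) \<in> carrier (quot_mod M' N')"
      using \<delta>[OF y] closed[OF y] by (auto simp: M'.carrier_quot)
    show "\<delta> (c \<odot>\<^bsub>quot_mod M N\<^esub> M.cls x) = c \<odot>\<^bsub>quot_mod M' N'\<^esub> \<delta> (M.cls x)" for c
      using \<delta>[OF y] \<delta>[OF smult[OF y, of c]] closed[OF y] by (simp add: M.smult_quot M'.smult_quot)
    fix x' assume x': "x' \<in> carrier M"
    obtain y' where y': "r x' y'" using total[OF x'] by blast
    then show "\<delta> (M.cls x \<oplus>\<^bsub>quot_mod M N\<^esub> M.cls x') = \<delta> (M.cls x) \<oplus>\<^bsub>quot_mod M' N'\<^esub> \<delta> (M.cls x')"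
      using \<delta>[OF y] \<delta>[OF y'] \<delta>[OF add[OF y y']] closed[OF y] closed[OF y']
      by (simp add: M.add_quot M'.add_quot)
  qed
  then show ?thesis using \<delta> by blast
qed

section \<open>Long exact sequences up to congruence\<close>

text \<open>Godement cochains represent sections only up to \<open>gcochain_eq\<close>, and their differential is linear and
  squares to zero only up to it; \<open>E\<close> stands for this congruence.\<close>

locale quasi_complex =
  fixes M :: "nat \<Rightarrow> (complex, 'm) module" and E :: "nat \<Rightarrow> 'm \<Rightarrow> 'm \<Rightarrow> bool"
    and d :: "nat \<Rightarrow> 'm \<Rightarrow> 'm"
  assumes module: "complex_module (M q)"
    and E_refl: "E q x x"
    and E_sym: "E q x y \<Longrightarrow> E q y x"
    and E_trans [trans]: "E q x y \<Longrightarrow> E q y z \<Longrightarrow> E q x z"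
    and E_add: "E q x x' \<Longrightarrow> E q y y' \<Longrightarrow> E q (x \<oplus>\<^bsub>M q\<^esub> y) (x' \<oplus>\<^bsub>M q\<^esub> y')"
    and E_smult: "E q x y \<Longrightarrow> E q (c \<odot>\<^bsub>M q\<^esub> x) (c \<odot>\<^bsub>M q\<^esub> y)"
    and d_closed: "x \<in> carrier (M q) \<Longrightarrow> d q x \<in> carrier (M (Suc q))"
    and d_add: "x \<in> carrier (M q) \<Longrightarrow> y \<in> carrier (M q) \<Longrightarrow>
      E (Suc q) (d q (x \<oplus>\<^bsub>M q\<^esub> y)) (d q x \<oplus>\<^bsub>M (Suc q)\<^esub> d q y)"
    and d_smult: "x \<in> carrier (M q) \<Longrightarrow> E (Suc q) (d q (c \<odot>\<^bsub>M q\<^esub> x)) (c \<odot>\<^bsub>M (Suc q)\<^esub> d q x)"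
    and d_cong: "x \<in> carrier (M q) \<Longrightarrow> y \<in> carrier (M q) \<Longrightarrow> E q x y \<Longrightarrow> E (Suc q) (d q x) (d q y)"
    and d_d: "x \<in> carrier (M q) \<Longrightarrow> E (Suc (Suc q)) (d (Suc q) (d q x)) \<zero>\<^bsub>M (Suc (Suc q))\<^esub>"
begin

definition cyc :: "nat \<Rightarrow> (complex, 'm) module" where
  "cyc q = (M q)\<lparr>carrier := {x \<in> carrier (M q). E (Suc q) (d q x) \<zero>\<^bsub>M (Suc q)\<^esub>}\<rparr>"

text \<open>In degree 0 everything congruent to zero counts as a boundary, and in higher degrees
  this is automatic through \<open>d 0\<close>. Forming cohomology thus divides by the congruence at
  the same time. The shape follows \<open>gcoboundaries\<close>, so that the abstract cohomology
  unfolds to \<open>sheaf_cohomology\<close>.\<close>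

definition bnd :: "nat \<Rightarrow> 'm set" where
  "bnd q = {x \<in> carrier (M q).
     case q of 0 \<Rightarrow> E 0 x \<zero>\<^bsub>M 0\<^esub> | Suc p \<Rightarrow> \<exists>y\<in>carrier (M p). E q x (d p y)}"

abbreviation diff :: "nat \<Rightarrow> 'm \<Rightarrow> 'm \<Rightarrow> 'm" where
  "diff q x y \<equiv> x \<oplus>\<^bsub>M q\<^esub> (-1) \<odot>\<^bsub>M q\<^esub> y"

lemma zero_closed: "\<zero>\<^bsub>M q\<^esub> \<in> carrier (M q)"
  and add_closed: "x \<in> carrier (M q) \<Longrightarrow> y \<in> carrier (M q) \<Longrightarrow> x \<oplus>\<^bsub>M q\<^esub> y \<in> carrier (M q)"
  and smult_closed: "x \<in> carrier (M q) \<Longrightarrow> c \<odot>\<^bsub>M q\<^esub> x \<in> carrier (M q)"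
  and smult_zero: "c \<odot>\<^bsub>M q\<^esub> \<zero>\<^bsub>M q\<^esub> = \<zero>\<^bsub>M q\<^esub>"
  and zero_smult: "x \<in> carrier (M q) \<Longrightarrow> 0 \<odot>\<^bsub>M q\<^esub> x = \<zero>\<^bsub>M q\<^esub>"
  and add_zero: "x \<in> carrier (M q) \<Longrightarrow> x \<oplus>\<^bsub>M q\<^esub> \<zero>\<^bsub>M q\<^esub> = x"
proof -
  interpret Module.module complex_ring "M q" by (rule module)
  show "\<zero>\<^bsub>M q\<^esub> \<in> carrier (M q)"
    and "x \<in> carrier (M q) \<Longrightarrow> y \<in> carrier (M q) \<Longrightarrow> x \<oplus>\<^bsub>M q\<^esub> y \<in> carrier (M q)"
    and "x \<in> carrier (M q) \<Longrightarrow> c \<odot>\<^bsub>M q\<^esub> x \<in> carrier (M q)"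
    and "c \<odot>\<^bsub>M q\<^esub> \<zero>\<^bsub>M q\<^esub> = \<zero>\<^bsub>M q\<^esub>"
    and "x \<in> carrier (M q) \<Longrightarrow> 0 \<odot>\<^bsub>M q\<^esub> x = \<zero>\<^bsub>M q\<^esub>"
    and "x \<in> carrier (M q) \<Longrightarrow> x \<oplus>\<^bsub>M q\<^esub> \<zero>\<^bsub>M q\<^esub> = x"
    using smult_l_null by simp_all
qed

lemmas diff_simps = complex_module_add_cancel[OF module]

lemmas closed = zero_closed add_closed smult_closed d_closed

lemma E_diff: "E q x x' \<Longrightarrow> E q y y' \<Longrightarrow> E q (diff q x y) (diff q x' y')"
  by (intro E_add E_smult)

text \<open>Reduces congruence of two elements to congruence to zero, the form in which injectivity
  and exactness of short sequences are stated below.\<close>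

lemma E_iff_diff:
  assumes "x \<in> carrier (M q)" "y \<in> carrier (M q)"
  shows "E q x y \<longleftrightarrow> E q (diff q x y) \<zero>\<^bsub>M q\<^esub>"
proof
  assume "E q x y"
  from E_diff[OF this E_refl, of y] show "E q (diff q x y) \<zero>\<^bsub>M q\<^esub>"
    using assms by (simp add: diff_simps)
next
  assume "E q (diff q x y) \<zero>\<^bsub>M q\<^esub>"
  from E_add[OF this E_refl, of y] show "E q x y"
    using assms module[of q]
    by (simp add: diff_simps Module.module.axioms(2) abelian_group.axioms(1) abelian_monoid.l_zero)
qed

lemma d_zero: "E (Suc q) (d q \<zero>\<^bsub>M q\<^esub>) \<zero>\<^bsub>M (Suc q)\<^esub>"
  using d_smult[of "\<zero>\<^bsub>M q\<^esub>" q 0] by (simp add: smult_zero zero_smult closed)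

lemma d_diff:
  assumes "x \<in> carrier (M q)" "y \<in> carrier (M q)"
  shows "E (Suc q) (d q (diff q x y)) (diff (Suc q) (d q x) (d q y))"
  using d_add[OF assms(1) smult_closed[OF assms(2)]] E_add[OF E_refl d_smult[OF assms(2)]]
  by (rule E_trans)

lemma bnd_closed: "x \<in> bnd q \<Longrightarrow> x \<in> carrier (M q)"
  by (simp add: bnd_def)

lemma d_bnd:
  assumes "x \<in> bnd q"
  shows "E (Suc q) (d q x) \<zero>\<^bsub>M (Suc q)\<^esub>"
proof (cases q)
  case 0
  then show ?thesis using assms E_trans[OF d_cong d_zero] by (auto simp: bnd_def closed)
next
  case (Suc p)
  then obtain y where "y \<in> carrier (M p)" "E q x (d p y)" using assms by (auto simp: bnd_def)
  then show ?thesis using assms E_trans[OF d_cong d_d] Suc by (auto simp: bnd_def closed)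
qed

lemma bndI: "x \<in> carrier (M q) \<Longrightarrow> y \<in> bnd q \<Longrightarrow> E q x y \<Longrightarrow> x \<in> bnd q"
  by (auto simp: bnd_def split: nat.splits intro: E_trans)

lemma zero_bnd: "\<zero>\<^bsub>M q\<^esub> \<in> bnd q"
  by (auto simp: bnd_def closed split: nat.splits intro: E_refl E_sym[OF d_zero])

lemma add_bnd: "x \<in> bnd q \<Longrightarrow> y \<in> bnd q \<Longrightarrow> x \<oplus>\<^bsub>M q\<^esub> y \<in> bnd q"
proof (cases q)
  case 0
  assume "x \<in> bnd q" "y \<in> bnd q"
  then show ?thesis using E_add[of 0 x "\<zero>\<^bsub>M 0\<^esub>" y "\<zero>\<^bsub>M 0\<^esub>"] 0 by (auto simp: bnd_def closed add_zero)
next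
  case (Suc p)
  assume "x \<in> bnd q" "y \<in> bnd q"
  then obtain x' y' where *: "x \<in> carrier (M q)" "y \<in> carrier (M q)"
    "x' \<in> carrier (M p)" "y' \<in> carrier (M p)" "E q x (d p x')" "E q y (d p y')"
    using Suc by (auto simp: bnd_def)
  have "E q (x \<oplus>\<^bsub>M q\<^esub> y) (d p (x' \<oplus>\<^bsub>M p\<^esub> y'))"
    using E_trans[OF E_add[OF *(5,6)]] E_sym[OF d_add[OF *(3,4)]] unfolding Suc by blast
  then show ?thesis using * Suc by (auto simp: bnd_def intro: closed)
qed

lemma smult_bnd: "x \<in> bnd q \<Longrightarrow> c \<odot>\<^bsub>M q\<^esub> x \<in> bnd q"
proof (cases q)
  case 0
  assume "x \<in> bnd q"
  then show ?thesis using E_smult[of 0 x "\<zero>\<^bsub>M 0\<^esub>" c] 0 by (auto simp: bnd_def closed smult_zero)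
next
  case (Suc p)
  assume "x \<in> bnd q"
  then obtain x' where *: "x \<in> carrier (M q)" "x' \<in> carrier (M p)" "E q x (d p x')"
    using Suc by (auto simp: bnd_def)
  have "E q (c \<odot>\<^bsub>M q\<^esub> x) (d p (c \<odot>\<^bsub>M p\<^esub> x'))"
    using E_trans[OF E_smult[OF *(3)]] E_sym[OF d_smult[OF *(2)]] unfolding Suc by blast
  then show ?thesis using * Suc by (auto simp: bnd_def intro: closed)
qed

lemma cyc_simps [simp]:
  "x \<in> carrier (cyc q) \<longleftrightarrow> x \<in> carrier (M q) \<and> E (Suc q) (d q x) \<zero>\<^bsub>M (Suc q)\<^esub>"
  "\<zero>\<^bsub>cyc q\<^esub> = \<zero>\<^bsub>M q\<^esub>" "x \<oplus>\<^bsub>cyc q\<^esub> y = x \<oplus>\<^bsub>M q\<^esub> y" "c \<odot>\<^bsub>cyc q\<^esub> x = c \<odot>\<^bsub>M q\<^esub> x"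
  by (simp_all add: cyc_def)

lemma complex_module_cyc: "complex_module (cyc q)"
  unfolding cyc_def
proof (rule complex_submodule[OF module], safe)
  fix x y c
  assume x: "x \<in> carrier (M q)" "E (Suc q) (d q x) \<zero>\<^bsub>M (Suc q)\<^esub>"
  show "E (Suc q) (d q (c \<odot>\<^bsub>M q\<^esub> x)) \<zero>\<^bsub>M (Suc q)\<^esub>"
    using E_trans[OF d_smult[OF x(1)] E_smult[OF x(2)]] by (simp add: smult_zero)
  assume y: "y \<in> carrier (M q)" "E (Suc q) (d q y) \<zero>\<^bsub>M (Suc q)\<^esub>"
  show "E (Suc q) (d q (x \<oplus>\<^bsub>M q\<^esub> y)) \<zero>\<^bsub>M (Suc q)\<^esub>"
    using E_trans[OF d_add[OF x(1) y(1)] E_add[OF x(2) y(2)]] by (simp add: add_zero closed)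
qed (auto intro: closed d_zero)

lemma quotient_cohomology: "quotient_module (cyc q) (bnd q)"
proof -
  interpret Module.module complex_ring "cyc q" by (rule complex_module_cyc)
  show ?thesis
    by unfold_locales (auto intro: d_bnd zero_bnd add_bnd smult_bnd dest: bnd_closed)
qed

end

context quasi_complex begin

text \<open>The difference is congruent to zero, and the boundaries contain zero and are saturated
  under the congruence.\<close>

lemma coset_eqI:
  assumes "x \<in> carrier (cyc q)" "y \<in> carrier (cyc q)" "E q x y"
  shows "bnd q +>\<^bsub>cyc q\<^esub> x = bnd q +>\<^bsub>cyc q\<^esub> y"
proof -
  have "diff q x y \<in> bnd q"
    using assms E_iff_diff[of x q y] by (intro bndI[OF _ zero_bnd]) (auto intro: closed)
  then show ?thesis
    using quotient_module.cls_eq_iff_diff[OF quotient_cohomology assms(1,2)] by simp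
qed

lemma coset_diff_bnd:
  assumes "x \<in> carrier (cyc q)" "b \<in> bnd q"
  shows "diff q x b \<in> carrier (cyc q)" "bnd q +>\<^bsub>cyc q\<^esub> (diff q x b) = bnd q +>\<^bsub>cyc q\<^esub> x"
proof -
  interpret Module.module complex_ring "cyc q" by (rule complex_module_cyc)
  have b: "b \<in> carrier (cyc q)" using assms(2) by (auto intro: bnd_closed d_bnd)
  show *: "diff q x b \<in> carrier (cyc q)"
    using M.a_closed[OF assms(1) Module.module.smult_closed[OF complex_module_cyc _ b, of "-1"]] by simp
  show "bnd q +>\<^bsub>cyc q\<^esub> (diff q x b) = bnd q +>\<^bsub>cyc q\<^esub> x"
    using quotient_module.cls_eq_iff_diff[OF quotient_cohomology assms(1) *] assms b
    by (simp add: diff_simps)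
qed

end

text \<open>The maps are linear in the strict sense, because the intended ones act value by value on
  cochains. They commute with the differentials only up to congruence, because the representatives
  chosen on the two sides need not correspond.\<close>

locale quasi_map = A: quasi_complex A EA dA + B: quasi_complex B EB dB
  for A :: "nat \<Rightarrow> (complex, 'm) module" and EA dA
    and B :: "nat \<Rightarrow> (complex, 'k) module" and EB dB +
  fixes f :: "nat \<Rightarrow> 'm \<Rightarrow> 'k"
  assumes f_linear: "linear_map complex_ring (A q) (B q) (f q)"
    and f_cong: "x \<in> carrier (A q) \<Longrightarrow> y \<in> carrier (A q) \<Longrightarrow> EA q x y \<Longrightarrow> EB q (f q x) (f q y)"
    and f_d: "x \<in> carrier (A q) \<Longrightarrow> EB (Suc q) (f (Suc q) (dA q x)) (dB q (f q x))"
begin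

lemma f_closed: "x \<in> carrier (A q) \<Longrightarrow> f q x \<in> carrier (B q)"
  and f_add: "x \<in> carrier (A q) \<Longrightarrow> y \<in> carrier (A q) \<Longrightarrow> f q (x \<oplus>\<^bsub>A q\<^esub> y) = f q x \<oplus>\<^bsub>B q\<^esub> f q y"
  and f_smult: "x \<in> carrier (A q) \<Longrightarrow> f q (c \<odot>\<^bsub>A q\<^esub> x) = c \<odot>\<^bsub>B q\<^esub> f q x"
  using f_linear[of q] by (simp_all add: linear_map_def)

lemma f_zero: "f q \<zero>\<^bsub>A q\<^esub> = \<zero>\<^bsub>B q\<^esub>"
  by (rule linear_map_zero[OF A.module B.module f_linear])

lemma f_diff: "x \<in> carrier (A q) \<Longrightarrow> y \<in> carrier (A q) \<Longrightarrow> f q (A.diff q x y) = B.diff q (f q x) (f q y)"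
  by (simp add: f_add f_smult A.closed)

lemma f_cyc:
  assumes "x \<in> carrier (A.cyc q)"
  shows "f q x \<in> carrier (B.cyc q)"
proof -
  have x: "x \<in> carrier (A q)" "EA (Suc q) (dA q x) \<zero>\<^bsub>A (Suc q)\<^esub>" using assms by auto
  have "EB (Suc q) (dB q (f q x)) \<zero>\<^bsub>B (Suc q)\<^esub>"
    using B.E_trans[OF B.E_sym[OF f_d[OF x(1)]] f_cong[OF _ _ x(2)]] x(1) by (simp add: f_zero A.closed)
  then show ?thesis using x by (simp add: f_closed)
qed

lemma f_bnd:
  assumes "x \<in> A.bnd q"
  shows "f q x \<in> B.bnd q"
proof (cases q)
  case 0
  then show ?thesis using assms f_cong[of x 0 "\<zero>\<^bsub>A 0\<^esub>"]
    by (auto simp: A.bnd_def B.bnd_def f_closed A.closed f_zero)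
next
  case (Suc p)
  then obtain y where y: "x \<in> carrier (A q)" "y \<in> carrier (A p)" "EA q x (dA p y)"
    using assms by (auto simp: A.bnd_def)
  have "EB q (f q x) (dB p (f p y))"
    using B.E_trans[OF f_cong[OF y(1) _ y(3)]] f_d[OF y(2)] y(2) Suc by (simp add: A.closed)
  then show ?thesis using y Suc by (auto simp: B.bnd_def f_closed)
qed

lemma quotient_map_cohomology: "quotient_module_map (A.cyc q) (A.bnd q) (B.cyc q) (B.bnd q) (f q)"
proof -
  interpret A': quotient_module "A.cyc q" "A.bnd q" by (rule A.quotient_cohomology)
  interpret B': quotient_module "B.cyc q" "B.bnd q" by (rule B.quotient_cohomology)
  show ?thesis
  proof
    show "linear_map complex_ring (A.cyc q) (B.cyc q) (f q)"
      using f_cyc by (simp add: linear_map_def f_add f_smult)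
  qed (rule f_bnd)
qed

end

section \<open>The snake lemma for complexes with a congruence\<close>

locale quasi_short_exact =
  f: quasi_map A EA dA B EB dB f + g: quasi_map B EB dB C EC dC g
  for A :: "nat \<Rightarrow> (complex, 'l) module" and EA dA
    and B :: "nat \<Rightarrow> (complex, 'm) module" and EB dB
    and C :: "nat \<Rightarrow> (complex, 'k) module" and EC dC and f g +
  assumes f_inj: "x \<in> carrier (A q) \<Longrightarrow> EB q (f q x) \<zero>\<^bsub>B q\<^esub> \<Longrightarrow> EA q x \<zero>\<^bsub>A q\<^esub>"
    and g_surj: "z \<in> carrier (C q) \<Longrightarrow> \<exists>y\<in>carrier (B q). EC q (g q y) z"
    and g_f: "x \<in> carrier (A q) \<Longrightarrow> EC q (g q (f q x)) \<zero>\<^bsub>C q\<^esub>"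
    and exact: "y \<in> carrier (B q) \<Longrightarrow> EC q (g q y) \<zero>\<^bsub>C q\<^esub> \<Longrightarrow> \<exists>x\<in>carrier (A q). EB q (f q x) y"
begin

abbreviation "coh_A q \<equiv> quot_mod (f.A.cyc q) (f.A.bnd q)"
abbreviation "coh_B q \<equiv> quot_mod (f.B.cyc q) (f.B.bnd q)"
abbreviation "coh_C q \<equiv> quot_mod (g.B.cyc q) (g.B.bnd q)"
abbreviation "coh_f q \<equiv> quot_map (f.B.cyc q) (f.B.bnd q) (f q)"
abbreviation "coh_g q \<equiv> quot_map (g.B.cyc q) (g.B.bnd q) (g q)"

sublocale A: quotient_module "f.A.cyc q" "f.A.bnd q" for q by (rule f.A.quotient_cohomology)
sublocale B: quotient_module "f.B.cyc q" "f.B.bnd q" for q by (rule f.B.quotient_cohomology)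
sublocale C: quotient_module "g.B.cyc q" "g.B.bnd q" for q by (rule g.B.quotient_cohomology)
sublocale qf: quotient_module_map "f.A.cyc q" "f.A.bnd q" "f.B.cyc q" "f.B.bnd q" "f q" for q
  by (rule f.quotient_map_cohomology)
sublocale qg: quotient_module_map "f.B.cyc q" "f.B.bnd q" "g.B.cyc q" "g.B.bnd q" "g q" for q
  by (rule g.quotient_map_cohomology)

lemma f_reflects:
  assumes "x \<in> carrier (A q)" "y \<in> carrier (A q)" "EB q (f q x) (f q y)"
  shows "EA q x y"
  using assms f_inj[of "f.A.diff q x y" q]
  by (simp add: f.A.E_iff_diff[of x q y] f.B.E_iff_diff[of "f q x"] f.f_closed f.f_diff f.A.closed)

text \<open>In positive degree a primitive is lifted through \<open>g\<close> and then
  differentiated. In degree 0 a boundary is congruent to zero, hence to the image of zero.\<close>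

lemma lift_bnd:
  assumes "z \<in> g.B.bnd q"
  shows "\<exists>y\<in>f.B.bnd q. EC q (g q y) z"
proof (cases q)
  case 0
  then have "EC q z (g q \<zero>\<^bsub>B q\<^esub>)" using assms by (auto simp: g.B.bnd_def g.f_zero)
  then have "EC q (g q \<zero>\<^bsub>B q\<^esub>) z" by (rule g.B.E_sym)
  then show ?thesis using f.B.zero_bnd by blast
next
  case (Suc p)
  then obtain z' where z': "z' \<in> carrier (C p)" "EC q z (dC p z')"
    using assms by (auto simp: g.B.bnd_def)
  obtain y where y: "y \<in> carrier (B p)" "EC p (g p y) z'" using g_surj[OF z'(1)] by blast
  have "EC q (g q (dB p y)) (dC p (g p y))" using g.f_d[OF y(1)] Suc by simp
  also have "EC q (dC p (g p y)) (dC p z')"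
    using g.B.d_cong[OF _ z'(1) y(2)] y(1) Suc by (simp add: g.f_closed)
  also have "EC q (dC p z') z" by (rule g.B.E_sym[OF z'(2)])
  finally have "EC q (g q (dB p y)) z" .
  moreover have "dB p y \<in> f.B.bnd q"
    using y(1) Suc by (auto simp: f.B.bnd_def f.B.closed intro: f.B.E_refl)
  ultimately show ?thesis by blast
qed

text \<open>Since \<open>f\<close> is injective up to congruence, \<open>dA x\<close> may be tested
  after applying \<open>f\<close>, where it becomes congruent to \<open>dB y\<close>.\<close>

lemma cyc_A_iff:
  assumes "x \<in> carrier (A q)" "y \<in> carrier (B q)" "EB q (f q x) y" "EB (Suc q) (dB q y) \<zero>\<^bsub>B (Suc q)\<^esub>"
  shows "x \<in> carrier (f.A.cyc q)"
proof -
  have "EB (Suc q) (f (Suc q) (dA q x)) (dB q (f q x))" by (rule f.f_d[OF assms(1)])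
  also have "EB (Suc q) (dB q (f q x)) (dB q y)"
    using assms by (intro f.B.d_cong) (auto simp: f.f_closed)
  also note assms(4)
  finally show ?thesis using f_inj assms(1) by (simp add: f.A.closed)
qed

text \<open>The usual zigzag, kept as a relation: \<open>y\<close> lifts \<open>z\<close> through
  \<open>g\<close>, and \<open>x\<close> is a preimage of its differential under \<open>f\<close>.
  \<open>linear_map_of_relation\<close> turns it into a map on classes, so no lift has to be
  fixed.\<close>

definition connecting :: "nat \<Rightarrow> 'k \<Rightarrow> 'l \<Rightarrow> bool" where
  "connecting q z x \<longleftrightarrow> z \<in> carrier (g.B.cyc q) \<and> x \<in> carrier (f.A.cyc (Suc q)) \<and>
     (\<exists>y\<in>carrier (B q). EC q (g q y) z \<and> EB (Suc q) (f (Suc q) x) (dB q y))"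

lemma connecting_closed:
  "connecting q z x \<Longrightarrow> z \<in> carrier (g.B.cyc q) \<and> x \<in> carrier (f.A.cyc (Suc q))"
  by (simp add: connecting_def)

text \<open>The differential of a lift of \<open>z\<close> is mapped by \<open>g\<close> to the
  differential of \<open>z\<close>, which is congruent to zero, so exactness supplies
  \<open>x\<close>. It is a cocycle because the differential squares to zero in the middle
  complex.\<close>

lemma connecting_total:
  assumes z: "z \<in> carrier (g.B.cyc q)"
  shows "\<exists>x. connecting q z x"
proof -
  obtain y where y: "y \<in> carrier (B q)" "EC q (g q y) z" using g_surj z by auto
  have "EC (Suc q) (g (Suc q) (dB q y)) (dC q (g q y))" by (rule g.f_d[OF y(1)])
  also have "EC (Suc q) (dC q (g q y)) (dC q z)"
    using y z by (intro g.B.d_cong) (auto simp: g.f_closed)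
  also have "EC (Suc q) (dC q z) \<zero>\<^bsub>C (Suc q)\<^esub>" using z by simp
  finally obtain x where x: "x \<in> carrier (A (Suc q))" "EB (Suc q) (f (Suc q) x) (dB q y)"
    using exact[OF f.B.d_closed[OF y(1)]] by blast
  have "x \<in> carrier (f.A.cyc (Suc q))"
    using x y f.B.d_d by (intro cyc_A_iff[OF x(1) _ x(2)]) (auto simp: f.B.closed)
  then show ?thesis using x y z by (auto simp: connecting_def)
qed

lemma connecting_add:
  assumes "connecting q z x" "connecting q z' x'"
  shows "connecting q (z \<oplus>\<^bsub>g.B.cyc q\<^esub> z') (x \<oplus>\<^bsub>f.A.cyc (Suc q)\<^esub> x')"
proof -
  obtain y y' where y: "y \<in> carrier (B q)" "EC q (g q y) z" "EB (Suc q) (f (Suc q) x) (dB q y)"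
    and y': "y' \<in> carrier (B q)" "EC q (g q y') z'" "EB (Suc q) (f (Suc q) x') (dB q y')"
    using assms by (auto simp: connecting_def)
  have x: "z \<in> carrier (g.B.cyc q)" "z' \<in> carrier (g.B.cyc q)"
    "x \<in> carrier (f.A.cyc (Suc q))" "x' \<in> carrier (f.A.cyc (Suc q))"
    using assms by (auto simp: connecting_def)
  have "EC q (g q (y \<oplus>\<^bsub>B q\<^esub> y')) (z \<oplus>\<^bsub>C q\<^esub> z')"
    using g.B.E_add[OF y(2) y'(2)] y(1) y'(1) by (simp add: g.f_add)
  moreover have "EB (Suc q) (f (Suc q) (x \<oplus>\<^bsub>A (Suc q)\<^esub> x')) (dB q (y \<oplus>\<^bsub>B q\<^esub> y'))"
    using f.B.E_trans[OF f.B.E_add[OF y(3) y'(3)] f.B.E_sym[OF f.B.d_add[OF y(1) y'(1)]]] x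
    by (simp add: f.f_add)
  moreover have "z \<oplus>\<^bsub>g.B.cyc q\<^esub> z' \<in> carrier (g.B.cyc q)"
    "x \<oplus>\<^bsub>f.A.cyc (Suc q)\<^esub> x' \<in> carrier (f.A.cyc (Suc q))"
    using x by (auto simp del: f.A.cyc_simps g.B.cyc_simps)
  ultimately show ?thesis
    unfolding connecting_def using f.B.closed(2)[OF y(1) y'(1)]
    by (auto simp del: f.A.cyc_simps(1) g.B.cyc_simps(1))
qed

lemma connecting_smult:
  assumes "connecting q z x"
  shows "connecting q (c \<odot>\<^bsub>g.B.cyc q\<^esub> z) (c \<odot>\<^bsub>f.A.cyc (Suc q)\<^esub> x)"
proof -
  obtain y where y: "y \<in> carrier (B q)" "EC q (g q y) z" "EB (Suc q) (f (Suc q) x) (dB q y)"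
    using assms by (auto simp: connecting_def)
  have x: "z \<in> carrier (g.B.cyc q)" "x \<in> carrier (f.A.cyc (Suc q))"
    using assms by (auto simp: connecting_def)
  have "EC q (g q (c \<odot>\<^bsub>B q\<^esub> y)) (c \<odot>\<^bsub>C q\<^esub> z)"
    using g.B.E_smult[OF y(2)] y(1) by (simp add: g.f_smult)
  moreover have "EB (Suc q) (f (Suc q) (c \<odot>\<^bsub>A (Suc q)\<^esub> x)) (dB q (c \<odot>\<^bsub>B q\<^esub> y))"
    using f.B.E_trans[OF f.B.E_smult[OF y(3)] f.B.E_sym[OF f.B.d_smult[OF y(1)]]] x
    by (simp add: f.f_smult)
  moreover have "c \<odot>\<^bsub>g.B.cyc q\<^esub> z \<in> carrier (g.B.cyc q)"
    "c \<odot>\<^bsub>f.A.cyc (Suc q)\<^esub> x \<in> carrier (f.A.cyc (Suc q))"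
    using x by (auto simp del: f.A.cyc_simps g.B.cyc_simps)
  ultimately show ?thesis
    unfolding connecting_def using f.B.closed(3)[OF y(1)]
    by (auto simp del: f.A.cyc_simps(1) g.B.cyc_simps(1))
qed

text \<open>If \<open>b\<close> is a boundary lifting \<open>z\<close>, then \<open>y\<close> minus
  \<open>b\<close> is killed by \<open>g\<close> and comes from some \<open>a\<close>. As the
  differential of \<open>b\<close> is congruent to zero, that of \<open>a\<close> is congruent to
  \<open>x\<close>.\<close>

lemma connecting_bnd:
  assumes "connecting q z x" "z \<in> g.B.bnd q"
  shows "x \<in> f.A.bnd (Suc q)"
proof -
  obtain y where y: "y \<in> carrier (B q)" "EC q (g q y) z" "EB (Suc q) (f (Suc q) x) (dB q y)"
    and x: "x \<in> carrier (A (Suc q))"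
    using assms by (auto simp: connecting_def)
  obtain b where b: "b \<in> f.B.bnd q" "EC q (g q b) z" using lift_bnd[OF assms(2)] by blast
  have b': "b \<in> carrier (B q)" by (rule f.B.bnd_closed[OF b(1)])
  have "EC q (g q y) (g q b)" using y(2) b(2) by (blast intro: g.B.E_sym g.B.E_trans)
  then have "EC q (g q (f.B.diff q y b)) \<zero>\<^bsub>C q\<^esub>"
    using y b' by (simp add: g.B.E_iff_diff[of "g q y"] g.f_closed g.f_diff)
  then obtain a where a: "a \<in> carrier (A q)" "EB q (f q a) (f.B.diff q y b)"
    using exact[OF f.B.add_closed[OF y(1) f.B.smult_closed[OF b']]] by blast
  have "EB (Suc q) (f (Suc q) (dA q a)) (dB q (f q a))" by (rule f.f_d[OF a(1)])
  also have "EB (Suc q) (dB q (f q a)) (dB q (f.B.diff q y b))"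
    using a y b' by (intro f.B.d_cong) (auto simp: f.f_closed f.B.closed)
  also have "EB (Suc q) (dB q (f.B.diff q y b)) (f.B.diff (Suc q) (dB q y) (dB q b))"
    using y b' by (intro f.B.d_diff)
  also have "EB (Suc q) (f.B.diff (Suc q) (dB q y) (dB q b)) (f.B.diff (Suc q) (dB q y) \<zero>\<^bsub>B (Suc q)\<^esub>)"
    by (intro f.B.E_diff f.B.d_bnd b f.B.E_refl)
  also have "f.B.diff (Suc q) (dB q y) \<zero>\<^bsub>B (Suc q)\<^esub> = dB q y"
    using y by (simp add: f.B.smult_zero f.B.add_zero f.B.closed)
  also have "EB (Suc q) (dB q y) (f (Suc q) x)" by (rule f.B.E_sym[OF y(3)])
  finally have "EA (Suc q) (dA q a) x" by (intro f_reflects) (auto simp: a x f.A.closed)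
  from f.A.E_sym[OF this] show ?thesis using x a(1) by (auto simp: f.A.bnd_def)
qed

text \<open>Subtracting \<open>f x'\<close> cancels the differential of \<open>y\<close> and leaves
  the image under \<open>g\<close> unchanged. This is the essential half of exactness at the
  cohomology of \<open>C\<close>.\<close>

lemma in_kernel_lift:
  assumes y: "y \<in> carrier (B q)" and z: "z \<in> carrier (g.B.cyc q)" and yz: "EC q (g q y) z"
    and x': "x' \<in> carrier (A q)" and "EB (Suc q) (dB q y) (f (Suc q) (dA q x'))"
  shows "\<exists>b\<in>carrier (f.B.cyc q). EC q (g q b) z"
proof -
  let ?b = "f.B.diff q y (f q x')"
  have b: "?b \<in> carrier (B q)" using y x' by (simp add: f.B.closed f.f_closed)
  have "EB (Suc q) (dB q y) (dB q (f q x'))"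
    using assms(5) f.f_d[OF x'] by (rule f.B.E_trans)
  then have "EB (Suc q) (f.B.diff (Suc q) (dB q y) (dB q (f q x'))) \<zero>\<^bsub>B (Suc q)\<^esub>"
    using y x' by (subst f.B.E_iff_diff[symmetric]) (auto simp: f.B.closed f.f_closed)
  then have "EB (Suc q) (dB q ?b) \<zero>\<^bsub>B (Suc q)\<^esub>"
    using f.B.E_trans[OF f.B.d_diff] y x' f.f_closed by blast
  moreover have "EC q (g q ?b) (g.B.diff q z \<zero>\<^bsub>C q\<^esub>)"
    using g.B.E_diff[OF yz g_f[OF x']] y x' by (simp add: g.f_diff f.f_closed)
  then have "EC q (g q ?b) z" using z by (simp add: g.B.smult_zero g.B.add_zero)
  ultimately show ?thesis using b by auto
qed

lemma exact_B: "exact_at (coh_A q) (coh_B q) (coh_C q) (coh_f q) (coh_g q)"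
  unfolding exact_at_def
proof (rule Set.set_eqI, rule iffI)
  fix Y assume "Y \<in> coh_f q ` carrier (coh_A q)"
  then obtain x where x: "x \<in> carrier (f.A.cyc q)" and Y: "Y = B.cls q (f q x)"
    by (auto simp only: A.carrier_quot qf.quot_map_cls)
  have fx: "f q x \<in> carrier (f.B.cyc q)" by (rule f.f_cyc[OF x])
  have "g q (f q x) \<in> g.B.bnd q"
    using x g_f by (intro g.B.bndI[OF _ g.B.zero_bnd]) (auto simp: g.f_closed f.f_closed)
  then have "coh_g q Y = \<zero>\<^bsub>coh_C q\<^esub>"
    using C.cls_eq_zero_quot_iff[OF g.f_cyc[OF fx]] unfolding Y qg.quot_map_cls[OF fx] by blast
  then show "Y \<in> {Y \<in> carrier (coh_B q). coh_g q Y = \<zero>\<^bsub>coh_C q\<^esub>}"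
    using fx unfolding Y B.carrier_quot by blast
next
  fix Y assume "Y \<in> {Y \<in> carrier (coh_B q). coh_g q Y = \<zero>\<^bsub>coh_C q\<^esub>}"
  then obtain y where y: "y \<in> carrier (f.B.cyc q)" and Y: "Y = B.cls q y"
    and "coh_g q Y = \<zero>\<^bsub>coh_C q\<^esub>"
    unfolding B.carrier_quot by blast
  then have "g q y \<in> g.B.bnd q"
    using C.cls_eq_zero_quot_iff[OF g.f_cyc[OF y]] unfolding Y qg.quot_map_cls[OF y] by blast
  \<comment> \<open>The image of \<open>y\<close> is only a boundary; after subtraction of a
    boundary \<open>b\<close> with the same image it is congruent to zero, and exactness of the
    cochains applies.\<close>
  then obtain b where b: "b \<in> f.B.bnd q" "EC q (g q b) (g q y)" using lift_bnd by blast
  note y' = f.B.coset_diff_bnd[OF y b(1)]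
  have gy': "EC q (g q (f.B.diff q y b)) \<zero>\<^bsub>C q\<^esub>"
    using y b f.B.bnd_closed[OF b(1)] g.B.E_sym[OF b(2)]
    by (simp add: g.B.E_iff_diff[of "g q y"] g.f_closed g.f_diff)
  have "f.B.diff q y b \<in> carrier (B q)" using y'(1) by simp
  from exact[OF this gy'] obtain a where a: "a \<in> carrier (A q)" "EB q (f q a) (f.B.diff q y b)"
    by blast
  then have a': "a \<in> carrier (f.A.cyc q)" using y'(1) by (intro cyc_A_iff) auto
  have "B.cls q (f q a) = Y"
    using f.B.coset_eqI[OF f.f_cyc[OF a'] y'(1) a(2)] y'(2) Y by simp
  then show "Y \<in> coh_f q ` carrier (coh_A q)"
    using a' qf.quot_map_cls[OF a'] unfolding A.carrier_quot by blast
qed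

lemma exact_C:
  assumes \<delta>: "\<And>z x. connecting q z x \<Longrightarrow> \<delta> (C.cls q z) = A.cls (Suc q) x"
  shows "exact_at (coh_B q) (coh_C q) (coh_A (Suc q)) (coh_g q) \<delta>"
  unfolding exact_at_def
proof (rule Set.set_eqI, rule iffI)
  fix Z assume "Z \<in> coh_g q ` carrier (coh_B q)"
  then obtain y where y: "y \<in> carrier (f.B.cyc q)" and Z: "Z = C.cls q (g q y)"
    by (auto simp only: B.carrier_quot qg.quot_map_cls)
  have gy: "g q y \<in> carrier (g.B.cyc q)" by (rule g.f_cyc[OF y])
  \<comment> \<open>The cocycle \<open>y\<close> is itself a lift of \<open>g q y\<close>, and its
    differential is congruent to the image of zero, so zero is a value of the connecting
    relation.\<close>
  have "EB (Suc q) (f (Suc q) \<zero>\<^bsub>A (Suc q)\<^esub>) (dB q y)"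
    using y by (simp add: f.f_zero f.B.E_sym)
  moreover have "\<zero>\<^bsub>A (Suc q)\<^esub> \<in> carrier (f.A.cyc (Suc q))"
    by (simp add: f.A.closed f.A.d_zero)
  ultimately have "connecting q (g q y) \<zero>\<^bsub>A (Suc q)\<^esub>"
    unfolding connecting_def using gy y g.B.E_refl by auto
  from \<delta>[OF this] have "\<delta> Z = \<zero>\<^bsub>coh_A (Suc q)\<^esub>" unfolding Z A.zero_quot by simp
  then show "Z \<in> {Z \<in> carrier (coh_C q). \<delta> Z = \<zero>\<^bsub>coh_A (Suc q)\<^esub>}"
    using gy unfolding Z C.carrier_quot by blast
next
  fix Z assume "Z \<in> {Z \<in> carrier (coh_C q). \<delta> Z = \<zero>\<^bsub>coh_A (Suc q)\<^esub>}"
  then obtain z where z: "z \<in> carrier (g.B.cyc q)" and Z: "Z = C.cls q z"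
    and \<delta>Z: "\<delta> Z = \<zero>\<^bsub>coh_A (Suc q)\<^esub>"
    unfolding C.carrier_quot by blast
  obtain x where x: "connecting q z x" using connecting_total[OF z] by blast
  then have x': "x \<in> carrier (f.A.cyc (Suc q))" by (simp add: connecting_def)
  have "x \<in> f.A.bnd (Suc q)"
    using A.cls_eq_zero_quot_iff[OF x'] \<delta>Z \<delta>[OF x] unfolding Z by simp
  then obtain x2 where x2: "x2 \<in> carrier (A q)" "EA (Suc q) x (dA q x2)"
    by (auto simp: f.A.bnd_def)
  obtain y where y: "y \<in> carrier (B q)" "EC q (g q y) z" "EB (Suc q) (f (Suc q) x) (dB q y)"
    using x by (auto simp: connecting_def)
  have "EB (Suc q) (f (Suc q) x) (f (Suc q) (dA q x2))"
    using x2 x' by (intro f.f_cong) (auto simp: f.A.closed)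
  then have "EB (Suc q) (dB q y) (f (Suc q) (dA q x2))"
    using f.B.E_sym[OF y(3)] f.B.E_trans by blast
  then obtain b where b: "b \<in> carrier (f.B.cyc q)" "EC q (g q b) z"
    using in_kernel_lift[OF y(1) z y(2) x2(1)] by blast
  have "C.cls q (g q b) = Z"
    using g.B.coset_eqI[OF g.f_cyc[OF b(1)] z b(2)] Z by simp
  then show "Z \<in> coh_g q ` carrier (coh_B q)"
    using b(1) qg.quot_map_cls[OF b(1)] unfolding B.carrier_quot by blast
qed

lemma exact_A:
  assumes \<delta>: "\<And>z x. connecting q z x \<Longrightarrow> \<delta> (C.cls q z) = A.cls (Suc q) x"
  shows "exact_at (coh_C q) (coh_A (Suc q)) (coh_B (Suc q)) \<delta> (coh_f (Suc q))"
  unfolding exact_at_def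
proof (rule Set.set_eqI, rule iffI)
  fix X assume "X \<in> \<delta> ` carrier (coh_C q)"
  then obtain z where z: "z \<in> carrier (g.B.cyc q)" and "X = \<delta> (C.cls q z)"
    by (auto simp only: C.carrier_quot)
  then obtain x where x: "connecting q z x" and X: "X = A.cls (Suc q) x"
    using connecting_total[OF z] \<delta> by blast
  then obtain y where x': "x \<in> carrier (f.A.cyc (Suc q))" and y: "y \<in> carrier (B q)" "EB (Suc q) (f (Suc q) x) (dB q y)"
    unfolding connecting_def by blast
  have "f (Suc q) x \<in> f.B.bnd (Suc q)"
    using x' y by (auto simp: f.B.bnd_def f.f_closed)
  then have "coh_f (Suc q) X = \<zero>\<^bsub>coh_B (Suc q)\<^esub>"
    using B.cls_eq_zero_quot_iff[OF f.f_cyc[OF x']] unfolding X qf.quot_map_cls[OF x'] by blast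
  then show "X \<in> {X \<in> carrier (coh_A (Suc q)). coh_f (Suc q) X = \<zero>\<^bsub>coh_B (Suc q)\<^esub>}"
    using x' unfolding X A.carrier_quot by blast
next
  fix X assume "X \<in> {X \<in> carrier (coh_A (Suc q)). coh_f (Suc q) X = \<zero>\<^bsub>coh_B (Suc q)\<^esub>}"
  then obtain x where x: "x \<in> carrier (f.A.cyc (Suc q))" and X: "X = A.cls (Suc q) x"
    and "coh_f (Suc q) X = \<zero>\<^bsub>coh_B (Suc q)\<^esub>"
    unfolding A.carrier_quot by blast
  then have "f (Suc q) x \<in> f.B.bnd (Suc q)"
    using B.cls_eq_zero_quot_iff[OF f.f_cyc[OF x]] unfolding X qf.quot_map_cls[OF x] by blast
  then obtain y where y: "y \<in> carrier (B q)" "EB (Suc q) (f (Suc q) x) (dB q y)"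
    by (auto simp: f.B.bnd_def)
  have x': "x \<in> carrier (A (Suc q))" using x by simp
  \<comment> \<open>The class that is mapped to \<open>X\<close> is that of \<open>g q y\<close>,
    where \<open>y\<close> is a primitive of \<open>f (Suc q) x\<close>. It is a cocycle because
    \<open>g\<close> after \<open>f\<close> vanishes.\<close>
  have "EC (Suc q) (dC q (g q y)) (g (Suc q) (dB q y))" by (rule g.B.E_sym[OF g.f_d[OF y(1)]])
  also have "EC (Suc q) (g (Suc q) (dB q y)) (g (Suc q) (f (Suc q) x))"
    using f.B.E_sym[OF y(2)] y(1) x' by (intro g.f_cong) (auto simp: f.f_closed f.B.closed)
  also have "EC (Suc q) (g (Suc q) (f (Suc q) x)) \<zero>\<^bsub>C (Suc q)\<^esub>" by (rule g_f[OF x'])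
  finally have gy: "g q y \<in> carrier (g.B.cyc q)" using y(1) by (simp add: g.f_closed)
  then have "connecting q (g q y) x"
    unfolding connecting_def using x y g.B.E_refl by blast
  from \<delta>[OF this] show "X \<in> \<delta> ` carrier (coh_C q)"
    using gy X unfolding C.carrier_quot by (metis imageI)
qed

text \<open>In degree 0 the boundaries are just the elements congruent to zero, so injectivity of
  \<open>f\<close> up to congruence is injectivity on classes.\<close>

lemma inj_coh_f_0: "inj_on (coh_f 0) (carrier (coh_A 0))"
proof (rule inj_onI)
  fix X Y assume "X \<in> carrier (coh_A 0)" "Y \<in> carrier (coh_A 0)" and eq: "coh_f 0 X = coh_f 0 Y"
  then obtain x y where x: "x \<in> carrier (f.A.cyc 0)" "X = A.cls 0 x"
    and y: "y \<in> carrier (f.A.cyc 0)" "Y = A.cls 0 y"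
    by (auto simp only: A.carrier_quot)
  have "B.cls 0 (f 0 x) = B.cls 0 (f 0 y)"
    using eq qf.quot_map_cls[OF x(1)] qf.quot_map_cls[OF y(1)] x(2) y(2) by simp
  then have "f.B.diff 0 (f 0 x) (f 0 y) \<in> f.B.bnd 0"
    using B.cls_eq_iff_diff[OF f.f_cyc[OF x(1)] f.f_cyc[OF y(1)]] by simp
  then have "EB 0 (f.B.diff 0 (f 0 x) (f 0 y)) \<zero>\<^bsub>B 0\<^esub>"
    by (simp add: f.B.bnd_def)
  then have "EB 0 (f 0 x) (f 0 y)"
    using x(1) y(1) f.B.E_iff_diff[of "f 0 x" 0 "f 0 y"] by (simp add: f.f_closed)
  then have "EA 0 x y" using x(1) y(1) by (intro f_reflects) auto
  then show "X = Y" using f.A.coset_eqI[OF x(1) y(1)] x(2) y(2) by simp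
qed

theorem long_exact: "\<exists>\<delta>. long_exact_sequence coh_A coh_B coh_C coh_f coh_g \<delta>"
proof -
  have "\<forall>q. \<exists>\<delta>. linear_map complex_ring (coh_C q) (coh_A (Suc q)) \<delta> \<and>
      (\<forall>z x. connecting q z x \<longrightarrow> \<delta> (C.cls q z) = A.cls (Suc q) x)"
    by (intro allI linear_map_of_relation[OF g.B.quotient_cohomology f.A.quotient_cohomology])
      (fact connecting_closed connecting_total connecting_add connecting_smult connecting_bnd)+
  from choice[OF this] obtain \<delta>
    where *: "\<forall>q. linear_map complex_ring (coh_C q) (coh_A (Suc q)) (\<delta> q) \<and>
      (\<forall>z x. connecting q z x \<longrightarrow> \<delta> q (C.cls q z) = A.cls (Suc q) x)" ..
  have linear: "linear_map complex_ring (coh_C q) (coh_A (Suc q)) (\<delta> q)" for q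
    using * by simp
  have \<delta>: "connecting q z x \<Longrightarrow> \<delta> q (C.cls q z) = A.cls (Suc q) x" for q z x
    using * by simp
  show ?thesis
    unfolding long_exact_sequence_def
  proof (intro exI[of _ \<delta>] conjI allI)
    fix q
    show "exact_at (coh_B q) (coh_C q) (coh_A (Suc q)) (coh_g q) (\<delta> q)"
      "exact_at (coh_C q) (coh_A (Suc q)) (coh_B (Suc q)) (\<delta> q) (coh_f (Suc q))"
      by (rule exact_C exact_A, erule \<delta>)+
  qed (fact A.complex_module_quot B.complex_module_quot C.complex_module_quot linear
      qf.linear_map_quot qg.linear_map_quot inj_coh_f_0 exact_B)+
qed

end

section \<open>Godement cochains\<close>

lemma eventually_nhdsin_topspace: "\<forall>\<^sub>F y in nhdsin T x. y \<in> topspace T"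
  by (auto simp: eventually_nhdsin)

lemma eventually_eventually_nhdsin:
  "\<forall>\<^sub>F y in nhdsin T x. P y \<Longrightarrow> \<forall>\<^sub>F y in nhdsin T x. \<forall>\<^sub>F z in nhdsin T y. P z"
  by (auto simp: eventually_nhdsin)

text \<open>Iterated filters replace the neighbourhood systems of \<open>gcochain_eq\<close>: the property \<open>P\<close> holds for all
  \<open>[y1, \<dots>, yn]\<close> with \<open>y1\<close> close to \<open>x\<close>, \<open>y2\<close> close to \<open>y1\<close> in terms of \<open>y1\<close>, and so on.
  This form is suited to induction on \<open>n\<close>.\<close>

primrec near :: "'a topology \<Rightarrow> nat \<Rightarrow> ('a list \<Rightarrow> bool) \<Rightarrow> 'a \<Rightarrow> bool" where
  "near T 0 P x \<longleftrightarrow> P []"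
| "near T (Suc n) P x \<longleftrightarrow> (\<forall>\<^sub>F y in nhdsin T x. near T n (\<lambda>ys. P (y # ys)) y)"

abbreviation plists :: "'a topology \<Rightarrow> nat \<Rightarrow> 'a list set" where
  "plists T n \<equiv> {ys. length ys = n \<and> set ys \<subseteq> topspace T}"

lemma near_all: "(\<And>ys. ys \<in> plists T n \<Longrightarrow> P ys) \<Longrightarrow> near T n P x"
proof (induction n arbitrary: P x)
  case (Suc n)
  show ?case unfolding near.simps
    by (rule eventually_mono[OF eventually_nhdsin_topspace]) (auto intro!: Suc)
qed auto

text \<open>Conjunction and weakening in one step: this is how two identities that hold after
  shrinking are combined, as in transitivity of the congruence.\<close>

lemma near_mono2:
  "near T n P x \<Longrightarrow> near T n Q x \<Longrightarrow> (\<And>ys. ys \<in> plists T n \<Longrightarrow> P ys \<Longrightarrow> Q ys \<Longrightarrow> R ys) \<Longrightarrow> near T n R x"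
proof (induction n arbitrary: P Q R x)
  case (Suc n)
  have "\<forall>\<^sub>F y in nhdsin T x. near T n (\<lambda>ys. P (y # ys)) y \<and> near T n (\<lambda>ys. Q (y # ys)) y \<and> y \<in> topspace T"
    using Suc.prems(1,2) eventually_nhdsin_topspace by (simp add: eventually_conj_iff)
  then show ?case unfolding near.simps
  proof (rule eventually_mono)
    fix y assume "near T n (\<lambda>ys. P (y # ys)) y \<and> near T n (\<lambda>ys. Q (y # ys)) y \<and> y \<in> topspace T"
    then show "near T n (\<lambda>ys. R (y # ys)) y"
      using Suc.prems(3) by (auto intro: Suc.IH[where P = "\<lambda>ys. P (y # ys)" and Q = "\<lambda>ys. Q (y # ys)"])
  qed
qed auto

lemma near_mono: "near T n P x \<Longrightarrow> (\<And>ys. ys \<in> plists T n \<Longrightarrow> P ys \<Longrightarrow> Q ys) \<Longrightarrow> near T n Q x"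
  using near_mono2[where P = P and Q = P] by blast

text \<open>The base point enters only through the filter for the first entry of the list, and being
  near is an open condition on that point.\<close>

lemma near_shift:
  assumes "near T n P x"
  shows "\<forall>\<^sub>F y in nhdsin T x. near T n P y"
  using assms by (cases n) (auto intro: eventually_eventually_nhdsin)

definition neighbourhood_system :: "'a topology \<Rightarrow> ('a list \<Rightarrow> 'a set) \<Rightarrow> bool" where
  "neighbourhood_system T V \<longleftrightarrow> (\<forall>ys. ys \<noteq> [] \<and> set ys \<subseteq> topspace T \<longrightarrow> openin T (V ys) \<and> last ys \<in> V ys)"

lemma neighbourhood_systemD:
  assumes "neighbourhood_system T V" "ys \<noteq> []" "set ys \<subseteq> topspace T"
  shows "openin T (V ys)" "last ys \<in> V ys"
  using assms by (auto simp: neighbourhood_system_def)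

text \<open>Once \<open>y\<close> has been chosen in \<open>V [x]\<close>, the remaining points are
  governed by the system obtained from \<open>V\<close> by prepending \<open>x\<close>, to which
  induction applies.\<close>

lemma near_of_neighbourhood_system:
  assumes "neighbourhood_system T V" "x \<in> topspace T"
    and "\<And>ys. ys \<in> plists T n \<Longrightarrow> (\<forall>j<n. ys ! j \<in> V (x # take j ys)) \<Longrightarrow> P ys"
  shows "near T n P x"
  using assms
proof (induction n arbitrary: V P x)
  case (Suc n)
  have V: "openin T (V [x])" "x \<in> V [x]" using neighbourhood_systemD[OF Suc.prems(1), of "[x]"] Suc.prems(2) by auto
  have "near T n (\<lambda>ys. P (y # ys)) y" if y: "y \<in> V [x]" for y
  proof (rule Suc.IH[of "\<lambda>ys. V (x # ys)"])
    show "neighbourhood_system T (\<lambda>ys. V (x # ys))"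
      unfolding neighbourhood_system_def
    proof (intro allI impI)
      fix ys assume "ys \<noteq> [] \<and> set ys \<subseteq> topspace T"
      then show "openin T (V (x # ys)) \<and> last ys \<in> V (x # ys)"
        using neighbourhood_systemD[OF Suc.prems(1), of "x # ys"] Suc.prems(2) by simp
    qed
    show "y \<in> topspace T" using y openin_subset[OF V(1)] by blast
    then show "P (y # ys)"
      if "ys \<in> plists T n" "\<forall>j<n. ys ! j \<in> V (x # y # take j ys)" for ys
      using that y by (intro Suc.prems(3)) (auto simp: less_Suc_eq_0_disj)
  qed
  then show ?case using V by (auto simp: eventually_nhdsin)
qed auto

lemma neighbourhood_system_of_near:
  assumes "near T n P x" "x \<in> topspace T"
  shows "\<exists>V. neighbourhood_system T V \<and>
    (\<forall>ys\<in>plists T n. (\<forall>j<n. ys ! j \<in> V (x # take j ys)) \<longrightarrow> P ys)"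
  using assms
proof (induction n arbitrary: P x)
  case 0
  then show ?case
    by (intro exI[of _ "\<lambda>_. topspace T"]) (auto simp: neighbourhood_system_def)
next
  case (Suc n)
  obtain W where W: "openin T W" "x \<in> W" "\<And>y. y \<in> W \<Longrightarrow> near T n (\<lambda>ys. P (y # ys)) y"
    using Suc.prems by (auto simp: eventually_nhdsin)
  have "\<forall>y\<in>W. \<exists>V. neighbourhood_system T V \<and>
      (\<forall>ys\<in>plists T n. (\<forall>j<n. ys ! j \<in> V (y # take j ys)) \<longrightarrow> P (y # ys))"
    using W(3) openin_subset[OF W(1)] by (intro ballI Suc.IH) auto
  then obtain V' where V': "\<And>y. y \<in> W \<Longrightarrow> neighbourhood_system T (V' y)"
    "\<And>y ys. y \<in> W \<Longrightarrow> ys \<in> plists T n \<Longrightarrow> (\<forall>j<n. ys ! j \<in> V' y (y # take j ys)) \<Longrightarrow> P (y # ys)"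
    by metis
  \<comment> \<open>Lists begin with the base point \<open>x\<close>, so \<open>[x]\<close> receives
    \<open>W\<close>, and the entry after it selects the system chosen for that entry. The whole
    space is the default for lists that cannot occur.\<close>
  define V where "V zs = (case zs of [] \<Rightarrow> W
    | [z] \<Rightarrow> if z = x then W else topspace T
    | z # y # ys \<Rightarrow> if y \<in> W then V' y (y # ys) else topspace T)" for zs
  have "openin T (V zs) \<and> last zs \<in> V zs" if zs: "zs \<noteq> []" "set zs \<subseteq> topspace T" for zs
  proof (cases "\<exists>z y ys. zs = z # y # ys \<and> y \<in> W")
    case True
    then obtain z y ys where *: "zs = z # y # ys" "y \<in> W" by blast
    then show ?thesis
      using neighbourhood_systemD[OF V'(1)[OF *(2)], of "y # ys"] zs by (simp add: V_def)
  next
    case False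
    then show ?thesis using zs W(1,2) by (auto simp: V_def split: list.splits)
  qed
  then have "neighbourhood_system T V" by (simp add: neighbourhood_system_def)
  moreover have "P ys" if ys: "ys \<in> plists T (Suc n)" "\<forall>j<Suc n. ys ! j \<in> V (x # take j ys)" for ys
  proof -
    obtain y zs where *: "ys = y # zs" using ys(1) by (cases ys) auto
    have y: "y \<in> W" using ys(2)[rule_format, of 0] * by (simp add: V_def)
    show ?thesis
      unfolding *
    proof (rule V'(2)[OF y])
      show "\<forall>j<n. zs ! j \<in> V' y (y # take j zs)"
      proof safe
        fix j assume "j < n"
        then show "zs ! j \<in> V' y (y # take j zs)"
          using ys(2)[rule_format, of "Suc j"] y * by (simp add: V_def)
      qed
    qed (use ys(1) * in auto)
  qed
  ultimately show ?case by blast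
qed

lemma gcochain_eq_iff_near:
  "gcochain_eq T q f g \<longleftrightarrow> (\<forall>x\<in>topspace T. near T q (\<lambda>ys. f (x # ys) = g (x # ys)) x)"
proof
  assume "gcochain_eq T q f g"
  then obtain V where V: "neighbourhood_system T V"
    "\<And>xs. xs \<in> glists T q \<Longrightarrow> \<forall>j<q. xs ! Suc j \<in> V (take (Suc j) xs) \<Longrightarrow> f xs = g xs"
    unfolding gcochain_eq_def neighbourhood_system_def by blast
  show "\<forall>x\<in>topspace T. near T q (\<lambda>ys. f (x # ys) = g (x # ys)) x"
  proof safe
    fix x assume x: "x \<in> topspace T"
    show "near T q (\<lambda>ys. f (x # ys) = g (x # ys)) x"
      by (rule near_of_neighbourhood_system[OF V(1) x], rule V(2)) (use x in \<open>auto simp: glists_def\<close>)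
  qed
next
  assume near: "\<forall>x\<in>topspace T. near T q (\<lambda>ys. f (x # ys) = g (x # ys)) x"
  have "\<forall>x\<in>topspace T. \<exists>V. neighbourhood_system T V \<and>
    (\<forall>ys\<in>plists T q. (\<forall>j<q. ys ! j \<in> V (x # take j ys)) \<longrightarrow> f (x # ys) = g (x # ys))"
    using near by (intro ballI neighbourhood_system_of_near) auto
  from bchoice[OF this] obtain V where *: "\<forall>x\<in>topspace T. neighbourhood_system T (V x) \<and>
    (\<forall>ys\<in>plists T q. (\<forall>j<q. ys ! j \<in> V x (x # take j ys)) \<longrightarrow> f (x # ys) = g (x # ys))" ..
  have V: "\<And>x. x \<in> topspace T \<Longrightarrow> neighbourhood_system T (V x)"
    "\<And>x ys. x \<in> topspace T \<Longrightarrow> ys \<in> plists T q \<Longrightarrow> \<forall>j<q. ys ! j \<in> V x (x # take j ys) \<Longrightarrow> f (x # ys) = g (x # ys)"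
    using * by simp_all
  show "gcochain_eq T q f g"
    unfolding gcochain_eq_def
  \<comment> \<open>The systems found for the different first points do not interfere: the head of a
    list tells which of them to use.\<close>
  proof (intro exI[of _ "\<lambda>zs. V (hd zs) zs"] conjI allI ballI impI)
    fix ys assume "ys \<noteq> [] \<and> set ys \<subseteq> topspace T"
    moreover from this have "hd ys \<in> topspace T" using hd_in_set by blast
    ultimately show "openin T (V (hd ys) ys)" "last ys \<in> V (hd ys) ys"
      using neighbourhood_systemD[OF V(1), of "hd ys" ys] by blast+
  next
    fix xs assume xs: "xs \<in> glists T q" "\<forall>j<q. xs ! Suc j \<in> V (hd (take (Suc j) xs)) (take (Suc j) xs)"
    obtain x ys where *: "xs = x # ys" using xs(1) by (cases xs) (auto simp: glists_def)
    show "f xs = g xs"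
      unfolding * by (rule V(2)) (use xs * in \<open>auto simp: glists_def\<close>)
  qed
qed

text \<open>With \<open>f ys\<close> playing the role of \<open>\<phi> (xs @ ys)\<close> for a cochain \<open>\<phi>\<close> and a fixed prefix \<open>xs\<close>, this is the
  differential of \<open>\<phi>\<close> without the terms that omit a point of \<open>xs\<close>.\<close>

primrec alt_diff :: "'a topology \<Rightarrow> ('a, complex, 'm) presheaf \<Rightarrow>
    ('a list \<Rightarrow> ('a, 'm) germ) \<Rightarrow> 'a list \<Rightarrow> ('a, 'm) germ" where
  "alt_diff T A f [] = undefined"
| "alt_diff T A f (y # ys) = (if ys = [] then propagate T A (f []) y else
     f ys \<oplus>\<^bsub>stalk T A (last ys)\<^esub> (-1) \<odot>\<^bsub>stalk T A (last ys)\<^esub> alt_diff T A (\<lambda>zs. f (y # zs)) ys)"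

text \<open>The part of a presheaf that the Godement complex sees. Values of
  \<open>propagate\<close> are in the right stalk everywhere, thanks to the default zero. Its
  linearity and its composition law hold only near the point, because the representatives chosen for
  different germs agree with each other only there.\<close>

locale stalk_system =
  fixes T :: "'a topology" and A :: "('a, complex, 'm) presheaf"
  assumes stalk_module: "x \<in> topspace T \<Longrightarrow> complex_module (stalk T A x)"
    and propagate_closed: "x \<in> topspace T \<Longrightarrow> y \<in> topspace T \<Longrightarrow> \<gamma> \<in> carrier (stalk T A x) \<Longrightarrow>
      propagate T A \<gamma> y \<in> carrier (stalk T A y)"
    and propagate_linear: "x \<in> topspace T \<Longrightarrow> \<gamma> \<in> carrier (stalk T A x) \<Longrightarrow> \<gamma>' \<in> carrier (stalk T A x) \<Longrightarrow>
      \<forall>\<^sub>F y in nhdsin T x. propagate T A (c \<odot>\<^bsub>stalk T A x\<^esub> \<gamma> \<oplus>\<^bsub>stalk T A x\<^esub> \<gamma>') y =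
        c \<odot>\<^bsub>stalk T A y\<^esub> propagate T A \<gamma> y \<oplus>\<^bsub>stalk T A y\<^esub> propagate T A \<gamma>' y"
    and propagate_propagate: "x \<in> topspace T \<Longrightarrow> \<gamma> \<in> carrier (stalk T A x) \<Longrightarrow>
      \<forall>\<^sub>F y in nhdsin T x. \<forall>\<^sub>F z in nhdsin T y. propagate T A (propagate T A \<gamma> y) z = propagate T A \<gamma> z"
begin

abbreviation "S \<equiv> stalk T A"
abbreviation "D \<equiv> alt_diff T A"

text \<open>Cochains as functions of the last \<open>n\<close> points; \<open>x\<close> is the point before these.\<close>

definition cochain :: "nat \<Rightarrow> 'a \<Rightarrow> ('a list \<Rightarrow> ('a, 'm) germ) \<Rightarrow> bool" where
  "cochain n x f \<longleftrightarrow> (\<forall>ys\<in>plists T n. f ys \<in> carrier (S (last (x # ys))))"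

lemma last_in_topspace: "ys \<in> plists T n \<Longrightarrow> ys \<noteq> [] \<Longrightarrow> last ys \<in> topspace T"
  using last_in_set by blast

lemma cochain_Cons: "cochain (Suc n) x f \<Longrightarrow> y \<in> topspace T \<Longrightarrow> cochain n y (\<lambda>ys. f (y # ys))"
  unfolding cochain_def
proof
  fix ys assume f: "\<forall>ys\<in>plists T (Suc n). f ys \<in> carrier (S (last (x # ys)))"
    and "y \<in> topspace T" "ys \<in> plists T n"
  then have "y # ys \<in> plists T (Suc n)" by simp
  from bspec[OF f this] show "f (y # ys) \<in> carrier (S (last (y # ys)))" by simp
qed

lemma cochain_Suc: "cochain (Suc n) x f \<longleftrightarrow> (\<forall>ys\<in>plists T (Suc n). f ys \<in> carrier (S (last ys)))"
  unfolding cochain_def by (rule ball_cong) auto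

lemma D_closed:
  "x \<in> topspace T \<Longrightarrow> cochain n x f \<Longrightarrow> ys \<in> plists T (Suc n) \<Longrightarrow> D f ys \<in> carrier (S (last ys))"
proof (induction n arbitrary: x f ys)
  case 0
  then obtain y where "ys = [y]" by (auto simp: length_Suc_conv)
  then show ?case using 0 by (auto simp: cochain_def intro: propagate_closed)
next
  case (Suc n)
  obtain y zs where ys: "ys = y # zs" using Suc.prems(3) by (cases ys) auto
  have zs: "zs \<noteq> []" "zs \<in> plists T (Suc n)" "y \<in> topspace T" using Suc.prems(3) ys by auto
  interpret Module.module complex_ring "S (last zs)"
    by (rule stalk_module[OF last_in_topspace[OF zs(2,1)]])
  have "f zs \<in> carrier (S (last zs))" "D (\<lambda>ys. f (y # ys)) zs \<in> carrier (S (last zs))"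
    using Suc.prems(2) zs Suc.IH[OF zs(3) cochain_Cons[OF Suc.prems(2) zs(3)] zs(2)]
    by (auto simp: cochain_Suc)
  then show ?case using ys zs(1) by simp
qed

text \<open>A single unfolding of the recursion, separated from the induction because it is used
  twice: inside the induction, and for the first point of the lists on which cochains live.\<close>

lemma D_linear_Cons:
  assumes y: "y \<in> topspace T" and f: "cochain (Suc n) y f" and g: "cochain (Suc n) y g"
    and h: "\<And>ys. ys \<in> plists T (Suc n) \<Longrightarrow> h ys = c \<odot>\<^bsub>S (last ys)\<^esub> f ys \<oplus>\<^bsub>S (last ys)\<^esub> g ys"
    and near: "near T (Suc n) (\<lambda>ys. D (\<lambda>zs. h (y # zs)) ys =
        c \<odot>\<^bsub>S (last ys)\<^esub> D (\<lambda>zs. f (y # zs)) ys \<oplus>\<^bsub>S (last ys)\<^esub> D (\<lambda>zs. g (y # zs)) ys) y"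
  shows "near T (Suc n) (\<lambda>ys. D h (y # ys) =
    c \<odot>\<^bsub>S (last ys)\<^esub> D f (y # ys) \<oplus>\<^bsub>S (last ys)\<^esub> D g (y # ys)) y"
  using near
proof (rule near_mono)
  fix ys assume ys: "ys \<in> plists T (Suc n)" and
    eq: "D (\<lambda>zs. h (y # zs)) ys =
    c \<odot>\<^bsub>S (last ys)\<^esub> D (\<lambda>zs. f (y # zs)) ys \<oplus>\<^bsub>S (last ys)\<^esub> D (\<lambda>zs. g (y # zs)) ys"
  have ne: "ys \<noteq> []" using ys by auto
  interpret Module.module complex_ring "S (last ys)"
    by (rule stalk_module[OF last_in_topspace[OF ys ne]])
  have carr: "f ys \<in> carrier (S (last ys))" "g ys \<in> carrier (S (last ys))"
    "D (\<lambda>zs. f (y # zs)) ys \<in> carrier (S (last ys))" "D (\<lambda>zs. g (y # zs)) ys \<in> carrier (S (last ys))"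
    using f g D_closed[OF y cochain_Cons[OF f y] ys] D_closed[OF y cochain_Cons[OF g y] ys] ys
    by (auto simp: cochain_Suc)
  show "D h (y # ys) =
    c \<odot>\<^bsub>S (last ys)\<^esub> D f (y # ys) \<oplus>\<^bsub>S (last ys)\<^esub> D g (y # ys)"
    using complex_module_rearrange[OF module_axioms carr(1,3,2,4)] ne by (simp add: h[OF ys] eq)
qed

text \<open>All terms that omit a point are strictly linear. Only the propagated term needs
  shrinking, and it restricts the last point relative to the one before it; hence all earlier points
  range over the whole space and the base case carries the content.\<close>

lemma D_linear:
  assumes "x \<in> topspace T" "cochain n x f" "cochain n x g"
    and "\<And>ys. ys \<in> plists T n \<Longrightarrow> h ys = c \<odot>\<^bsub>S (last (x # ys))\<^esub> f ys \<oplus>\<^bsub>S (last (x # ys))\<^esub> g ys"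
  shows "near T (Suc n) (\<lambda>ys. D h ys = c \<odot>\<^bsub>S (last ys)\<^esub> D f ys \<oplus>\<^bsub>S (last ys)\<^esub> D g ys) x"
  using assms
proof (induction n arbitrary: x f g h)
  case 0
  then show ?case using propagate_linear[of x "f []" "g []" c] by (auto simp: cochain_def)
next
  case (Suc n)
  show ?case
    unfolding near.simps(2)[of T "Suc n"]
  proof (rule eventually_mono[OF eventually_nhdsin_topspace])
    fix y assume y: "y \<in> topspace T"
    have f: "cochain (Suc n) y f" and g: "cochain (Suc n) y g"
      using Suc.prems(2,3) by (auto simp: cochain_Suc)
    have h: "h ys = c \<odot>\<^bsub>S (last ys)\<^esub> f ys \<oplus>\<^bsub>S (last ys)\<^esub> g ys" if "ys \<in> plists T (Suc n)" for ys
      using Suc.prems(4)[OF that] that by (auto split: if_splits)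
    have near: "near T (Suc n) (\<lambda>ys. D (\<lambda>zs. h (y # zs)) ys =
        c \<odot>\<^bsub>S (last ys)\<^esub> D (\<lambda>zs. f (y # zs)) ys \<oplus>\<^bsub>S (last ys)\<^esub> D (\<lambda>zs. g (y # zs)) ys) y"
      by (rule Suc.IH[OF y cochain_Cons[OF f y] cochain_Cons[OF g y]]) (use h y in auto)
    show "near T (Suc n) (\<lambda>ys. D h (y # ys) =
      c \<odot>\<^bsub>S (last (y # ys))\<^esub> D f (y # ys) \<oplus>\<^bsub>S (last (y # ys))\<^esub> D g (y # ys)) y"
      by (rule near_mono[OF D_linear_Cons[OF y f g h near]]) auto
  qed
qed

lemma D_cong_Cons:
  assumes "near T (Suc n) (\<lambda>ys. f ys = g ys) y" "near T (Suc n) (\<lambda>ys. D (\<lambda>zs. f (y # zs)) ys = D (\<lambda>zs. g (y # zs)) ys) y"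
  shows "near T (Suc n) (\<lambda>ys. D f (y # ys) = D g (y # ys)) y"
  using assms by (rule near_mono2) auto

text \<open>The term that omits \<open>y\<close> evaluates the functions on lists whose first entry
  is close to \<open>y\<close> instead of \<open>x\<close>; \<open>near_shift\<close> provides the
  equality there. The other terms keep \<open>y\<close> and fall to the induction.\<close>

lemma D_cong:
  "near T n (\<lambda>ys. f ys = g ys) x \<Longrightarrow> near T (Suc n) (\<lambda>ys. D f ys = D g ys) x"
proof (induction n arbitrary: x f g)
  case (Suc n)
  have "\<forall>\<^sub>F y in nhdsin T x. near T (Suc n) (\<lambda>ys. f ys = g ys) y \<and> near T n (\<lambda>ys. f (y # ys) = g (y # ys)) y"
    using near_shift[OF Suc.prems] Suc.prems by (simp add: eventually_conj_iff)
  then show ?case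
    unfolding near.simps(2)[of T "Suc n"]
  proof (rule eventually_mono, elim conjE)
    fix y assume "near T (Suc n) (\<lambda>ys. f ys = g ys) y" "near T n (\<lambda>ys. f (y # ys) = g (y # ys)) y"
    then show "near T (Suc n) (\<lambda>ys. D f (y # ys) = D g (y # ys)) y"
      by (intro D_cong_Cons Suc.IH)
  qed
qed auto

text \<open>Write \<open>fx\<close> for \<open>f\<close> with first point \<open>x\<close> inserted.
  Two unfoldings give \<open>D (D f) (x # ys)\<close> as \<open>D f ys\<close> minus
  \<open>D\<close> of \<open>f\<close> minus \<open>D fx\<close>. By linearity the two copies of
  \<open>D f ys\<close> cancel and \<open>D (D fx) ys\<close> remains.\<close>

lemma D_D_Cons:
  assumes x: "x \<in> topspace T" and f: "cochain (Suc n) x f"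
  shows "near T (Suc (Suc n)) (\<lambda>ys. D (D f) (x # ys) = D (D (\<lambda>zs. f (x # zs))) ys) x"
proof -
  let ?fx = "\<lambda>zs. f (x # zs)"
  have fx: "cochain n x ?fx" by (rule cochain_Cons[OF f x])
  have dfx: "cochain (Suc n) x (D ?fx)"
    unfolding cochain_Suc using D_closed[OF x fx] by blast
  have df: "cochain (Suc n) x (\<lambda>zs. D f (x # zs))"
    unfolding cochain_Suc
  proof
    fix ys assume "ys \<in> plists T (Suc n)"
    then show "D f (x # ys) \<in> carrier (S (last ys))"
      using D_closed[OF x f, of "x # ys"] x by auto
  qed
  have "near T (Suc (Suc n)) (\<lambda>ys. D (\<lambda>zs. D f (x # zs)) ys =
      (-1) \<odot>\<^bsub>S (last ys)\<^esub> D (D ?fx) ys \<oplus>\<^bsub>S (last ys)\<^esub> D f ys) x"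
  proof (rule D_linear[OF x dfx f])
    fix ys assume ys: "ys \<in> plists T (Suc n)"
    then have ne: "ys \<noteq> []" by auto
    interpret Module.module complex_ring "S (last ys)"
      by (rule stalk_module[OF last_in_topspace[OF ys ne]])
    have "f ys \<in> carrier (S (last ys))" "D ?fx ys \<in> carrier (S (last ys))"
      using f dfx ys by (auto simp: cochain_Suc)
    then show "D f (x # ys) =
        (-1) \<odot>\<^bsub>S (last (x # ys))\<^esub> D ?fx ys \<oplus>\<^bsub>S (last (x # ys))\<^esub> f ys"
      using ne by (simp add: M.a_comm)
  qed
  then show ?thesis
  proof (rule near_mono)
    fix ys assume ys: "ys \<in> plists T (Suc (Suc n))"
      and eq: "D (\<lambda>zs. D f (x # zs)) ys =
        (-1) \<odot>\<^bsub>S (last ys)\<^esub> D (D ?fx) ys \<oplus>\<^bsub>S (last ys)\<^esub> D f ys"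
    have ne: "ys \<noteq> []" using ys by auto
    interpret Module.module complex_ring "S (last ys)"
      by (rule stalk_module[OF last_in_topspace[OF ys ne]])
    have carr: "D f ys \<in> carrier (S (last ys))" "D (D ?fx) ys \<in> carrier (S (last ys))"
      using D_closed[OF x f ys] D_closed[OF x dfx ys] by auto
    have "D (D f) (x # ys) = D f ys \<oplus>\<^bsub>S (last ys)\<^esub> (-1) \<odot>\<^bsub>S (last ys)\<^esub> D (\<lambda>zs. D f (x # zs)) ys"
      by (simp only: alt_diff.simps(2)[of T A "D f" x ys] ne if_False)
    also have "\<dots> = D f ys \<oplus>\<^bsub>S (last ys)\<^esub> (-1) \<odot>\<^bsub>S (last ys)\<^esub>
        (D f ys \<oplus>\<^bsub>S (last ys)\<^esub> (-1) \<odot>\<^bsub>S (last ys)\<^esub> D (D ?fx) ys)"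
      unfolding eq using carr by (simp only: M.a_comm complex_ring_simps UNIV_I smult_closed)
    also have "\<dots> = D (D ?fx) ys"
      by (rule complex_module_add_cancel(3)[OF module_axioms carr])
    finally show "D (D f) (x # ys) = D (D ?fx) ys" .
  qed
qed

text \<open>\<open>D_D_Cons\<close> absorbs the first point into \<open>f\<close> until two points
  are left. What remains is the difference between propagating a germ directly to \<open>z\<close>
  and propagating it through \<open>y\<close>, which vanishes near by.\<close>

lemma D_D:
  "x \<in> topspace T \<Longrightarrow> cochain n x f \<Longrightarrow>
    near T (Suc (Suc n)) (\<lambda>ys. D (D f) ys = \<zero>\<^bsub>S (last ys)\<^esub>) x"
proof (induction n arbitrary: x f)
  case 0
  have f: "f [] \<in> carrier (S x)" using 0 by (auto simp: cochain_def)
  have "\<forall>\<^sub>F y in nhdsin T x. (\<forall>\<^sub>F z in nhdsin T y. propagate T A (propagate T A (f []) y) z = propagate T A (f []) z)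
      \<and> y \<in> topspace T"
    using propagate_propagate[OF 0(1) f] eventually_nhdsin_topspace by (simp add: eventually_conj_iff)
  then show ?case
    unfolding near.simps
  proof (rule eventually_mono, elim conjE)
    fix y assume y: "y \<in> topspace T"
      and "\<forall>\<^sub>F z in nhdsin T y. propagate T A (propagate T A (f []) y) z = propagate T A (f []) z"
    then have "\<forall>\<^sub>F z in nhdsin T y. propagate T A (propagate T A (f []) y) z = propagate T A (f []) z \<and> z \<in> topspace T"
      using eventually_nhdsin_topspace by (simp add: eventually_conj_iff)
    then show "\<forall>\<^sub>F z in nhdsin T y. D (D f) [y, z] = \<zero>\<^bsub>S (last [y, z])\<^esub>"
    proof (rule eventually_mono, elim conjE)
      fix z assume z: "z \<in> topspace T" and eq: "propagate T A (propagate T A (f []) y) z = propagate T A (f []) z"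
      show "D (D f) [y, z] = \<zero>\<^bsub>S (last [y, z])\<^esub>"
        using complex_module_add_cancel(1)[OF stalk_module[OF z] propagate_closed[OF 0(1) z f]] propagate_closed[OF 0(1) z f]
        by (simp add: eq)
    qed
  qed
next
  case (Suc n)
  show ?case
    unfolding near.simps(2)[of T "Suc (Suc n)"]
  proof (rule eventually_mono[OF eventually_nhdsin_topspace])
    fix y assume y: "y \<in> topspace T"
    have f: "cochain (Suc n) y f" using Suc.prems(2) by (simp add: cochain_Suc)
    show "near T (Suc (Suc n)) (\<lambda>ys. D (D f) (y # ys) = \<zero>\<^bsub>S (last (y # ys))\<^esub>) y"
      by (rule near_mono2[OF D_D_Cons[OF y f] Suc.IH[OF y cochain_Cons[OF f y]]]) auto
  qed
qed

text \<open>Identifies the recursion with the alternating sum in \<open>gdiff\<close>. The summand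
  for \<open>j = 0\<close> omits \<open>y\<close> and is \<open>f zs\<close>; the summand for
  \<open>j + 1\<close> omits the \<open>j\<close>-th point of \<open>zs\<close> while keeping
  \<open>y\<close>, with the opposite sign.\<close>

lemma D_eq_finsum:
  "x \<in> topspace T \<Longrightarrow> cochain n x f \<Longrightarrow> ys \<in> plists T (Suc n) \<Longrightarrow>
    D f ys = finsum (S (last ys)) (\<lambda>j. signed (S (last ys)) (int j) (f (take j ys @ drop (Suc j) ys))) {..<n}
      \<oplus>\<^bsub>S (last ys)\<^esub> signed (S (last ys)) (int n) (propagate T A (f (butlast ys)) (last ys))"
proof (induction n arbitrary: x f ys)
  case 0
  then obtain y where y: "ys = [y]" "y \<in> topspace T" by (auto simp: length_Suc_conv)
  interpret Module.module complex_ring "S y" by (rule stalk_module[OF y(2)])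
  show ?case using 0 y propagate_closed[OF 0(1) y(2)] by (simp add: cochain_def signed_def)
next
  case (Suc n)
  obtain y zs where ys: "ys = y # zs" using Suc.prems(3) by (cases ys) auto
  have zs: "zs \<noteq> []" "zs \<in> plists T (Suc n)" "y \<in> topspace T" using Suc.prems(3) ys by auto
  note last = last_in_topspace[OF zs(2,1)]
  let ?S = "S (last zs)" and ?f = "\<lambda>ws. f (y # ws)"
  interpret Module.module complex_ring ?S by (rule stalk_module[OF last])
  have signed: "signed ?S (int (Suc j)) s = (-1) \<odot>\<^bsub>?S\<^esub> signed ?S (int j) s" if "s \<in> carrier ?S" for j s
    using that complex_module_minus[OF module_axioms that] by (simp add: signed_def complex_module_smult[OF module_axioms])
  have closed: "signed ?S m s \<in> carrier ?S" if "s \<in> carrier ?S" for m s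
    using that by (simp add: signed_def)
  have smult_finsum: "(-1) \<odot>\<^bsub>?S\<^esub> finsum ?S t {..<k} = finsum ?S (\<lambda>j. (-1) \<odot>\<^bsub>?S\<^esub> t j) {..<k}"
    if "t \<in> {..<k} \<rightarrow> carrier ?S" for t and k :: nat
    using that by (induction k) (auto simp: complex_module_smult[OF module_axioms] lessThan_Suc smult_r_distr Pi_def)
  have face: "f (take j ys @ drop (Suc j) ys) \<in> carrier ?S" if "j < Suc n" for j
  proof -
    have "take j ys @ drop (Suc j) ys \<in> plists T (Suc n)"
      using Suc.prems(3) that by (auto dest: in_set_takeD in_set_dropD)
    moreover have "last (take j ys @ drop (Suc j) ys) = last zs"
      using that zs ys by (auto simp: last_append)
    ultimately show ?thesis
      using bspec[OF Suc.prems(2)[unfolded cochain_Suc]] by metis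
  qed
  have face': "f (y # take j zs @ drop (Suc j) zs) \<in> carrier ?S" if "j < n" for j
    using face[of "Suc j"] that ys by simp
  have fbl: "f (y # butlast zs) \<in> carrier (S (last (y # butlast zs)))" "last (y # butlast zs) \<in> topspace T"
  proof -
    have *: "y # butlast zs \<in> plists T (Suc n)" using zs by (auto dest: in_set_butlastD)
    show "f (y # butlast zs) \<in> carrier (S (last (y # butlast zs)))" "last (y # butlast zs) \<in> topspace T"
      using bspec[OF Suc.prems(2)[unfolded cochain_Suc] *] last_in_topspace[OF *] by simp_all
  qed
  note pcl = propagate_closed[OF fbl(2) last fbl(1)]
  have fzs: "f zs \<in> carrier ?S" using face[of 0] by (simp add: ys)
  have sum: "finsum ?S (\<lambda>j. signed ?S (int j) (f (take j ys @ drop (Suc j) ys))) {..<Suc n} =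
    f zs \<oplus>\<^bsub>?S\<^esub> finsum ?S (\<lambda>j. (-1) \<odot>\<^bsub>?S\<^esub> signed ?S (int j) (f (y # take j zs @ drop (Suc j) zs))) {..<n}"
  proof -
    have "finsum ?S (\<lambda>j. signed ?S (int j) (f (take j ys @ drop (Suc j) ys))) (insert 0 (Suc ` {..<n})) =
      signed ?S (int 0) (f (take 0 ys @ drop (Suc 0) ys)) \<oplus>\<^bsub>?S\<^esub>
      finsum ?S (\<lambda>j. signed ?S (int j) (f (take j ys @ drop (Suc j) ys))) (Suc ` {..<n})"
      using face face[of 0] by (intro M.finsum_insert) (auto intro!: closed)
    also have "finsum ?S (\<lambda>j. signed ?S (int j) (f (take j ys @ drop (Suc j) ys))) (Suc ` {..<n}) =
      finsum ?S (\<lambda>j. signed ?S (int (Suc j)) (f (take (Suc j) ys @ drop (Suc (Suc j)) ys))) {..<n}"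
      using face by (intro M.finsum_reindex) (auto intro!: closed)
    also have "\<dots> = finsum ?S (\<lambda>j. (-1) \<odot>\<^bsub>?S\<^esub> signed ?S (int j) (f (y # take j zs @ drop (Suc j) zs))) {..<n}"
      using face' ys by (intro M.finsum_cong') (auto simp: signed simp del: of_nat_Suc intro!: closed)
    finally show ?thesis using ys by (simp add: lessThan_Suc_eq_insert_0 signed_def)
  qed
  have carr: "finsum ?S (\<lambda>j. signed ?S (int j) (f (y # take j zs @ drop (Suc j) zs))) {..<n} \<in> carrier ?S"
    using face' by (intro M.finsum_closed) (auto intro!: closed)
  have "D f ys = f zs \<oplus>\<^bsub>?S\<^esub> (-1) \<odot>\<^bsub>?S\<^esub> D ?f zs" using ys zs by simp
  also have "D ?f zs = finsum ?S (\<lambda>j. signed ?S (int j) (f (y # take j zs @ drop (Suc j) zs))) {..<n}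
      \<oplus>\<^bsub>?S\<^esub> signed ?S (int n) (propagate T A (f (y # butlast zs)) (last zs))"
    by (rule Suc.IH[OF zs(3) cochain_Cons[OF Suc.prems(2) zs(3)] zs(2)])
  also have "f zs \<oplus>\<^bsub>?S\<^esub> (-1) \<odot>\<^bsub>?S\<^esub> \<dots> =
      finsum ?S (\<lambda>j. signed ?S (int j) (f (take j ys @ drop (Suc j) ys))) {..<Suc n}
      \<oplus>\<^bsub>?S\<^esub> signed ?S (int (Suc n)) (propagate T A (f (y # butlast zs)) (last zs))"
    unfolding sum using fzs carr pcl face'
    by (simp add: smult_r_distr signed smult_finsum closed M.a_assoc del: of_nat_Suc)
  finally show ?case using ys zs(1) by simp
qed

text \<open>Cochains of degree \<open>q\<close> take \<open>q + 1\<close> points, so the list is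
  nonempty and the base point in \<open>cochain\<close> is never read. It is left free here; where a
  lemma requires one, the head of the list serves.\<close>

lemma cochain_iff: "f \<in> carrier (gcochains T A q) \<longleftrightarrow> f \<in> extensional (glists T q) \<and> cochain (Suc q) x f"
  by (auto simp: gcochains_def cochain_Suc glists_def PiE_def Pi_def)

lemma gdiff_eq:
  assumes "f \<in> carrier (gcochains T A q)"
  shows "gdiff T A q f = (\<lambda>xs\<in>glists T (Suc q). D f xs)"
  unfolding gdiff_def
proof (rule restrict_ext)
  fix xs assume xs: "xs \<in> glists T (Suc q)"
  have "xs \<noteq> []" using xs by (auto simp: glists_def)
  then have "hd xs \<in> topspace T" using xs hd_in_set[of xs] unfolding glists_def by blast
  from D_eq_finsum[OF this, of "Suc q" f xs] show "(let S = stalk T A (last xs) in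
     finsum S (\<lambda>j. signed S (int j) (f (take j xs @ drop (Suc j) xs))) {..q}
     \<oplus>\<^bsub>S\<^esub> signed S (int (Suc q)) (propagate T A (f (butlast xs)) (last xs))) = D f xs"
    using assms xs unfolding cochain_iff[of f q "hd xs"]
    by (simp add: Let_def glists_def lessThan_Suc_atMost)
qed

lemma gdiff_closed: "f \<in> carrier (gcochains T A q) \<Longrightarrow> gdiff T A q f \<in> carrier (gcochains T A (Suc q))"
proof -
  assume f: "f \<in> carrier (gcochains T A q)"
  have "D f xs \<in> carrier (S (last xs))" if "xs \<in> glists T (Suc q)" for xs
  proof -
    have "xs \<noteq> []" using that by (auto simp: glists_def)
    then have "hd xs \<in> topspace T" using that hd_in_set[of xs] unfolding glists_def by blast
    from D_closed[OF this, of "Suc q" f xs] show ?thesis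
      using f that unfolding cochain_iff[of f q "hd xs"] by (simp add: glists_def)
  qed
  then show ?thesis unfolding gdiff_eq[OF f] by (auto simp: gcochains_def)
qed

lemma glists_stalk_module: "xs \<in> glists T q \<Longrightarrow> complex_module (S (last xs))"
  by (intro stalk_module last_in_topspace[of _ "Suc q"]) (auto simp: glists_def)

lemma complex_module_gcochains: "complex_module (gcochains T A q)"
proof -
  note M = glists_stalk_module[of _ q]
  note G = M[THEN Module.module.axioms(2), THEN abelian_group.axioms(1)]
  show ?thesis
    by (rule complex_module_of_evaluation[OF M, where e = "\<lambda>xs f. f xs"])
      (auto simp: gcochains_def PiE_iff abelian_monoid.a_closed[OF G] abelian_monoid.zero_closed[OF G]
        Module.module.smult_closed[OF M] intro: extensionalityI)
qed

text \<open>\<open>gdiff\<close> is \<open>D\<close> cut off outside the lists of the right length,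
  and \<open>near\<close> tests only such lists, so the cut-off may be ignored.\<close>

lemma gcochain_eq_gdiffI:
  assumes "f \<in> carrier (gcochains T A q)"
    and "\<And>x. x \<in> topspace T \<Longrightarrow> near T (Suc q) (\<lambda>ys. D f (x # ys) = g (x # ys)) x"
  shows "gcochain_eq T (Suc q) (gdiff T A q f) g"
  unfolding gcochain_eq_iff_near gdiff_eq[OF assms(1)]
proof
  fix x assume x: "x \<in> topspace T"
  show "near T (Suc q) (\<lambda>ys. (\<lambda>xs\<in>glists T (Suc q). D f xs) (x # ys) = g (x # ys)) x"
    by (rule near_mono[OF assms(2)[OF x]]) (use x in \<open>simp add: glists_def\<close>)
qed

lemma cochain_of_gcochain:
  assumes "f \<in> carrier (gcochains T A q)"
  shows "cochain (Suc q) x f" "x \<in> topspace T \<Longrightarrow> cochain q x (\<lambda>ys. f (x # ys))"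
proof -
  show "cochain (Suc q) x f" using assms cochain_iff by blast
  then show "x \<in> topspace T \<Longrightarrow> cochain q x (\<lambda>ys. f (x # ys))" by (rule cochain_Cons)
qed

lemma near_D_linear:
  assumes f: "f \<in> carrier (gcochains T A q)" and g: "g \<in> carrier (gcochains T A q)"
    and x: "x \<in> topspace T"
    and h: "\<And>xs. xs \<in> glists T q \<Longrightarrow> h xs = c \<odot>\<^bsub>S (last xs)\<^esub> f xs \<oplus>\<^bsub>S (last xs)\<^esub> g xs"
  shows "near T (Suc q) (\<lambda>ys. D h (x # ys) =
    c \<odot>\<^bsub>S (last ys)\<^esub> D f (x # ys) \<oplus>\<^bsub>S (last ys)\<^esub> D g (x # ys)) x"
proof (rule D_linear_Cons[OF x cochain_of_gcochain(1)[OF f] cochain_of_gcochain(1)[OF g]])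
  show "near T (Suc q) (\<lambda>ys. D (\<lambda>zs. h (x # zs)) ys =
        c \<odot>\<^bsub>S (last ys)\<^esub> D (\<lambda>zs. f (x # zs)) ys \<oplus>\<^bsub>S (last ys)\<^esub> D (\<lambda>zs. g (x # zs)) ys) x"
    by (rule D_linear[OF x cochain_of_gcochain(2)[OF f x] cochain_of_gcochain(2)[OF g x]])
      (use h x in \<open>simp add: glists_def\<close>)
qed (use h in \<open>simp add: glists_def\<close>)

lemma gdiff_linear:
  assumes f: "f \<in> carrier (gcochains T A q)" and g: "g \<in> carrier (gcochains T A q)"
  shows "gcochain_eq T (Suc q)
    (gdiff T A q (c \<odot>\<^bsub>gcochains T A q\<^esub> f \<oplus>\<^bsub>gcochains T A q\<^esub> g))
    (c \<odot>\<^bsub>gcochains T A (Suc q)\<^esub> gdiff T A q f \<oplus>\<^bsub>gcochains T A (Suc q)\<^esub> gdiff T A q g)"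
proof (rule gcochain_eq_gdiffI)
  interpret Module.module complex_ring "gcochains T A q" by (rule complex_module_gcochains)
  show "c \<odot>\<^bsub>gcochains T A q\<^esub> f \<oplus>\<^bsub>gcochains T A q\<^esub> g \<in> carrier (gcochains T A q)"
    using f g by (intro M.a_closed smult_closed) auto
  fix x assume x: "x \<in> topspace T"
  have "near T (Suc q) (\<lambda>ys. D (c \<odot>\<^bsub>gcochains T A q\<^esub> f \<oplus>\<^bsub>gcochains T A q\<^esub> g) (x # ys) =
      c \<odot>\<^bsub>S (last ys)\<^esub> D f (x # ys) \<oplus>\<^bsub>S (last ys)\<^esub> D g (x # ys)) x"
    by (rule near_D_linear[OF f g x]) (simp add: gcochains_def)
  then show "near T (Suc q) (\<lambda>ys. D (c \<odot>\<^bsub>gcochains T A q\<^esub> f \<oplus>\<^bsub>gcochains T A q\<^esub> g) (x # ys) =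
    (c \<odot>\<^bsub>gcochains T A (Suc q)\<^esub> gdiff T A q f \<oplus>\<^bsub>gcochains T A (Suc q)\<^esub> gdiff T A q g) (x # ys)) x"
  proof (rule near_mono)
    fix ys assume ys: "ys \<in> plists T (Suc q)"
      and eq: "D (c \<odot>\<^bsub>gcochains T A q\<^esub> f \<oplus>\<^bsub>gcochains T A q\<^esub> g) (x # ys) =
        c \<odot>\<^bsub>S (last ys)\<^esub> D f (x # ys) \<oplus>\<^bsub>S (last ys)\<^esub> D g (x # ys)"
    have "ys \<noteq> []" "x # ys \<in> glists T (Suc q)" using ys x by (auto simp: glists_def)
    then show "D (c \<odot>\<^bsub>gcochains T A q\<^esub> f \<oplus>\<^bsub>gcochains T A q\<^esub> g) (x # ys) =
      (c \<odot>\<^bsub>gcochains T A (Suc q)\<^esub> gdiff T A q f \<oplus>\<^bsub>gcochains T A (Suc q)\<^esub> gdiff T A q g) (x # ys)"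
      unfolding eq gdiff_eq[OF f] gdiff_eq[OF g] by (simp add: gcochains_def del: alt_diff.simps)
  qed
qed

lemma gdiff_cong:
  assumes f: "f \<in> carrier (gcochains T A q)" and g: "g \<in> carrier (gcochains T A q)"
    and eq: "gcochain_eq T q f g"
  shows "gcochain_eq T (Suc q) (gdiff T A q f) (gdiff T A q g)"
proof (rule gcochain_eq_gdiffI[OF f])
  fix x assume x: "x \<in> topspace T"
  have near: "near T q (\<lambda>ys. f (y # ys) = g (y # ys)) y" if "y \<in> topspace T" for y
    using eq that by (simp add: gcochain_eq_iff_near)
  \<comment> \<open>The terms omitting \<open>x\<close> start at a point near \<open>x\<close>. The
    congruence of \<open>f\<close> and \<open>g\<close> is available at every first point, hence at
    these as well.\<close>
  have "near T (Suc q) (\<lambda>ys. f ys = g ys) x"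
    unfolding near.simps(2)[of T q] by (rule eventually_mono[OF eventually_nhdsin_topspace near])
  then have "near T (Suc q) (\<lambda>ys. D f (x # ys) = D g (x # ys)) x"
    by (intro D_cong_Cons D_cong near x)
  then show "near T (Suc q) (\<lambda>ys. D f (x # ys) = gdiff T A q g (x # ys)) x"
    by (rule near_mono) (use x in \<open>auto simp: gdiff_eq[OF g] glists_def simp del: alt_diff.simps\<close>)
qed

lemma gcochain_eq_of_eq: "(\<And>xs. xs \<in> glists T q \<Longrightarrow> f xs = g xs) \<Longrightarrow> gcochain_eq T q f g"
  unfolding gcochain_eq_iff_near by (intro ballI near_all) (simp add: glists_def)

lemma gdiff_gdiff:
  assumes f: "f \<in> carrier (gcochains T A q)"
  shows "gcochain_eq T (Suc (Suc q)) (gdiff T A (Suc q) (gdiff T A q f)) \<zero>\<^bsub>gcochains T A (Suc (Suc q))\<^esub>"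
proof (rule gcochain_eq_gdiffI[OF gdiff_closed[OF f]])
  fix x assume x: "x \<in> topspace T"
  have eq: "near T q' (\<lambda>ys. gdiff T A q f (y # ys) = D f (y # ys)) y"
    if "y \<in> topspace T" "q' = Suc q" for y q'
    using that by (intro near_all) (auto simp: gdiff_eq[OF f] glists_def simp del: alt_diff.simps)
  have eq': "near T (Suc (Suc q)) (\<lambda>ys. gdiff T A q f ys = D f ys) x"
    by (intro near_all) (auto simp: gdiff_eq[OF f] glists_def simp del: alt_diff.simps)
  \<comment> \<open>The inner \<open>gdiff\<close> is replaced by \<open>D\<close>. They agree on
    all lists that are evaluated, and congruence of \<open>D\<close> carries this through the outer
    differential.\<close>
  have "near T (Suc (Suc q)) (\<lambda>ys. D (gdiff T A q f) (x # ys) = D (D f) (x # ys)) x"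
    by (intro D_cong_Cons D_cong eq eq' x refl)
  moreover have "near T (Suc (Suc q)) (\<lambda>ys. D (D f) (x # ys) = \<zero>\<^bsub>S (last ys)\<^esub>) x"
    using D_D_Cons[OF x cochain_of_gcochain(1)[OF f]] D_D[OF x cochain_of_gcochain(2)[OF f x]]
    by (rule near_mono2) simp
  ultimately show "near T (Suc (Suc q))
      (\<lambda>ys. D (gdiff T A q f) (x # ys) = \<zero>\<^bsub>gcochains T A (Suc (Suc q))\<^esub> (x # ys)) x"
    by (rule near_mono2) (use x in \<open>auto simp: gcochains_def glists_def simp del: alt_diff.simps\<close>)
qed

lemma quasi_complex_gcochains: "quasi_complex (gcochains T A) (gcochain_eq T) (gdiff T A)"
proof (rule quasi_complex.intro)
  fix q and x y z :: "'a list \<Rightarrow> ('a, 'm) germ"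
  show "gcochain_eq T q x x" by (rule gcochain_eq_of_eq) simp
  show "gcochain_eq T q x y \<Longrightarrow> gcochain_eq T q y x"
    by (simp add: gcochain_eq_iff_near eq_commute)
  show "gcochain_eq T q x y \<Longrightarrow> gcochain_eq T q y z \<Longrightarrow> gcochain_eq T q x z"
    unfolding gcochain_eq_iff_near
  proof
    fix a assume "\<forall>a\<in>topspace T. near T q (\<lambda>ys. x (a # ys) = y (a # ys)) a"
      "\<forall>a\<in>topspace T. near T q (\<lambda>ys. y (a # ys) = z (a # ys)) a" "a \<in> topspace T"
    then have "near T q (\<lambda>ys. x (a # ys) = y (a # ys)) a" "near T q (\<lambda>ys. y (a # ys) = z (a # ys)) a"
      by blast+
    then show "near T q (\<lambda>ys. x (a # ys) = z (a # ys)) a" by (rule near_mono2) simp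
  qed
  show "gcochain_eq T q x y \<Longrightarrow> gcochain_eq T q (c \<odot>\<^bsub>gcochains T A q\<^esub> x) (c \<odot>\<^bsub>gcochains T A q\<^esub> y)" for c
    unfolding gcochain_eq_iff_near
  proof
    fix a assume "\<forall>a\<in>topspace T. near T q (\<lambda>ys. x (a # ys) = y (a # ys)) a" "a \<in> topspace T"
    then have "near T q (\<lambda>ys. x (a # ys) = y (a # ys)) a" by blast
    then show "near T q (\<lambda>ys. (c \<odot>\<^bsub>gcochains T A q\<^esub> x) (a # ys) = (c \<odot>\<^bsub>gcochains T A q\<^esub> y) (a # ys)) a"
      by (rule near_mono) (simp add: gcochains_def restrict_def)
  qed
  show "gcochain_eq T q x x' \<Longrightarrow> gcochain_eq T q y y' \<Longrightarrow>
      gcochain_eq T q (x \<oplus>\<^bsub>gcochains T A q\<^esub> y) (x' \<oplus>\<^bsub>gcochains T A q\<^esub> y')" for x' y'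
    unfolding gcochain_eq_iff_near
  proof
    fix a assume "\<forall>a\<in>topspace T. near T q (\<lambda>ys. x (a # ys) = x' (a # ys)) a"
      "\<forall>a\<in>topspace T. near T q (\<lambda>ys. y (a # ys) = y' (a # ys)) a" "a \<in> topspace T"
    then have "near T q (\<lambda>ys. x (a # ys) = x' (a # ys)) a" "near T q (\<lambda>ys. y (a # ys) = y' (a # ys)) a"
      by blast+
    then show "near T q (\<lambda>ys. (x \<oplus>\<^bsub>gcochains T A q\<^esub> y) (a # ys) = (x' \<oplus>\<^bsub>gcochains T A q\<^esub> y') (a # ys)) a"
      by (rule near_mono2) (simp add: gcochains_def restrict_def)
  qed
  assume x: "x \<in> carrier (gcochains T A q)"
  show "gcochain_eq T (Suc q) (gdiff T A q (c \<odot>\<^bsub>gcochains T A q\<^esub> x)) (c \<odot>\<^bsub>gcochains T A (Suc q)\<^esub> gdiff T A q x)" for c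
  proof -
    \<comment> \<open>Homogeneity is read off from linearity with both cochains equal to
      \<open>x\<close> and coefficient \<open>c - 1\<close>, since \<open>c - 1\<close> times
      \<open>x\<close> plus \<open>x\<close> is \<open>c\<close> times \<open>x\<close>.\<close>
    have *: "(c - 1) \<odot>\<^bsub>gcochains T A p\<^esub> f \<oplus>\<^bsub>gcochains T A p\<^esub> f = c \<odot>\<^bsub>gcochains T A p\<^esub> f"
      if "f \<in> carrier (gcochains T A p)" for f p
      using that Module.module.smult_l_distr[OF complex_module_gcochains, of "c - 1" 1 f p]
      by (simp add: complex_module_smult(1)[OF complex_module_gcochains])
    show ?thesis using gdiff_linear[OF x x, of "c - 1"] by (simp add: * x gdiff_closed)
  qed
  assume y: "y \<in> carrier (gcochains T A q)"
  show "gcochain_eq T (Suc q) (gdiff T A q (x \<oplus>\<^bsub>gcochains T A q\<^esub> y))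
     (gdiff T A q x \<oplus>\<^bsub>gcochains T A (Suc q)\<^esub> gdiff T A q y)"
    using gdiff_linear[OF x y, of 1] complex_module_smult(1)[OF complex_module_gcochains]
    by (simp add: x gdiff_closed)
qed (fact complex_module_gcochains gdiff_closed gdiff_cong gdiff_gdiff)+

end

section \<open>Maps of stalk systems and exactness of Godement cochains\<close>

locale stalk_system_map = A: stalk_system T A + B: stalk_system T B
  for T :: "'a topology" and A :: "('a, complex, 'm) presheaf" and B :: "('a, complex, 'k) presheaf" +
  fixes \<phi> :: "'a \<Rightarrow> ('a, 'm) germ \<Rightarrow> ('a, 'k) germ"
  assumes \<phi>_linear: "x \<in> topspace T \<Longrightarrow> linear_map complex_ring (stalk T A x) (stalk T B x) (\<phi> x)"
    and \<phi>_propagate: "x \<in> topspace T \<Longrightarrow> \<gamma> \<in> carrier (stalk T A x) \<Longrightarrow>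
      \<forall>\<^sub>F y in nhdsin T x. propagate T B (\<phi> x \<gamma>) y = \<phi> y (propagate T A \<gamma> y)"
begin

definition induced :: "nat \<Rightarrow> ('a list \<Rightarrow> ('a, 'm) germ) \<Rightarrow> 'a list \<Rightarrow> ('a, 'k) germ" where
  "induced q f = (\<lambda>xs\<in>glists T q. \<phi> (last xs) (f xs))"

lemma \<phi>_closed: "x \<in> topspace T \<Longrightarrow> \<gamma> \<in> carrier (A.S x) \<Longrightarrow> \<phi> x \<gamma> \<in> carrier (B.S x)"
  and \<phi>_add: "x \<in> topspace T \<Longrightarrow> \<gamma> \<in> carrier (A.S x) \<Longrightarrow> \<gamma>' \<in> carrier (A.S x) \<Longrightarrow>
    \<phi> x (\<gamma> \<oplus>\<^bsub>A.S x\<^esub> \<gamma>') = \<phi> x \<gamma> \<oplus>\<^bsub>B.S x\<^esub> \<phi> x \<gamma>'"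
  and \<phi>_smult: "x \<in> topspace T \<Longrightarrow> \<gamma> \<in> carrier (A.S x) \<Longrightarrow> \<phi> x (c \<odot>\<^bsub>A.S x\<^esub> \<gamma>) = c \<odot>\<^bsub>B.S x\<^esub> \<phi> x \<gamma>"
  using \<phi>_linear[of x] by (simp_all add: linear_map_def)

lemma D_natural_Cons:
  assumes y: "y \<in> topspace T" and f: "A.cochain (Suc n) y f"
    and h: "\<And>ys. ys \<in> plists T (Suc n) \<Longrightarrow> h ys = \<phi> (last ys) (f ys)"
    and near: "near T (Suc n) (\<lambda>ys. B.D (\<lambda>zs. h (y # zs)) ys = \<phi> (last ys) (A.D (\<lambda>zs. f (y # zs)) ys)) y"
  shows "near T (Suc n) (\<lambda>ys. B.D h (y # ys) = \<phi> (last ys) (A.D f (y # ys))) y"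
  using near
proof (rule near_mono)
  fix ys assume ys: "ys \<in> plists T (Suc n)"
    and eq: "B.D (\<lambda>zs. h (y # zs)) ys = \<phi> (last ys) (A.D (\<lambda>zs. f (y # zs)) ys)"
  have ne: "ys \<noteq> []" using ys by auto
  note last = A.last_in_topspace[OF ys ne]
  interpret Module.module complex_ring "A.S (last ys)" by (rule A.stalk_module[OF last])
  have carr: "f ys \<in> carrier (A.S (last ys))" "A.D (\<lambda>zs. f (y # zs)) ys \<in> carrier (A.S (last ys))"
    using f A.D_closed[OF y A.cochain_Cons[OF f y] ys] ys by (auto simp: A.cochain_Suc)
  show "B.D h (y # ys) = \<phi> (last ys) (A.D f (y # ys))"
    using carr ne by (simp add: h[OF ys] eq \<phi>_add[OF last] \<phi>_smult[OF last])
qed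

text \<open>The scheme is that of linearity: terms omitting a point are natural without shrinking,
  and the propagated term is natural near its point, which is the base case.\<close>

lemma D_natural:
  assumes "x \<in> topspace T" "A.cochain n x f"
    and "\<And>ys. ys \<in> plists T n \<Longrightarrow> h ys = \<phi> (last (x # ys)) (f ys)"
  shows "near T (Suc n) (\<lambda>ys. B.D h ys = \<phi> (last ys) (A.D f ys)) x"
  using assms
proof (induction n arbitrary: x f h)
  case 0
  then show ?case using \<phi>_propagate[of x "f []"] by (auto simp: A.cochain_def)
next
  case (Suc n)
  show ?case
    unfolding near.simps(2)[of T "Suc n"]
  proof (rule eventually_mono[OF eventually_nhdsin_topspace])
    fix y assume y: "y \<in> topspace T"
    have f: "A.cochain (Suc n) y f"
      using Suc.prems(2) by (auto simp: A.cochain_Suc)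
    have h: "h ys = \<phi> (last ys) (f ys)" if "ys \<in> plists T (Suc n)" for ys
      using Suc.prems(3)[OF that] that by (auto split: if_splits)
    have near: "near T (Suc n) (\<lambda>ys. B.D (\<lambda>zs. h (y # zs)) ys = \<phi> (last ys) (A.D (\<lambda>zs. f (y # zs)) ys)) y"
      by (rule Suc.IH[OF y A.cochain_Cons[OF f y]]) (use h y in auto)
    show "near T (Suc n) (\<lambda>ys. B.D h (y # ys) = \<phi> (last (y # ys)) (A.D f (y # ys))) y"
      by (rule near_mono[OF D_natural_Cons[OF y f h near]]) auto
  qed
qed

lemma glists_last: "xs \<in> glists T q \<Longrightarrow> last xs \<in> topspace T"
  by (rule A.last_in_topspace[of _ "Suc q"]) (auto simp: glists_def)

lemma gcochain_at: "f \<in> carrier (gcochains T A q) \<Longrightarrow> xs \<in> glists T q \<Longrightarrow> f xs \<in> carrier (A.S (last xs))"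
  by (auto simp: gcochains_def)

lemma induced_closed: "f \<in> carrier (gcochains T A q) \<Longrightarrow> induced q f \<in> carrier (gcochains T B q)"
  by (auto simp: gcochains_def induced_def intro!: \<phi>_closed glists_last)

lemma quasi_map_induced:
  "quasi_map (gcochains T A) (gcochain_eq T) (gdiff T A) (gcochains T B) (gcochain_eq T) (gdiff T B) induced"
proof (intro quasi_map.intro A.quasi_complex_gcochains B.quasi_complex_gcochains quasi_map_axioms.intro)
  fix q and f g
  show "linear_map complex_ring (gcochains T A q) (gcochains T B q) (induced q)"
    using induced_closed
    by (auto simp: linear_map_def) (auto simp: gcochains_def induced_def fun_eq_iff \<phi>_add \<phi>_smult glists_last PiE_iff)
  assume f: "f \<in> carrier (gcochains T A q)"
  show "gcochain_eq T (Suc q) (induced (Suc q) (gdiff T A q f)) (gdiff T B q (induced q f))"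
    unfolding gcochain_eq_iff_near
  proof
    fix x assume x: "x \<in> topspace T"
    have "near T (Suc q) (\<lambda>ys. B.D (\<lambda>zs. induced q f (x # zs)) ys = \<phi> (last ys) (A.D (\<lambda>zs. f (x # zs)) ys)) x"
      by (rule D_natural[OF x A.cochain_of_gcochain(2)[OF f x]]) (use x in \<open>simp add: induced_def glists_def\<close>)
    then have "near T (Suc q) (\<lambda>ys. B.D (induced q f) (x # ys) = \<phi> (last ys) (A.D f (x # ys))) x"
      by (intro D_natural_Cons[OF x A.cochain_of_gcochain(1)[OF f]]) (simp_all add: induced_def glists_def)
    then show "near T (Suc q)
      (\<lambda>ys. induced (Suc q) (gdiff T A q f) (x # ys) = gdiff T B q (induced q f) (x # ys)) x"
      unfolding A.gdiff_eq[OF f] B.gdiff_eq[OF induced_closed[OF f]]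
      by (rule near_mono) (use x in \<open>auto simp: induced_def glists_def simp del: alt_diff.simps\<close>)
  qed
  assume "gcochain_eq T q f g"
  then have *: "near T q (\<lambda>ys. f (x # ys) = g (x # ys)) x" if "x \<in> topspace T" for x
    using that by (simp add: gcochain_eq_iff_near)
  show "gcochain_eq T q (induced q f) (induced q g)"
    unfolding gcochain_eq_iff_near by (intro ballI near_mono[OF *]) (simp_all add: induced_def)
qed

end

locale stalk_short_exact =
  \<phi>: stalk_system_map T A B \<phi> + \<psi>: stalk_system_map T B C \<psi>
  for T :: "'a topology" and A :: "('a, complex, 'l) presheaf" and B :: "('a, complex, 'm) presheaf"
    and C :: "('a, complex, 'k) presheaf" and \<phi> \<psi> +
  assumes \<phi>_inj: "x \<in> topspace T \<Longrightarrow> \<gamma> \<in> carrier (stalk T A x) \<Longrightarrow> \<phi> x \<gamma> = \<zero>\<^bsub>stalk T B x\<^esub> \<Longrightarrow> \<gamma> = \<zero>\<^bsub>stalk T A x\<^esub>"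
    and \<psi>_surj: "x \<in> topspace T \<Longrightarrow> \<zeta> \<in> carrier (stalk T C x) \<Longrightarrow> \<exists>\<eta>\<in>carrier (stalk T B x). \<psi> x \<eta> = \<zeta>"
    and \<psi>_\<phi>: "x \<in> topspace T \<Longrightarrow> \<gamma> \<in> carrier (stalk T A x) \<Longrightarrow> \<psi> x (\<phi> x \<gamma>) = \<zero>\<^bsub>stalk T C x\<^esub>"
    and exact: "x \<in> topspace T \<Longrightarrow> \<eta> \<in> carrier (stalk T B x) \<Longrightarrow> \<psi> x \<eta> = \<zero>\<^bsub>stalk T C x\<^esub> \<Longrightarrow>
      \<exists>\<gamma>\<in>carrier (stalk T A x). \<phi> x \<gamma> = \<eta>"
begin

text \<open>A cochain may take any value in the stalk at each list, so preimages are chosen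
  independently of one another. Exactness of the cochain modules is exactness of the stalks at the
  last points.\<close>

lemma quasi_short_exact:
  "quasi_short_exact (gcochains T A) (gcochain_eq T) (gdiff T A) (gcochains T B) (gcochain_eq T) (gdiff T B)
     (gcochains T C) (gcochain_eq T) (gdiff T C) \<phi>.induced \<psi>.induced"
proof (intro quasi_short_exact.intro \<phi>.quasi_map_induced \<psi>.quasi_map_induced quasi_short_exact_axioms.intro)
  fix q :: nat
  note last = \<phi>.glists_last[of _ q]
  show "gcochain_eq T q f \<zero>\<^bsub>gcochains T A q\<^esub>"
    if f: "f \<in> carrier (gcochains T A q)" and eq: "gcochain_eq T q (\<phi>.induced q f) \<zero>\<^bsub>gcochains T B q\<^esub>" for f
    unfolding gcochain_eq_iff_near
  proof
    fix x assume x: "x \<in> topspace T"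
    have "near T q (\<lambda>ys. \<phi>.induced q f (x # ys) = \<zero>\<^bsub>gcochains T B q\<^esub> (x # ys)) x"
      using eq x by (simp add: gcochain_eq_iff_near)
    then show "near T q (\<lambda>ys. f (x # ys) = \<zero>\<^bsub>gcochains T A q\<^esub> (x # ys)) x"
    proof (rule near_mono)
      fix ys assume ys: "ys \<in> plists T q" and eq: "\<phi>.induced q f (x # ys) = \<zero>\<^bsub>gcochains T B q\<^esub> (x # ys)"
      have g: "x # ys \<in> glists T q" using ys x by (simp add: glists_def)
      have "\<phi> (last (x # ys)) (f (x # ys)) = \<zero>\<^bsub>stalk T B (last (x # ys))\<^esub>"
        using eq g by (simp add: \<phi>.induced_def gcochains_def del: last.simps)
      from \<phi>_inj[OF last[OF g] \<phi>.gcochain_at[OF f g] this]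
      show "f (x # ys) = \<zero>\<^bsub>gcochains T A q\<^esub> (x # ys)"
        using g by (simp add: gcochains_def del: last.simps)
    qed
  qed
  show "\<exists>g\<in>carrier (gcochains T B q). gcochain_eq T q (\<psi>.induced q g) f"
    if f: "f \<in> carrier (gcochains T C q)" for f
  proof -
    have "\<forall>xs\<in>glists T q. \<exists>\<gamma>. \<gamma> \<in> carrier (stalk T B (last xs)) \<and> \<psi> (last xs) \<gamma> = f xs"
      using \<psi>_surj[OF last] f by (fastforce simp: gcochains_def)
    from bchoice[OF this] obtain g where
      g: "\<forall>xs\<in>glists T q. g xs \<in> carrier (stalk T B (last xs)) \<and> \<psi> (last xs) (g xs) = f xs" ..
    show ?thesis
    proof
      show "restrict g (glists T q) \<in> carrier (gcochains T B q)" using g by (auto simp: gcochains_def)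
      show "gcochain_eq T q (\<psi>.induced q (restrict g (glists T q))) f"
        using g by (intro \<phi>.A.gcochain_eq_of_eq) (simp add: \<psi>.induced_def)
    qed
  qed
  show "gcochain_eq T q (\<psi>.induced q (\<phi>.induced q f)) \<zero>\<^bsub>gcochains T C q\<^esub>"
    if f: "f \<in> carrier (gcochains T A q)" for f
    using \<psi>_\<phi>[OF last \<phi>.gcochain_at[OF f]]
    by (intro \<phi>.A.gcochain_eq_of_eq) (simp add: \<psi>.induced_def \<phi>.induced_def gcochains_def)
  show "\<exists>h\<in>carrier (gcochains T A q). gcochain_eq T q (\<phi>.induced q h) f"
    if f: "f \<in> carrier (gcochains T B q)" and eq: "gcochain_eq T q (\<psi>.induced q f) \<zero>\<^bsub>gcochains T C q\<^esub>" for f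
  proof -
    \<comment> \<open>The vanishing of \<psi> on the value of \<open>f\<close> is known only for
      sufficiently close points. At the other lists any element of the stalk will do, so that
      \<open>h\<close> is defined everywhere.\<close>
    have "\<exists>\<gamma>. \<gamma> \<in> carrier (stalk T A (last xs)) \<and>
        (\<psi> (last xs) (f xs) = \<zero>\<^bsub>stalk T C (last xs)\<^esub> \<longrightarrow> \<phi> (last xs) \<gamma> = f xs)"
      if xs: "xs \<in> glists T q" for xs
    proof (cases "\<psi> (last xs) (f xs) = \<zero>\<^bsub>stalk T C (last xs)\<^esub>")
      case True
      from exact[OF last[OF xs] \<psi>.gcochain_at[OF f xs] True] show ?thesis by blast
    next
      case False
      interpret Module.module complex_ring "stalk T A (last xs)" by (rule \<phi>.A.glists_stalk_module[OF xs])
      show ?thesis using False M.zero_closed by blast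
    qed
    then have "\<forall>xs\<in>glists T q. \<exists>\<gamma>. \<gamma> \<in> carrier (stalk T A (last xs)) \<and>
        (\<psi> (last xs) (f xs) = \<zero>\<^bsub>stalk T C (last xs)\<^esub> \<longrightarrow> \<phi> (last xs) \<gamma> = f xs)" by blast
    from bchoice[OF this] obtain h where
      h: "\<forall>xs\<in>glists T q. h xs \<in> carrier (stalk T A (last xs)) \<and>
        (\<psi> (last xs) (f xs) = \<zero>\<^bsub>stalk T C (last xs)\<^esub> \<longrightarrow> \<phi> (last xs) (h xs) = f xs)" ..
    show ?thesis
    proof
      show "restrict h (glists T q) \<in> carrier (gcochains T A q)" using h by (auto simp: gcochains_def)
      show "gcochain_eq T q (\<phi>.induced q (restrict h (glists T q))) f"
        unfolding gcochain_eq_iff_near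
      proof
        fix x assume x: "x \<in> topspace T"
        have "near T q (\<lambda>ys. \<psi>.induced q f (x # ys) = \<zero>\<^bsub>gcochains T C q\<^esub> (x # ys)) x"
          using eq x by (simp add: gcochain_eq_iff_near)
        then show "near T q (\<lambda>ys. \<phi>.induced q (restrict h (glists T q)) (x # ys) = f (x # ys)) x"
        proof (rule near_mono)
          fix ys assume ys: "ys \<in> plists T q" and eq: "\<psi>.induced q f (x # ys) = \<zero>\<^bsub>gcochains T C q\<^esub> (x # ys)"
          have g: "x # ys \<in> glists T q" using ys x by (simp add: glists_def)
          have "\<psi> (last (x # ys)) (f (x # ys)) = \<zero>\<^bsub>stalk T C (last (x # ys))\<^esub>"
            using eq g by (simp add: \<psi>.induced_def gcochains_def del: last.simps)
          then show "\<phi>.induced q (restrict h (glists T q)) (x # ys) = f (x # ys)"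
            using h g by (simp add: \<phi>.induced_def del: last.simps)
        qed
      qed
    qed
  qed
qed

theorem long_exact_cohomology:
  "\<exists>\<delta>. long_exact_sequence (sheaf_cohomology T A) (sheaf_cohomology T B) (sheaf_cohomology T C)
    (\<lambda>q. quot_map (gcocycles T B q) (gcoboundaries T B q) (\<phi>.induced q))
    (\<lambda>q. quot_map (gcocycles T C q) (gcoboundaries T C q) (\<psi>.induced q)) \<delta>"
proof -
  interpret quasi_short_exact "gcochains T A" "gcochain_eq T" "gdiff T A" "gcochains T B" "gcochain_eq T" "gdiff T B"
     "gcochains T C" "gcochain_eq T" "gdiff T C" \<phi>.induced \<psi>.induced by (rule quasi_short_exact)
  have "f.A.cyc = gcocycles T A" "f.B.cyc = gcocycles T B" "g.B.cyc = gcocycles T C"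
    by (simp_all add: fun_eq_iff f.A.cyc_def f.B.cyc_def g.B.cyc_def gcocycles_def)
  moreover have "f.A.bnd = gcoboundaries T A" "f.B.bnd = gcoboundaries T B" "g.B.bnd = gcoboundaries T C"
    by (auto simp: fun_eq_iff f.A.bnd_def f.B.bnd_def g.B.bnd_def gcoboundaries_def split: nat.splits)
  ultimately show ?thesis using long_exact by (simp add: sheaf_cohomology_def[abs_def])
qed

end

section \<open>Stalks of presheaves\<close>

lemma const_space_simps [simp]:
  "base (const_space T) = T" "ring_of (const_space T) U = complex_ring" "ring_res (const_space T) U V c = c"
  by (simp_all add: const_space_def)

locale module_presheaf =
  fixes T :: "'a topology" and F :: "('a, complex, 'm) presheaf"
  assumes presheaf: "is_presheaf (const_space T) F"
begin

lemma sec_module: "openin T U \<Longrightarrow> complex_module (sec F U)"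
  and res_self: "openin T U \<Longrightarrow> s \<in> sections F U \<Longrightarrow> res F U U s = s"
  and res_closed: "openin T U \<Longrightarrow> openin T V \<Longrightarrow> V \<subseteq> U \<Longrightarrow> s \<in> sections F U \<Longrightarrow> res F U V s \<in> sections F V"
  and res_add: "openin T U \<Longrightarrow> openin T V \<Longrightarrow> V \<subseteq> U \<Longrightarrow> s \<in> sections F U \<Longrightarrow> t \<in> sections F U \<Longrightarrow>
    res F U V (s \<oplus>\<^bsub>sec F U\<^esub> t) = res F U V s \<oplus>\<^bsub>sec F V\<^esub> res F U V t"
  and res_smult: "openin T U \<Longrightarrow> openin T V \<Longrightarrow> V \<subseteq> U \<Longrightarrow> s \<in> sections F U \<Longrightarrow>
    res F U V (c \<odot>\<^bsub>sec F U\<^esub> s) = c \<odot>\<^bsub>sec F V\<^esub> res F U V s"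
  and res_res: "openin T U \<Longrightarrow> openin T V \<Longrightarrow> openin T W \<Longrightarrow> V \<subseteq> U \<Longrightarrow> W \<subseteq> V \<Longrightarrow> s \<in> sections F U \<Longrightarrow>
    res F V W (res F U V s) = res F U W s"
  using presheaf unfolding is_presheaf_def const_space_simps complex_ring_simps by simp_all

lemma sec_closed:
  assumes "openin T U"
  shows "\<zero>\<^bsub>sec F U\<^esub> \<in> sections F U"
    and "s \<in> sections F U \<Longrightarrow> t \<in> sections F U \<Longrightarrow> s \<oplus>\<^bsub>sec F U\<^esub> t \<in> sections F U"
    and "s \<in> sections F U \<Longrightarrow> c \<odot>\<^bsub>sec F U\<^esub> s \<in> sections F U"
proof -
  interpret Module.module complex_ring "sec F U" by (rule sec_module[OF assms])
  show "\<zero>\<^bsub>sec F U\<^esub> \<in> sections F U"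
    and "s \<in> sections F U \<Longrightarrow> t \<in> sections F U \<Longrightarrow> s \<oplus>\<^bsub>sec F U\<^esub> t \<in> sections F U"
    and "s \<in> sections F U \<Longrightarrow> c \<odot>\<^bsub>sec F U\<^esub> s \<in> sections F U"
    by simp_all
qed

lemma res_zero:
  assumes "openin T U" "openin T V" "V \<subseteq> U"
  shows "res F U V \<zero>\<^bsub>sec F U\<^esub> = \<zero>\<^bsub>sec F V\<^esub>"
  using res_smult[OF assms sec_closed(1)[OF assms(1)], of 0]
  by (simp add: complex_module_smult[OF sec_module] assms sec_closed res_closed)

definition section_at :: "'a \<Rightarrow> 'a set \<Rightarrow> 'm \<Rightarrow> bool" where
  "section_at x U s \<longleftrightarrow> openin T U \<and> x \<in> U \<and> s \<in> sections F U"

lemma in_germ_iff: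
  "(V, t) \<in> germ T F x U s \<longleftrightarrow>
    section_at x V t \<and> (\<exists>W. openin T W \<and> x \<in> W \<and> W \<subseteq> U \<inter> V \<and> res F U W s = res F V W t)"
  by (auto simp: germ_def section_at_def)

lemma germ_refl: "section_at x U s \<Longrightarrow> (U, s) \<in> germ T F x U s"
  unfolding in_germ_iff by (auto simp: section_at_def)

text \<open>The two coincidences hold on \<open>W\<close> and on \<open>W'\<close> and are compared
  on the intersection. Together with symmetry this makes germs the classes of an equivalence
  relation.\<close>

lemma germ_subset:
  assumes "section_at x U s" "(V, t) \<in> germ T F x U s"
  shows "germ T F x V t \<subseteq> germ T F x U s"
proof
  fix p assume "p \<in> germ T F x V t"
  then obtain V' t' where p: "p = (V', t')" "(V', t') \<in> germ T F x V t" by (cases p) auto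
  obtain W W' where *: "section_at x V t" "section_at x V' t'"
    "openin T W" "x \<in> W" "W \<subseteq> U \<inter> V" "res F U W s = res F V W t"
    "openin T W'" "x \<in> W'" "W' \<subseteq> V \<inter> V'" "res F V W' t = res F V' W' t'"
    using assms(2) p(2) unfolding in_germ_iff by blast
  have W: "openin T (W \<inter> W')" using * by blast
  have "res F U (W \<inter> W') s = res F W (W \<inter> W') (res F U W s)"
    using assms(1) * W unfolding section_at_def by (intro res_res[symmetric]) auto
  also have "\<dots> = res F V (W \<inter> W') t"
    unfolding *(6) using * W unfolding section_at_def by (intro res_res) auto
  also have "\<dots> = res F W' (W \<inter> W') (res F V W' t)"
    using * W unfolding section_at_def by (intro res_res[symmetric]) auto
  also have "\<dots> = res F V' (W \<inter> W') t'"
    unfolding *(10) using * W unfolding section_at_def by (intro res_res) auto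
  finally show "p \<in> germ T F x U s" using * W unfolding p(1) in_germ_iff by blast
qed

lemma in_germ_sym: "section_at x U s \<Longrightarrow> (V, t) \<in> germ T F x U s \<Longrightarrow> (U, s) \<in> germ T F x V t"
  unfolding in_germ_iff by (metis inf_commute)

lemma germ_eqI:
  assumes "section_at x U s" "(V, t) \<in> germ T F x U s"
  shows "germ T F x V t = germ T F x U s"
  using germ_subset[OF assms] germ_subset[OF _ in_germ_sym[OF assms]] assms(2)
  unfolding in_germ_iff by blast

lemma germ_eq_iff:
  assumes "section_at x U s" "section_at x V t"
  shows "germ T F x U s = germ T F x V t \<longleftrightarrow>
    (\<exists>W. openin T W \<and> x \<in> W \<and> W \<subseteq> U \<inter> V \<and> res F U W s = res F V W t)"
proof
  assume "germ T F x U s = germ T F x V t"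
  then have "(V, t) \<in> germ T F x U s" using germ_refl[OF assms(2)] by simp
  then show "\<exists>W. openin T W \<and> x \<in> W \<and> W \<subseteq> U \<inter> V \<and> res F U W s = res F V W t"
    unfolding in_germ_iff by blast
next
  assume "\<exists>W. openin T W \<and> x \<in> W \<and> W \<subseteq> U \<inter> V \<and> res F U W s = res F V W t"
  then have "(V, t) \<in> germ T F x U s" using assms(2) unfolding in_germ_iff by blast
  from germ_eqI[OF assms(1) this] show "germ T F x U s = germ T F x V t" by simp
qed

lemma section_at_res: "section_at x U s \<Longrightarrow> openin T W \<Longrightarrow> x \<in> W \<Longrightarrow> W \<subseteq> U \<Longrightarrow> section_at x W (res F U W s)"
  by (auto simp: section_at_def intro: res_closed)

lemma germ_res:
  assumes "section_at x U s" "openin T W" "x \<in> W" "W \<subseteq> U"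
  shows "germ T F x W (res F U W s) = germ T F x U s"
  using assms section_at_res[OF assms] unfolding germ_eq_iff[OF section_at_res[OF assms] assms(1)]
  by (intro exI[of _ W]) (auto simp: section_at_def res_self)

lemma section_at_add: "section_at x U s \<Longrightarrow> section_at x U t \<Longrightarrow> section_at x U (s \<oplus>\<^bsub>sec F U\<^esub> t)"
  and section_at_smult: "section_at x U s \<Longrightarrow> section_at x U (c \<odot>\<^bsub>sec F U\<^esub> s)"
  by (auto simp: section_at_def sec_closed)

lemma stalk_carrier: "\<gamma> \<in> carrier (stalk T F x) \<longleftrightarrow> (\<exists>U s. section_at x U s \<and> \<gamma> = germ T F x U s)"
  by (auto simp: stalk_def section_at_def)

lemma germ_closed: "section_at x U s \<Longrightarrow> germ T F x U s \<in> carrier (stalk T F x)"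
  unfolding stalk_carrier by blast

text \<open>\<open>stalk\<close> takes the union over all pairs of representatives. These agree with
  \<open>s\<close> on some \<open>W1\<close> and with \<open>t\<close> on some \<open>W2\<close>, so
  the sums agree on the intersection and every germ in the union is the same.\<close>

lemma stalk_add:
  assumes s: "section_at x U s" and t: "section_at x U t"
  shows "germ T F x U s \<oplus>\<^bsub>stalk T F x\<^esub> germ T F x U t = germ T F x U (s \<oplus>\<^bsub>sec F U\<^esub> t)"
proof -
  have *: "germ T F x (V1 \<inter> V2) (res F V1 (V1 \<inter> V2) s' \<oplus>\<^bsub>sec F (V1 \<inter> V2)\<^esub> res F V2 (V1 \<inter> V2) t') =
      germ T F x U (s \<oplus>\<^bsub>sec F U\<^esub> t)"
    if s': "(V1, s') \<in> germ T F x U s" and t': "(V2, t') \<in> germ T F x U t" for V1 s' V2 t'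
  proof -
    obtain W1 W2 where W: "openin T W1" "x \<in> W1" "W1 \<subseteq> U \<inter> V1" "res F U W1 s = res F V1 W1 s'"
      "openin T W2" "x \<in> W2" "W2 \<subseteq> U \<inter> V2" "res F U W2 t = res F V2 W2 t'"
      and at: "section_at x V1 s'" "section_at x V2 t'"
      using s' t' unfolding in_germ_iff by blast
    let ?W = "W1 \<inter> W2" and ?V = "V1 \<inter> V2"
    have o: "openin T ?W" "openin T ?V" "x \<in> ?W" "x \<in> ?V" "?W \<subseteq> ?V" "?W \<subseteq> U"
      using W at by (auto simp: section_at_def)
    have at': "section_at x ?V (res F V1 ?V s')" "section_at x ?V (res F V2 ?V t')"
      using at o by (auto intro: section_at_res)
    have s1: "res F V1 ?W s' = res F U ?W s"
    proof -
      have "res F V1 ?W s' = res F W1 ?W (res F V1 W1 s')"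
        using W o at by (intro res_res[symmetric]) (auto simp: section_at_def)
      also have "\<dots> = res F U ?W s"
        unfolding W(4)[symmetric] using W o s by (intro res_res) (auto simp: section_at_def)
      finally show ?thesis .
    qed
    have t1: "res F V2 ?W t' = res F U ?W t"
    proof -
      have "res F V2 ?W t' = res F W2 ?W (res F V2 W2 t')"
        using W o at by (intro res_res[symmetric]) (auto simp: section_at_def)
      also have "\<dots> = res F U ?W t"
        unfolding W(8)[symmetric] using W o t by (intro res_res) (auto simp: section_at_def)
      finally show ?thesis .
    qed
    have "res F ?V ?W (res F V1 ?V s' \<oplus>\<^bsub>sec F ?V\<^esub> res F V2 ?V t') =
        res F ?V ?W (res F V1 ?V s') \<oplus>\<^bsub>sec F ?W\<^esub> res F ?V ?W (res F V2 ?V t')"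
      using o at' by (intro res_add) (auto simp: section_at_def)
    also have "res F ?V ?W (res F V1 ?V s') = res F U ?W s"
      unfolding s1[symmetric] using o at by (intro res_res) (auto simp: section_at_def)
    also have "res F ?V ?W (res F V2 ?V t') = res F U ?W t"
      unfolding t1[symmetric] using o at by (intro res_res) (auto simp: section_at_def)
    also have "res F U ?W s \<oplus>\<^bsub>sec F ?W\<^esub> res F U ?W t = res F U ?W (s \<oplus>\<^bsub>sec F U\<^esub> t)"
      using o s t by (intro res_add[symmetric]) (auto simp: section_at_def)
    finally show ?thesis
      unfolding germ_eq_iff[OF section_at_add[OF at'] section_at_add[OF s t]] using o by blast
  qed
  have "(\<Union>(V1, s')\<in>germ T F x U s. \<Union>(V2, t')\<in>germ T F x U t.
      germ T F x (V1 \<inter> V2) (res F V1 (V1 \<inter> V2) s' \<oplus>\<^bsub>sec F (V1 \<inter> V2)\<^esub> res F V2 (V1 \<inter> V2) t')) =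
      germ T F x U (s \<oplus>\<^bsub>sec F U\<^esub> t)"
  proof (rule SUP_eq_const)
    show "germ T F x U s \<noteq> {}" using germ_refl[OF s] by blast
    fix p assume p: "p \<in> germ T F x U s"
    show "(case p of (V1, s') \<Rightarrow> \<Union>(V2, t')\<in>germ T F x U t.
      germ T F x (V1 \<inter> V2) (res F V1 (V1 \<inter> V2) s' \<oplus>\<^bsub>sec F (V1 \<inter> V2)\<^esub> res F V2 (V1 \<inter> V2) t')) =
      germ T F x U (s \<oplus>\<^bsub>sec F U\<^esub> t)"
    proof (cases p)
      case (Pair V1 s')
      have "(\<Union>(V2, t')\<in>germ T F x U t.
        germ T F x (V1 \<inter> V2) (res F V1 (V1 \<inter> V2) s' \<oplus>\<^bsub>sec F (V1 \<inter> V2)\<^esub> res F V2 (V1 \<inter> V2) t')) =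
        germ T F x U (s \<oplus>\<^bsub>sec F U\<^esub> t)"
      proof (rule SUP_eq_const)
        show "germ T F x U t \<noteq> {}" using germ_refl[OF t] by blast
      qed (use * p Pair in auto)
      then show ?thesis by (simp add: Pair)
    qed
  qed
  then show ?thesis by (simp add: stalk_def)
qed

lemma stalk_smult:
  assumes s: "section_at x U s"
  shows "c \<odot>\<^bsub>stalk T F x\<^esub> germ T F x U s = germ T F x U (c \<odot>\<^bsub>sec F U\<^esub> s)"
proof -
  have *: "germ T F x V (c \<odot>\<^bsub>sec F V\<^esub> s') = germ T F x U (c \<odot>\<^bsub>sec F U\<^esub> s)"
    if s': "(V, s') \<in> germ T F x U s" for V s'
  proof -
    obtain W where W: "openin T W" "x \<in> W" "W \<subseteq> U \<inter> V" "res F U W s = res F V W s'"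
      and at: "section_at x V s'"
      using s' unfolding in_germ_iff by blast
    have "res F V W (c \<odot>\<^bsub>sec F V\<^esub> s') = res F U W (c \<odot>\<^bsub>sec F U\<^esub> s)"
      using W at s by (simp add: res_smult section_at_def)
    then show ?thesis
      unfolding germ_eq_iff[OF section_at_smult[OF at] section_at_smult[OF s]] using W by blast
  qed
  have "(\<Union>(V, s')\<in>germ T F x U s. germ T F x V (c \<odot>\<^bsub>sec F V\<^esub> s')) = germ T F x U (c \<odot>\<^bsub>sec F U\<^esub> s)"
  proof (rule SUP_eq_const)
    show "germ T F x U s \<noteq> {}" using germ_refl[OF s] by blast
  qed (use * in auto)
  then show ?thesis by (simp add: stalk_def)
qed

text \<open>\<open>stalk\<close> represents its zero over the whole space, and zero sections
  restrict to zero sections.\<close>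

lemma stalk_zero:
  assumes "openin T U" "x \<in> U"
  shows "\<zero>\<^bsub>stalk T F x\<^esub> = germ T F x U \<zero>\<^bsub>sec F U\<^esub>"
proof -
  have U: "U \<subseteq> topspace T" using assms(1) by (rule openin_subset)
  have "section_at x (topspace T) \<zero>\<^bsub>sec F (topspace T)\<^esub>"
    using assms U by (auto simp: section_at_def sec_closed)
  from germ_res[OF this assms U] show ?thesis
    by (simp add: stalk_def res_zero[OF openin_topspace assms(1) U])
qed

lemma common_neighbourhood:
  assumes "\<gamma> \<in> carrier (stalk T F x)" "\<gamma>' \<in> carrier (stalk T F x)"
  obtains U s t where "section_at x U s" "section_at x U t" "\<gamma> = germ T F x U s" "\<gamma>' = germ T F x U t"
proof -
  obtain U s V t where *: "section_at x U s" "\<gamma> = germ T F x U s" "section_at x V t" "\<gamma>' = germ T F x V t"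
    using assms unfolding stalk_carrier by blast
  have o: "openin T (U \<inter> V)" "x \<in> U \<inter> V" using * by (auto simp: section_at_def)
  show ?thesis
    by (rule that[of "U \<inter> V" "res F U (U \<inter> V) s" "res F V (U \<inter> V) t"])
      (use * o in \<open>auto simp: section_at_res germ_res\<close>)
qed

lemma common_neighbourhood3:
  assumes "\<gamma> \<in> carrier (stalk T F x)" "\<gamma>' \<in> carrier (stalk T F x)" "\<gamma>'' \<in> carrier (stalk T F x)"
  obtains U r s t where "section_at x U r" "section_at x U s" "section_at x U t"
    "\<gamma> = germ T F x U r" "\<gamma>' = germ T F x U s" "\<gamma>'' = germ T F x U t"
proof -
  obtain U r s where *: "section_at x U r" "section_at x U s" "\<gamma> = germ T F x U r" "\<gamma>' = germ T F x U s"
    using common_neighbourhood[OF assms(1,2)] by blast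
  obtain V t where **: "section_at x V t" "\<gamma>'' = germ T F x V t"
    using assms(3) unfolding stalk_carrier by blast
  have o: "openin T (U \<inter> V)" "x \<in> U \<inter> V" using * ** by (auto simp: section_at_def)
  show ?thesis
    by (rule that[of "U \<inter> V" "res F U (U \<inter> V) r" "res F U (U \<inter> V) s" "res F V (U \<inter> V) t"])
      (use * ** o in \<open>auto simp: section_at_res germ_res\<close>)
qed

text \<open>Two or three germs have representatives over one common neighbourhood, and the laws hold
  in the module of sections there.\<close>

lemma complex_module_stalk:
  assumes x: "x \<in> topspace T"
  shows "complex_module (stalk T F x)"
proof (rule complex_moduleI)
  show "\<zero>\<^bsub>stalk T F x\<^esub> \<in> carrier (stalk T F x)"
    unfolding stalk_zero[OF openin_topspace x] using x by (auto simp: section_at_def sec_closed intro: germ_closed)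
next
  fix \<gamma> \<gamma>' assume "\<gamma> \<in> carrier (stalk T F x)" "\<gamma>' \<in> carrier (stalk T F x)"
  then obtain U s t where *: "section_at x U s" "section_at x U t" "\<gamma> = germ T F x U s" "\<gamma>' = germ T F x U t"
    by (rule common_neighbourhood)
  interpret Module.module complex_ring "sec F U" using * by (intro sec_module) (simp add: section_at_def)
  have c: "s \<in> sections F U" "t \<in> sections F U" using * by (auto simp: section_at_def)
  show "\<gamma> \<oplus>\<^bsub>stalk T F x\<^esub> \<gamma>' \<in> carrier (stalk T F x)"
    using * by (auto simp: stalk_add intro: germ_closed section_at_add)
  show "\<gamma> \<oplus>\<^bsub>stalk T F x\<^esub> \<gamma>' = \<gamma>' \<oplus>\<^bsub>stalk T F x\<^esub> \<gamma>"
    using * M.a_comm[OF c] by (simp add: stalk_add)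
  show "c \<odot>\<^bsub>stalk T F x\<^esub> (\<gamma> \<oplus>\<^bsub>stalk T F x\<^esub> \<gamma>') = c \<odot>\<^bsub>stalk T F x\<^esub> \<gamma> \<oplus>\<^bsub>stalk T F x\<^esub> c \<odot>\<^bsub>stalk T F x\<^esub> \<gamma>'" for c
    using * c by (simp add: stalk_add stalk_smult section_at_add section_at_smult smult_r_distr)
next
  fix \<gamma> \<gamma>' \<gamma>'' assume "\<gamma> \<in> carrier (stalk T F x)" "\<gamma>' \<in> carrier (stalk T F x)" "\<gamma>'' \<in> carrier (stalk T F x)"
  then obtain U r s t where *: "section_at x U r" "section_at x U s" "section_at x U t"
    "\<gamma> = germ T F x U r" "\<gamma>' = germ T F x U s" "\<gamma>'' = germ T F x U t"
    by (rule common_neighbourhood3)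
  interpret Module.module complex_ring "sec F U" using * by (intro sec_module) (simp add: section_at_def)
  have c: "r \<in> sections F U" "s \<in> sections F U" "t \<in> sections F U" using * by (auto simp: section_at_def)
  show "\<gamma> \<oplus>\<^bsub>stalk T F x\<^esub> \<gamma>' \<oplus>\<^bsub>stalk T F x\<^esub> \<gamma>'' = \<gamma> \<oplus>\<^bsub>stalk T F x\<^esub> (\<gamma>' \<oplus>\<^bsub>stalk T F x\<^esub> \<gamma>'')"
    using * M.a_assoc[OF c] by (simp add: stalk_add section_at_add)
next
  fix \<gamma> assume "\<gamma> \<in> carrier (stalk T F x)"
  then obtain U s where *: "section_at x U s" "\<gamma> = germ T F x U s" unfolding stalk_carrier by blast
  have U: "openin T U" "x \<in> U" "s \<in> sections F U" using * by (auto simp: section_at_def)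
  interpret Module.module complex_ring "sec F U" by (rule sec_module[OF U(1)])
  have z: "section_at x U \<zero>\<^bsub>sec F U\<^esub>" using U by (simp add: section_at_def)
  show "c \<odot>\<^bsub>stalk T F x\<^esub> \<gamma> \<in> carrier (stalk T F x)" for c
    using * by (auto simp: stalk_smult intro: germ_closed section_at_smult)
  show "\<zero>\<^bsub>stalk T F x\<^esub> \<oplus>\<^bsub>stalk T F x\<^esub> \<gamma> = \<gamma>" "0 \<odot>\<^bsub>stalk T F x\<^esub> \<gamma> = \<zero>\<^bsub>stalk T F x\<^esub>" "1 \<odot>\<^bsub>stalk T F x\<^esub> \<gamma> = \<gamma>"
    using * U z by (simp_all add: stalk_zero[OF U(1,2)] stalk_add stalk_smult complex_module_smult[OF module_axioms])
  show "(a + b) \<odot>\<^bsub>stalk T F x\<^esub> \<gamma> = a \<odot>\<^bsub>stalk T F x\<^esub> \<gamma> \<oplus>\<^bsub>stalk T F x\<^esub> b \<odot>\<^bsub>stalk T F x\<^esub> \<gamma>"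
    "(a * b) \<odot>\<^bsub>stalk T F x\<^esub> \<gamma> = a \<odot>\<^bsub>stalk T F x\<^esub> (b \<odot>\<^bsub>stalk T F x\<^esub> \<gamma>)" for a b
    using * U smult_l_distr[of a b s] by (simp_all add: stalk_add stalk_smult section_at_smult complex_module_smult[OF module_axioms])
qed

text \<open>The representative chosen inside \<open>propagate\<close> depends on the germ alone, so
  one pair serves for all points \<open>y\<close> at once. From here on the choice operator is no
  longer visible.\<close>

lemma propagate_representative:
  assumes "\<gamma> \<in> carrier (stalk T F x)"
  obtains U s where "section_at x U s" "\<gamma> = germ T F x U s"
    "\<And>y. propagate T F \<gamma> y = (if y \<in> U then germ T F y U s else \<zero>\<^bsub>stalk T F y\<^esub>)"
proof -
  obtain V t where t: "section_at x V t" "\<gamma> = germ T F x V t" using assms unfolding stalk_carrier by blast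
  have "(SOME p. p \<in> \<gamma>) \<in> \<gamma>" using germ_refl[OF t(1)] t(2) by (metis someI)
  moreover obtain U s where p: "(SOME p. p \<in> \<gamma>) = (U, s)" by fastforce
  ultimately have "(U, s) \<in> germ T F x V t" using t(2) by simp
  then have "section_at x U s" "\<gamma> = germ T F x U s"
    using germ_eqI[OF t(1)] t(2) by (auto simp: in_germ_iff)
  then show ?thesis using p by (intro that) (auto simp: propagate_def)
qed

text \<open>The chosen representative and the given one coincide on a neighbourhood of
  \<open>x\<close>, and therefore have the same germ at each of its points.\<close>

lemma propagate_germ:
  assumes s: "section_at x U s"
  shows "\<forall>\<^sub>F y in nhdsin T x. propagate T F (germ T F x U s) y = germ T F y U s \<and> y \<in> U"
proof -
  obtain V t where t: "section_at x V t" "germ T F x U s = germ T F x V t"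
    "\<And>y. propagate T F (germ T F x U s) y = (if y \<in> V then germ T F y V t else \<zero>\<^bsub>stalk T F y\<^esub>)"
    using propagate_representative[OF germ_closed[OF s]] by metis
  obtain W where W: "openin T W" "x \<in> W" "W \<subseteq> U \<inter> V" "res F U W s = res F V W t"
    using t(2) unfolding germ_eq_iff[OF s t(1)] by blast
  have "germ T F y V t = germ T F y U s" if "y \<in> W" for y
  proof -
    have "section_at y U s" "section_at y V t" using s t(1) that W by (auto simp: section_at_def)
    then show ?thesis unfolding germ_eq_iff[OF \<open>section_at y V t\<close> \<open>section_at y U s\<close>] using W that by auto
  qed
  then show ?thesis unfolding eventually_nhdsin using W t(3) by auto
qed

sublocale stalk_system T F
proof (rule stalk_system.intro)
  fix x assume x: "x \<in> topspace T"
  show "complex_module (stalk T F x)" by (rule complex_module_stalk[OF x])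
  fix \<gamma> assume \<gamma>: "\<gamma> \<in> carrier (stalk T F x)"
  then obtain U s where *: "section_at x U s" "\<gamma> = germ T F x U s"
    and prp: "\<And>y. propagate T F \<gamma> y = (if y \<in> U then germ T F y U s else \<zero>\<^bsub>stalk T F y\<^esub>)"
    using propagate_representative by metis
  show "propagate T F \<gamma> y \<in> carrier (stalk T F y)" if y: "y \<in> topspace T" for y
  proof -
    interpret Module.module complex_ring "stalk T F y" by (rule complex_module_stalk[OF y])
    show ?thesis using * unfolding prp by (auto simp: section_at_def intro: germ_closed)
  qed
  show "\<forall>\<^sub>F y in nhdsin T x. \<forall>\<^sub>F z in nhdsin T y. propagate T F (propagate T F \<gamma> y) z = propagate T F \<gamma> z"
  \<comment> \<open>Both sides are the germ of the same section \<open>s\<close>: for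
    \<open>y\<close> near \<open>x\<close> the propagated germ is that of \<open>s\<close> at
    \<open>y\<close>, and propagating it once more gives the germ of \<open>s\<close> near
    \<open>y\<close>.\<close>
  proof (rule eventually_mono[OF eventually_conj[OF propagate_germ[OF *(1)]
        eventually_eventually_nhdsin[OF propagate_germ[OF *(1)]]]], elim conjE)
    fix y assume y: "propagate T F (germ T F x U s) y = germ T F y U s" "y \<in> U"
      and z: "\<forall>\<^sub>F z in nhdsin T y. propagate T F (germ T F x U s) z = germ T F z U s \<and> z \<in> U"
    have "section_at y U s" using * y by (simp add: section_at_def)
    from eventually_conj[OF propagate_germ[OF this] z]
    show "\<forall>\<^sub>F z in nhdsin T y. propagate T F (propagate T F \<gamma> y) z = propagate T F \<gamma> z"
      by (rule eventually_mono) (simp add: y *(2))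
  qed
next
  fix x \<gamma> \<gamma>' c assume x: "x \<in> topspace T" and "\<gamma> \<in> carrier (stalk T F x)" "\<gamma>' \<in> carrier (stalk T F x)"
  then obtain U s t where *: "section_at x U s" "section_at x U t" "\<gamma> = germ T F x U s" "\<gamma>' = germ T F x U t"
    by (metis common_neighbourhood)
  have cst: "c \<odot>\<^bsub>stalk T F x\<^esub> \<gamma> \<oplus>\<^bsub>stalk T F x\<^esub> \<gamma>' = germ T F x U (c \<odot>\<^bsub>sec F U\<^esub> s \<oplus>\<^bsub>sec F U\<^esub> t)"
    using * by (simp add: stalk_add stalk_smult section_at_smult)
  show "\<forall>\<^sub>F y in nhdsin T x. propagate T F (c \<odot>\<^bsub>stalk T F x\<^esub> \<gamma> \<oplus>\<^bsub>stalk T F x\<^esub> \<gamma>') y =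
        c \<odot>\<^bsub>stalk T F y\<^esub> propagate T F \<gamma> y \<oplus>\<^bsub>stalk T F y\<^esub> propagate T F \<gamma>' y"
  proof (rule eventually_mono[OF eventually_conj[OF propagate_germ[OF section_at_add[OF section_at_smult[OF *(1)] *(2)]]
        eventually_conj[OF propagate_germ[OF *(1)] propagate_germ[OF *(2)]]]], elim conjE)
    fix y assume y: "propagate T F (germ T F x U (c \<odot>\<^bsub>sec F U\<^esub> s \<oplus>\<^bsub>sec F U\<^esub> t)) y =
        germ T F y U (c \<odot>\<^bsub>sec F U\<^esub> s \<oplus>\<^bsub>sec F U\<^esub> t)"
      "propagate T F (germ T F x U s) y = germ T F y U s"
      "propagate T F (germ T F x U t) y = germ T F y U t" "y \<in> U"
    have "section_at y U s" "section_at y U t" using * y by (auto simp: section_at_def)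
    then show "propagate T F (c \<odot>\<^bsub>stalk T F x\<^esub> \<gamma> \<oplus>\<^bsub>stalk T F x\<^esub> \<gamma>') y =
        c \<odot>\<^bsub>stalk T F y\<^esub> propagate T F \<gamma> y \<oplus>\<^bsub>stalk T F y\<^esub> propagate T F \<gamma>' y"
      unfolding cst y(1) by (simp add: * y stalk_add stalk_smult section_at_smult)
  qed
qed

end

section \<open>Morphisms of presheaves and their action on stalks\<close>

locale module_presheaf_hom = F: module_presheaf T F + G: module_presheaf T G
  for T :: "'a topology" and F :: "('a, complex, 'm) presheaf" and G :: "('a, complex, 'k) presheaf" +
  fixes \<phi> :: "('a, 'm, 'k) sheaf_map"
  assumes hom: "is_hom (const_space T) F G \<phi>"
begin

lemma hom_linear: "openin T U \<Longrightarrow> linear_map complex_ring (sec F U) (sec G U) (\<phi> U)"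
  and hom_res: "openin T U \<Longrightarrow> openin T V \<Longrightarrow> V \<subseteq> U \<Longrightarrow> s \<in> sections F U \<Longrightarrow>
    \<phi> V (res F U V s) = res G U V (\<phi> U s)"
  using hom openin_subset[of T] unfolding is_hom_def is_hom_on_def const_space_simps by simp_all

lemma hom_closed: "openin T U \<Longrightarrow> s \<in> sections F U \<Longrightarrow> \<phi> U s \<in> sections G U"
  and hom_add: "openin T U \<Longrightarrow> s \<in> sections F U \<Longrightarrow> t \<in> sections F U \<Longrightarrow>
    \<phi> U (s \<oplus>\<^bsub>sec F U\<^esub> t) = \<phi> U s \<oplus>\<^bsub>sec G U\<^esub> \<phi> U t"
  and hom_smult: "openin T U \<Longrightarrow> s \<in> sections F U \<Longrightarrow> \<phi> U (c \<odot>\<^bsub>sec F U\<^esub> s) = c \<odot>\<^bsub>sec G U\<^esub> \<phi> U s"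
  using hom_linear[of U] by (simp_all add: linear_map_def)

lemma hom_at: "F.section_at x U s \<Longrightarrow> G.section_at x U (\<phi> U s)"
  by (auto simp: F.section_at_def G.section_at_def hom_closed)

lemma stalk_map_germ:
  assumes s: "F.section_at x U s"
  shows "stalk_map T G \<phi> x (germ T F x U s) = germ T G x U (\<phi> U s)"
proof -
  have *: "germ T G x V (\<phi> V t) = germ T G x U (\<phi> U s)" if t: "(V, t) \<in> germ T F x U s" for V t
  proof -
    obtain W where W: "openin T W" "x \<in> W" "W \<subseteq> U \<inter> V" "res F U W s = res F V W t"
      and at: "F.section_at x V t"
      using t unfolding F.in_germ_iff by blast
    have "res G V W (\<phi> V t) = res G U W (\<phi> U s)"
      using W at s by (simp add: F.section_at_def flip: hom_res)
    then show ?thesis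
      unfolding G.germ_eq_iff[OF hom_at[OF at] hom_at[OF s]] using W by auto
  qed
  show ?thesis
    unfolding stalk_map_def
  proof (rule SUP_eq_const)
    show "germ T F x U s \<noteq> {}" using F.germ_refl[OF s] by blast
  qed (use * in auto)
qed

sublocale stalk_system_map T F G "stalk_map T G \<phi>"
proof
  fix x assume x: "x \<in> topspace T"
  show "linear_map complex_ring (stalk T F x) (stalk T G x) (stalk_map T G \<phi> x)"
    unfolding linear_map_def
  proof (intro conjI ballI)
    fix \<gamma> \<gamma>' assume "\<gamma> \<in> carrier (stalk T F x)" "\<gamma>' \<in> carrier (stalk T F x)"
    then obtain U s t where *: "F.section_at x U s" "F.section_at x U t" "\<gamma> = germ T F x U s" "\<gamma>' = germ T F x U t"
      by (rule F.common_neighbourhood)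
    show "stalk_map T G \<phi> x (\<gamma> \<oplus>\<^bsub>stalk T F x\<^esub> \<gamma>') = stalk_map T G \<phi> x \<gamma> \<oplus>\<^bsub>stalk T G x\<^esub> stalk_map T G \<phi> x \<gamma>'"
      using * hom_at[OF *(1)] hom_at[OF *(2)] F.section_at_add[OF *(1,2)]
      by (simp add: F.stalk_add G.stalk_add stalk_map_germ) (simp add: F.section_at_def hom_add)
  next
    fix \<gamma> assume "\<gamma> \<in> carrier (stalk T F x)"
    then obtain U s where *: "F.section_at x U s" "\<gamma> = germ T F x U s" unfolding F.stalk_carrier by blast
    show "stalk_map T G \<phi> x \<gamma> \<in> carrier (stalk T G x)"
      using * hom_at by (auto simp: stalk_map_germ intro: G.germ_closed)
    show "stalk_map T G \<phi> x (c \<odot>\<^bsub>stalk T F x\<^esub> \<gamma>) = c \<odot>\<^bsub>stalk T G x\<^esub> stalk_map T G \<phi> x \<gamma>" for c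
      using * hom_at[OF *(1)] F.section_at_smult[OF *(1)]
      by (simp add: F.stalk_smult G.stalk_smult stalk_map_germ) (simp add: F.section_at_def hom_smult)
  qed
  fix \<gamma> assume "\<gamma> \<in> carrier (stalk T F x)"
  then obtain U s where *: "F.section_at x U s" "\<gamma> = germ T F x U s" unfolding F.stalk_carrier by blast
  show "\<forall>\<^sub>F y in nhdsin T x. propagate T G (stalk_map T G \<phi> x \<gamma>) y = stalk_map T G \<phi> y (propagate T F \<gamma> y)"
  proof (rule eventually_mono[OF eventually_conj[OF F.propagate_germ[OF *(1)] G.propagate_germ[OF hom_at[OF *(1)]]]])
    fix y assume y: "(propagate T F (germ T F x U s) y = germ T F y U s \<and> y \<in> U) \<and>
      propagate T G (germ T G x U (\<phi> U s)) y = germ T G y U (\<phi> U s) \<and> y \<in> U"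
    then have "F.section_at y U s" using *(1) by (simp add: F.section_at_def)
    then show "propagate T G (stalk_map T G \<phi> x \<gamma>) y = stalk_map T G \<phi> y (propagate T F \<gamma> y)"
      using y * by (simp add: stalk_map_germ)
  qed
qed

lemma induced_eq: "induced q = (\<lambda>f. \<lambda>xs\<in>glists T q. stalk_map T G \<phi> (last xs) (f xs))"
  by (simp add: fun_eq_iff induced_def)

end

section \<open>Kernels, images and associated sheaves\<close>

lemma is_presheafI:
  assumes "\<And>U. openin T U \<Longrightarrow> complex_module (sec F U)"
    and "\<And>U s. openin T U \<Longrightarrow> s \<in> sections F U \<Longrightarrow> res F U U s = s"
    and "\<And>U V s. openin T U \<Longrightarrow> openin T V \<Longrightarrow> V \<subseteq> U \<Longrightarrow> s \<in> sections F U \<Longrightarrow> res F U V s \<in> sections F V"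
    and "\<And>U V s t. openin T U \<Longrightarrow> openin T V \<Longrightarrow> V \<subseteq> U \<Longrightarrow> s \<in> sections F U \<Longrightarrow> t \<in> sections F U \<Longrightarrow>
      res F U V (s \<oplus>\<^bsub>sec F U\<^esub> t) = res F U V s \<oplus>\<^bsub>sec F V\<^esub> res F U V t"
    and "\<And>U V c s. openin T U \<Longrightarrow> openin T V \<Longrightarrow> V \<subseteq> U \<Longrightarrow> s \<in> sections F U \<Longrightarrow>
      res F U V (c \<odot>\<^bsub>sec F U\<^esub> s) = c \<odot>\<^bsub>sec F V\<^esub> res F U V s"
    and "\<And>U V W s. openin T U \<Longrightarrow> openin T V \<Longrightarrow> openin T W \<Longrightarrow> V \<subseteq> U \<Longrightarrow> W \<subseteq> V \<Longrightarrow> s \<in> sections F U \<Longrightarrow>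
      res F V W (res F U V s) = res F U W s"
  shows "is_presheaf (const_space T) F"
  unfolding is_presheaf_def const_space_simps using assms by simp

lemma is_homI:
  assumes "\<And>U. openin T U \<Longrightarrow> linear_map complex_ring (sec F U) (sec G U) (\<phi> U)"
    and "\<And>U V s. openin T U \<Longrightarrow> openin T V \<Longrightarrow> V \<subseteq> U \<Longrightarrow> s \<in> sections F U \<Longrightarrow>
      \<phi> V (res F U V s) = res G U V (\<phi> U s)"
  shows "is_hom (const_space T) F G \<phi>"
  unfolding is_hom_def is_hom_on_def const_space_simps using assms by simp

text \<open>Common to kernel and image, both of which are defined by shrinking the carriers and
  keeping operations and restrictions.\<close>

lemma (in module_presheaf) subpresheaf:
  assumes "\<And>U. openin T U \<Longrightarrow> N U \<subseteq> sections F U" "\<And>U. openin T U \<Longrightarrow> \<zero>\<^bsub>sec F U\<^esub> \<in> N U"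
    and "\<And>U s t. openin T U \<Longrightarrow> s \<in> N U \<Longrightarrow> t \<in> N U \<Longrightarrow> s \<oplus>\<^bsub>sec F U\<^esub> t \<in> N U"
    and "\<And>U c s. openin T U \<Longrightarrow> s \<in> N U \<Longrightarrow> c \<odot>\<^bsub>sec F U\<^esub> s \<in> N U"
    and "\<And>U V s. openin T U \<Longrightarrow> openin T V \<Longrightarrow> V \<subseteq> U \<Longrightarrow> s \<in> N U \<Longrightarrow> res F U V s \<in> N V"
  shows "module_presheaf T (F\<lparr>sec := \<lambda>U. (sec F U)\<lparr>carrier := N U\<rparr>\<rparr>)"
proof (rule module_presheaf.intro, rule is_presheafI)
  fix U assume U: "openin T U"
  show "complex_module (sec (F\<lparr>sec := \<lambda>U. (sec F U)\<lparr>carrier := N U\<rparr>\<rparr>) U)"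
    using complex_submodule[OF sec_module[OF U] assms(1-4)[OF U]] U by simp
qed (use assms(1,5) res_self res_add res_smult res_res in \<open>simp_all add: subset_iff\<close>)

context module_presheaf_hom begin

lemma hom_zero: "openin T U \<Longrightarrow> \<phi> U \<zero>\<^bsub>sec F U\<^esub> = \<zero>\<^bsub>sec G U\<^esub>"
  by (rule linear_map_zero[OF F.sec_module G.sec_module hom_linear])

lemma ker_sections: "s \<in> sections (ker_sheaf F G \<phi>) U \<longleftrightarrow> s \<in> sections F U \<and> \<phi> U s = \<zero>\<^bsub>sec G U\<^esub>"
  by (simp add: ker_sheaf_def)

lemma im_sections: "t \<in> sections (im_sheaf T F G \<phi>) U \<longleftrightarrow> t \<in> sections G U \<and>
    (\<forall>x\<in>U. \<exists>V s. openin T V \<and> x \<in> V \<and> V \<subseteq> U \<and> s \<in> sections F V \<and> \<phi> V s = res G U V t)"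
  by (simp add: im_sheaf_def)

lemma ker_simps [simp]:
  "\<zero>\<^bsub>sec (ker_sheaf F G \<phi>) U\<^esub> = \<zero>\<^bsub>sec F U\<^esub>" "s \<oplus>\<^bsub>sec (ker_sheaf F G \<phi>) U\<^esub> t = s \<oplus>\<^bsub>sec F U\<^esub> t"
  "c \<odot>\<^bsub>sec (ker_sheaf F G \<phi>) U\<^esub> s = c \<odot>\<^bsub>sec F U\<^esub> s" "res (ker_sheaf F G \<phi>) = res F"
  by (simp_all add: ker_sheaf_def)

lemma im_simps [simp]:
  "\<zero>\<^bsub>sec (im_sheaf T F G \<phi>) U\<^esub> = \<zero>\<^bsub>sec G U\<^esub>" "u \<oplus>\<^bsub>sec (im_sheaf T F G \<phi>) U\<^esub> t = u \<oplus>\<^bsub>sec G U\<^esub> t"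
  "c \<odot>\<^bsub>sec (im_sheaf T F G \<phi>) U\<^esub> u = c \<odot>\<^bsub>sec G U\<^esub> u" "res (im_sheaf T F G \<phi>) = res G"
  by (simp_all add: im_sheaf_def)

lemma presheaf_ker: "module_presheaf T (ker_sheaf F G \<phi>)"
  unfolding ker_sheaf_def
proof (rule F.subpresheaf)
  fix U assume U: "openin T U"
  interpret G': Module.module complex_ring "sec G U" by (rule G.sec_module[OF U])
  show "\<zero>\<^bsub>sec F U\<^esub> \<in> {s \<in> sections F U. \<phi> U s = \<zero>\<^bsub>sec G U\<^esub>}"
    using U by (simp add: F.sec_closed hom_zero)
  show "s \<oplus>\<^bsub>sec F U\<^esub> t \<in> {s \<in> sections F U. \<phi> U s = \<zero>\<^bsub>sec G U\<^esub>}"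
    if "s \<in> {s \<in> sections F U. \<phi> U s = \<zero>\<^bsub>sec G U\<^esub>}" "t \<in> {s \<in> sections F U. \<phi> U s = \<zero>\<^bsub>sec G U\<^esub>}" for s t
    using U that by (simp add: F.sec_closed hom_add)
  show "c \<odot>\<^bsub>sec F U\<^esub> s \<in> {s \<in> sections F U. \<phi> U s = \<zero>\<^bsub>sec G U\<^esub>}"
    if "s \<in> {s \<in> sections F U. \<phi> U s = \<zero>\<^bsub>sec G U\<^esub>}" for c s
    using U that complex_module_smult(3)[OF G'.module_axioms] by (simp add: F.sec_closed hom_smult)
  show "res F U V s \<in> {s \<in> sections F V. \<phi> V s = \<zero>\<^bsub>sec G V\<^esub>}"
    if "openin T V" "V \<subseteq> U" "s \<in> {s \<in> sections F U. \<phi> U s = \<zero>\<^bsub>sec G U\<^esub>}" for V s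
    using U that by (simp add: F.res_closed hom_res G.res_zero)
qed auto

lemma presheaf_im: "module_presheaf T (im_sheaf T F G \<phi>)"
  unfolding im_sheaf_def
proof (rule G.subpresheaf)
  fix U assume U: "openin T U"
  let ?N = "\<lambda>U. {t \<in> sections G U. \<forall>x\<in>U. \<exists>V s. openin T V \<and> x \<in> V \<and> V \<subseteq> U \<and> s \<in> sections F V \<and> \<phi> V s = res G U V t}"
  show "\<zero>\<^bsub>sec G U\<^esub> \<in> ?N U"
    using U by (auto simp: G.sec_closed F.sec_closed hom_zero G.res_self intro!: exI[of _ U] exI[of _ "\<zero>\<^bsub>sec F U\<^esub>"])
  show "t \<oplus>\<^bsub>sec G U\<^esub> t' \<in> ?N U" if t: "t \<in> ?N U" and t': "t' \<in> ?N U" for t t'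
  proof (intro CollectI conjI ballI)
    show "t \<oplus>\<^bsub>sec G U\<^esub> t' \<in> sections G U" using U t t' by (simp add: G.sec_closed)
    fix x assume x: "x \<in> U"
    obtain V s V' s' where V: "openin T V" "x \<in> V" "V \<subseteq> U" "s \<in> sections F V" "\<phi> V s = res G U V t"
      "openin T V'" "x \<in> V'" "V' \<subseteq> U" "s' \<in> sections F V'" "\<phi> V' s' = res G U V' t'"
      using t t' x by blast
    let ?W = "V \<inter> V'"
    have W: "openin T ?W" "x \<in> ?W" "?W \<subseteq> U" "?W \<subseteq> V" "?W \<subseteq> V'" using V by auto
    have s: "res F V ?W s \<in> sections F ?W" "res F V' ?W s' \<in> sections F ?W"
      using V W by (auto intro: F.res_closed)
    have "\<phi> ?W (res F V ?W s) = res G U ?W t"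
      using V W U t by (simp add: hom_res G.res_res)
    moreover have "\<phi> ?W (res F V' ?W s') = res G U ?W t'"
      using V W U t' by (simp add: hom_res G.res_res)
    ultimately have "\<phi> ?W (res F V ?W s \<oplus>\<^bsub>sec F ?W\<^esub> res F V' ?W s') = res G U ?W (t \<oplus>\<^bsub>sec G U\<^esub> t')"
      using s W U t t' by (simp add: hom_add G.res_add)
    then show "\<exists>V s. openin T V \<and> x \<in> V \<and> V \<subseteq> U \<and> s \<in> sections F V \<and> \<phi> V s = res G U V (t \<oplus>\<^bsub>sec G U\<^esub> t')"
      using W s F.sec_closed(2)[OF W(1)] by blast
  qed
  show "c \<odot>\<^bsub>sec G U\<^esub> t \<in> ?N U" if t: "t \<in> ?N U" for c t
  proof (intro CollectI conjI ballI)
    show "c \<odot>\<^bsub>sec G U\<^esub> t \<in> sections G U" using U t by (simp add: G.sec_closed)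
    fix x assume x: "x \<in> U"
    obtain V s where V: "openin T V" "x \<in> V" "V \<subseteq> U" "s \<in> sections F V" "\<phi> V s = res G U V t"
      using t x by blast
    then have "\<phi> V (c \<odot>\<^bsub>sec F V\<^esub> s) = res G U V (c \<odot>\<^bsub>sec G U\<^esub> t)"
      using U t by (simp add: hom_smult G.res_smult)
    then show "\<exists>V s. openin T V \<and> x \<in> V \<and> V \<subseteq> U \<and> s \<in> sections F V \<and> \<phi> V s = res G U V (c \<odot>\<^bsub>sec G U\<^esub> t)"
      using V F.sec_closed(3)[OF V(1,4)] by blast
  qed
  show "res G U U' t \<in> ?N U'" if U': "openin T U'" "U' \<subseteq> U" and t: "t \<in> ?N U" for U' t
  proof (intro CollectI conjI ballI)
    show "res G U U' t \<in> sections G U'" using U U' t by (simp add: G.res_closed)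
    fix x assume x: "x \<in> U'"
    then obtain V s where V: "openin T V" "x \<in> V" "V \<subseteq> U" "s \<in> sections F V" "\<phi> V s = res G U V t"
      using t U' by blast
    let ?W = "V \<inter> U'"
    have W: "openin T ?W" "x \<in> ?W" "?W \<subseteq> V" "?W \<subseteq> U'" using V U' x by auto
    have "\<phi> ?W (res F V ?W s) = res G U' ?W (res G U U' t)"
      using V W U U' t by (simp add: hom_res G.res_res)
    then show "\<exists>V s. openin T V \<and> x \<in> V \<and> V \<subseteq> U' \<and> s \<in> sections F V \<and> \<phi> V s = res G U' V (res G U U' t)"
      using W F.res_closed[OF V(1) W(1,3) V(4)] by blast
  qed
qed auto

lemma hom_ker: "module_presheaf_hom T (ker_sheaf F G \<phi>) F (\<lambda>U s. s)"
  by (intro module_presheaf_hom.intro presheaf_ker F.module_presheaf_axioms module_presheaf_hom_axioms.intro is_homI)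
    (simp_all add: linear_map_def ker_sections)

lemma hom_im: "module_presheaf_hom T F (im_sheaf T F G \<phi>) \<phi>"
proof (intro module_presheaf_hom.intro presheaf_im F.module_presheaf_axioms module_presheaf_hom_axioms.intro is_homI)
  fix U assume U: "openin T U"
  have "\<phi> U s \<in> sections (im_sheaf T F G \<phi>) U" if s: "s \<in> sections F U" for s
    using U s by (auto simp: im_sections hom_closed G.res_self intro!: exI[of _ U])
  then show "linear_map complex_ring (sec F U) (sec (im_sheaf T F G \<phi>) U) (\<phi> U)"
    using U by (simp add: linear_map_def hom_add hom_smult)
qed (simp add: hom_res)

text \<open>Surjectivity onto the stalks of the image is the local lifting condition in its
  definition. In the middle, a germ killed by \<phi> has a representative whose image vanishes on
  some smaller \<open>W\<close>, and its restriction to \<open>W\<close> is a section of the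
  kernel.\<close>

lemma stalk_short_exact:
  "stalk_short_exact T (ker_sheaf F G \<phi>) F (im_sheaf T F G \<phi>)
     (stalk_map T F (\<lambda>U s. s)) (stalk_map T (im_sheaf T F G \<phi>) \<phi>)"
proof -
  let ?K = "ker_sheaf F G \<phi>" and ?I = "im_sheaf T F G \<phi>"
  interpret K: module_presheaf_hom T ?K F "\<lambda>U s. s" by (rule hom_ker)
  interpret I: module_presheaf_hom T F ?I \<phi> by (rule hom_im)
  have in_ker: "F.section_at x U s \<Longrightarrow> \<phi> U s = \<zero>\<^bsub>sec G U\<^esub> \<Longrightarrow> K.F.section_at x U s" for x U s
    by (simp add: F.section_at_def K.F.section_at_def ker_sections)
  show ?thesis
  proof (intro stalk_short_exact.intro K.stalk_system_map_axioms I.stalk_system_map_axioms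
      stalk_short_exact_axioms.intro)
    fix x assume x: "x \<in> topspace T"
    show "\<gamma> = \<zero>\<^bsub>stalk T ?K x\<^esub>"
      if \<gamma>: "\<gamma> \<in> carrier (stalk T ?K x)" and zero: "stalk_map T F (\<lambda>U s. s) x \<gamma> = \<zero>\<^bsub>stalk T F x\<^esub>" for \<gamma>
    proof -
      obtain U s where s: "K.F.section_at x U s" "\<gamma> = germ T ?K x U s"
        using \<gamma> unfolding K.F.stalk_carrier by blast
      have U: "openin T U" "x \<in> U" using s by (auto simp: K.F.section_at_def)
      have s': "F.section_at x U s" "F.section_at x U \<zero>\<^bsub>sec F U\<^esub>" "K.F.section_at x U \<zero>\<^bsub>sec F U\<^esub>"
        using s(1) F.sec_closed(1)[OF U(1)] hom_zero[OF U(1)]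
        by (auto simp: K.F.section_at_def F.section_at_def ker_sections)
      have "germ T F x U s = germ T F x U \<zero>\<^bsub>sec F U\<^esub>"
        using zero K.stalk_map_germ[OF s(1)] s(2) F.stalk_zero[OF U] by simp
      \<comment> \<open>Kernel and ambient presheaf have the same restriction maps, so equality of
        germs is the same condition in both.\<close>
      then have "germ T ?K x U s = germ T ?K x U \<zero>\<^bsub>sec F U\<^esub>"
        unfolding F.germ_eq_iff[OF s'(1,2)] K.F.germ_eq_iff[OF s(1) s'(3)] by simp
      then show ?thesis using K.F.stalk_zero[OF U] s(2) by simp
    qed
    show "\<exists>\<eta>\<in>carrier (stalk T F x). stalk_map T ?I \<phi> x \<eta> = \<zeta>" if \<zeta>: "\<zeta> \<in> carrier (stalk T ?I x)" for \<zeta>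
    proof -
      obtain U t where t: "I.G.section_at x U t" "\<zeta> = germ T ?I x U t"
        using \<zeta> unfolding I.G.stalk_carrier by blast
      then obtain V s where V: "openin T V" "x \<in> V" "V \<subseteq> U" "s \<in> sections F V" "\<phi> V s = res G U V t"
        unfolding I.G.section_at_def im_sections by blast
      have s: "F.section_at x V s" using V by (simp add: F.section_at_def)
      have "stalk_map T ?I \<phi> x (germ T F x V s) = \<zeta>"
        using I.stalk_map_germ[OF s] I.G.germ_res[OF t(1) V(1-3)] V(5) t(2) by simp
      then show ?thesis using F.germ_closed[OF s] by blast
    qed
    show "stalk_map T ?I \<phi> x (stalk_map T F (\<lambda>U s. s) x \<gamma>) = \<zero>\<^bsub>stalk T ?I x\<^esub>"
      if \<gamma>: "\<gamma> \<in> carrier (stalk T ?K x)" for \<gamma>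
    proof -
      obtain U s where s: "K.F.section_at x U s" "\<gamma> = germ T ?K x U s"
        using \<gamma> unfolding K.F.stalk_carrier by blast
      have U: "openin T U" "x \<in> U" using s by (auto simp: K.F.section_at_def)
      have "\<phi> U s = \<zero>\<^bsub>sec G U\<^esub>" using s by (simp add: K.F.section_at_def ker_sections)
      then show ?thesis
        using K.stalk_map_germ[OF s(1)] I.stalk_map_germ[OF K.hom_at[OF s(1)]] s(2) I.G.stalk_zero[OF U] by simp
    qed
    show "\<exists>\<gamma>\<in>carrier (stalk T ?K x). stalk_map T F (\<lambda>U s. s) x \<gamma> = \<eta>"
      if \<eta>: "\<eta> \<in> carrier (stalk T F x)" and zero: "stalk_map T ?I \<phi> x \<eta> = \<zero>\<^bsub>stalk T ?I x\<^esub>" for \<eta>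
    proof -
      obtain U s where s: "F.section_at x U s" "\<eta> = germ T F x U s"
        using \<eta> unfolding F.stalk_carrier by blast
      have U: "openin T U" "x \<in> U" "s \<in> sections F U" using s by (auto simp: F.section_at_def)
      have z: "I.G.section_at x U \<zero>\<^bsub>sec G U\<^esub>"
        using U I.G.sec_closed(1)[OF U(1)] by (simp add: I.G.section_at_def)
      have "germ T ?I x U (\<phi> U s) = germ T ?I x U \<zero>\<^bsub>sec G U\<^esub>"
        using zero I.stalk_map_germ[OF s(1)] s(2) I.G.stalk_zero[OF U(1,2)] by simp
      then obtain W where W: "openin T W" "x \<in> W" "W \<subseteq> U" "res G U W (\<phi> U s) = res G U W \<zero>\<^bsub>sec G U\<^esub>"
        unfolding I.G.germ_eq_iff[OF I.hom_at[OF s(1)] z] by auto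
      have "\<phi> W (res F U W s) = \<zero>\<^bsub>sec G W\<^esub>"
        using W U by (simp add: hom_res G.res_zero)
      with F.section_at_res[OF s(1) W(1-3)] have r: "K.F.section_at x W (res F U W s)" by (rule in_ker)
      have "stalk_map T F (\<lambda>U s. s) x (germ T ?K x W (res F U W s)) = \<eta>"
        using K.stalk_map_germ[OF r] F.germ_res[OF s(1) W(1-3)] s(2) by simp
      then show ?thesis using K.F.germ_closed[OF r] by blast
    qed
  qed
qed

theorem long_exact_cohomology:
  "\<exists>\<delta>. long_exact_sequence (sheaf_cohomology T (ker_sheaf F G \<phi>)) (sheaf_cohomology T F)
     (sheaf_cohomology T (im_sheaf T F G \<phi>))
     (sheaf_cohomology_map T F (\<lambda>U s. s)) (sheaf_cohomology_map T (im_sheaf T F G \<phi>) \<phi>) \<delta>"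
  using stalk_short_exact.long_exact_cohomology[OF stalk_short_exact]
  unfolding module_presheaf_hom.induced_eq[OF hom_ker] module_presheaf_hom.induced_eq[OF hom_im]
  by (simp add: sheaf_cohomology_map_def[abs_def])

end

section \<open>The associated sheaf\<close>

context module_presheaf begin

lemma sheafify_sections:
  "\<sigma> \<in> sections (sheafify T F) U \<longleftrightarrow> \<sigma> \<in> extensional U \<and>
    (\<forall>x\<in>U. \<exists>V s. section_at x V s \<and> V \<subseteq> U \<and> (\<forall>y\<in>V. \<sigma> y = germ T F y V s))"
  unfolding sheafify_def section_at_def by simp blast

lemma sheafify_stalk:
  assumes "\<sigma> \<in> sections (sheafify T F) U" "x \<in> U"
  shows "\<sigma> x \<in> carrier (stalk T F x)"
proof -
  obtain V s where "section_at x V s" "\<forall>y\<in>V. \<sigma> y = germ T F y V s"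
    using assms unfolding sheafify_sections by blast
  then show ?thesis using germ_closed by (auto simp: section_at_def)
qed

text \<open>Allows the local representatives of two sections to be taken over comparable
  neighbourhoods, as addition requires.\<close>

lemma sheafify_locally:
  assumes "\<sigma> \<in> sections (sheafify T F) U" "x \<in> U" "openin T W" "x \<in> W"
  obtains V s where "section_at x V s" "V \<subseteq> U" "V \<subseteq> W" "\<And>y. y \<in> V \<Longrightarrow> \<sigma> y = germ T F y V s"
proof -
  obtain V s where V: "section_at x V s" "V \<subseteq> U" "\<forall>y\<in>V. \<sigma> y = germ T F y V s"
    using assms(1,2) unfolding sheafify_sections by blast
  have o: "openin T (V \<inter> W)" "x \<in> V \<inter> W" using V(1) assms(3,4) by (auto simp: section_at_def)
  have "\<sigma> y = germ T F y (V \<inter> W) (res F V (V \<inter> W) s)" if "y \<in> V \<inter> W" for y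
    using V(1,3) that germ_res[of y V s "V \<inter> W"] o by (auto simp: section_at_def)
  then show ?thesis
    using V o by (intro that[of "V \<inter> W" "res F V (V \<inter> W) s"]) (auto intro: section_at_res)
qed

lemma sheafify_sectionI:
  assumes "\<sigma> \<in> extensional U"
    and "\<And>x. x \<in> U \<Longrightarrow> \<exists>V s. section_at x V s \<and> V \<subseteq> U \<and> (\<forall>y\<in>V. \<sigma> y = germ T F y V s)"
  shows "\<sigma> \<in> sections (sheafify T F) U"
  unfolding sheafify_sections using assms by blast

lemma sheafify_simps:
  "\<zero>\<^bsub>sec (sheafify T F) U\<^esub> = (\<lambda>x\<in>U. \<zero>\<^bsub>stalk T F x\<^esub>)"
  "\<sigma> \<oplus>\<^bsub>sec (sheafify T F) U\<^esub> \<tau> = (\<lambda>x\<in>U. \<sigma> x \<oplus>\<^bsub>stalk T F x\<^esub> \<tau> x)"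
  "c \<odot>\<^bsub>sec (sheafify T F) U\<^esub> \<sigma> = (\<lambda>x\<in>U. c \<odot>\<^bsub>stalk T F x\<^esub> \<sigma> x)"
  "res (sheafify T F) U V \<sigma> = restrict \<sigma> V"
  by (simp_all add: sheafify_def)

lemma sheafify_add_closed:
  assumes "\<sigma> \<in> sections (sheafify T F) U" "\<tau> \<in> sections (sheafify T F) U"
  shows "\<sigma> \<oplus>\<^bsub>sec (sheafify T F) U\<^esub> \<tau> \<in> sections (sheafify T F) U"
  unfolding sheafify_simps
proof (rule sheafify_sectionI)
  fix x assume x: "x \<in> U"
  obtain V s where V: "section_at x V s" "V \<subseteq> U" "\<forall>y\<in>V. \<sigma> y = germ T F y V s"
    using assms(1) x unfolding sheafify_sections by blast
  have o: "openin T V" "x \<in> V" using V by (auto simp: section_at_def)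
  obtain W t where W: "section_at x W t" "W \<subseteq> U" "W \<subseteq> V" "\<And>y. y \<in> W \<Longrightarrow> \<tau> y = germ T F y W t"
    by (rule sheafify_locally[OF assms(2) x o]) blast
  have o': "openin T W" "x \<in> W" using W by (auto simp: section_at_def)
  have s: "section_at x W (res F V W s)" by (rule section_at_res[OF V(1) o' W(3)])
  have "\<sigma> y \<oplus>\<^bsub>stalk T F y\<^esub> \<tau> y = germ T F y W (res F V W s \<oplus>\<^bsub>sec F W\<^esub> t)" if y: "y \<in> W" for y
  proof -
    have "section_at y V s" "section_at y W t" "section_at y W (res F V W s)"
      using V(1) W(1,3) s y by (auto simp: section_at_def)
    then show ?thesis
      using V(3) W(3,4) y germ_res[of y V s W] o' by (auto simp flip: stalk_add)
  qed
  then show "\<exists>V s. section_at x V s \<and> V \<subseteq> U \<and>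
      (\<forall>y\<in>V. (\<lambda>x\<in>U. \<sigma> x \<oplus>\<^bsub>stalk T F x\<^esub> \<tau> x) y = germ T F y V s)"
    using section_at_add[OF s W(1)] W(2) by (intro exI[of _ W] exI) auto
qed simp

lemma sheafify_smult_closed:
  assumes "\<sigma> \<in> sections (sheafify T F) U"
  shows "c \<odot>\<^bsub>sec (sheafify T F) U\<^esub> \<sigma> \<in> sections (sheafify T F) U"
  unfolding sheafify_simps
proof (rule sheafify_sectionI)
  fix x assume x: "x \<in> U"
  obtain V s where V: "section_at x V s" "V \<subseteq> U" "\<forall>y\<in>V. \<sigma> y = germ T F y V s"
    using assms(1) x unfolding sheafify_sections by blast
  have "c \<odot>\<^bsub>stalk T F y\<^esub> \<sigma> y = germ T F y V (c \<odot>\<^bsub>sec F V\<^esub> s)" if y: "y \<in> V" for y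
    using V y stalk_smult[of y V s c] by (simp add: section_at_def)
  then show "\<exists>V s. section_at x V s \<and> V \<subseteq> U \<and>
      (\<forall>y\<in>V. (\<lambda>x\<in>U. c \<odot>\<^bsub>stalk T F x\<^esub> \<sigma> x) y = germ T F y V s)"
    using section_at_smult[OF V(1)] V(2) by (intro exI[of _ V] exI) auto
qed simp

lemma sheafify_zero_closed:
  assumes "openin T U"
  shows "\<zero>\<^bsub>sec (sheafify T F) U\<^esub> \<in> sections (sheafify T F) U"
  unfolding sheafify_simps
  by (rule sheafify_sectionI)
    (use assms in \<open>auto simp: section_at_def sec_closed stalk_zero intro!: exI[of _ U] exI[of _ "\<zero>\<^bsub>sec F U\<^esub>"]\<close>)

lemma sheafify_restrict:
  assumes "\<sigma> \<in> sections (sheafify T F) U" "openin T V" "V \<subseteq> U"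
  shows "restrict \<sigma> V \<in> sections (sheafify T F) V"
proof (rule sheafify_sectionI)
  fix x assume x: "x \<in> V"
  obtain W s where "section_at x W s" "W \<subseteq> U" "W \<subseteq> V" "\<And>y. y \<in> W \<Longrightarrow> \<sigma> y = germ T F y W s"
    by (rule sheafify_locally[OF assms(1) _ assms(2) x]) (use assms(3) x in auto)
  then show "\<exists>W s. section_at x W s \<and> W \<subseteq> V \<and> (\<forall>y\<in>W. restrict \<sigma> V y = germ T F y W s)"
    by (intro exI[of _ W] exI[of _ s]) auto
qed simp

text \<open>Sections are extensional families of germs, hence determined by their values in the
  stalks; the module laws are inherited from there.\<close>

lemma presheaf_sheafify: "module_presheaf T (sheafify T F)"
proof (rule module_presheaf.intro, rule is_presheafI)
  fix U assume U: "openin T U"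
  have M: "complex_module (stalk T F x)" if "x \<in> U" for x
    using that openin_subset[OF U] by (intro complex_module_stalk) auto
  show "complex_module (sec (sheafify T F) U)"
  proof (rule complex_module_of_evaluation[OF M, where e = "\<lambda>x \<sigma>. \<sigma> x"])
    show "\<sigma> = \<tau>" if "\<sigma> \<in> sections (sheafify T F) U" "\<tau> \<in> sections (sheafify T F) U"
      "\<And>x. x \<in> U \<Longrightarrow> \<sigma> x = \<tau> x" for \<sigma> \<tau>
      using that by (auto simp: sheafify_sections intro: extensionalityI)
  qed (assumption | rule sheafify_stalk sheafify_zero_closed[OF U] sheafify_add_closed sheafify_smult_closed |
      simp add: sheafify_simps)+
  show "res (sheafify T F) U U \<sigma> = \<sigma>" if "\<sigma> \<in> sections (sheafify T F) U" for \<sigma>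
    using that by (simp add: sheafify_sections sheafify_simps extensional_restrict)
  fix V assume V: "openin T V" "V \<subseteq> U"
  show "res (sheafify T F) U V \<sigma> \<in> sections (sheafify T F) V" if "\<sigma> \<in> sections (sheafify T F) U" for \<sigma>
    using sheafify_restrict[OF that V] by (simp add: sheafify_simps)
qed (auto simp: sheafify_simps fun_eq_iff)

end

lemma (in module_presheaf_hom) hom_sheafify:
  "module_presheaf_hom T (sheafify T F) (sheafify T G) (sheafify_map T G \<phi>)"
proof (intro module_presheaf_hom.intro F.presheaf_sheafify G.presheaf_sheafify
    module_presheaf_hom_axioms.intro is_homI)
  fix U assume U: "openin T U"
  have x: "x \<in> topspace T" if "x \<in> U" for x using that openin_subset[OF U] by blast
  note st = F.sheafify_stalk[of _ U]
  show "linear_map complex_ring (sec (sheafify T F) U) (sec (sheafify T G) U) (sheafify_map T G \<phi> U)"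
    unfolding linear_map_def
  proof (intro conjI ballI)
    fix \<sigma> assume \<sigma>: "\<sigma> \<in> sections (sheafify T F) U"
    show "sheafify_map T G \<phi> U \<sigma> \<in> sections (sheafify T G) U"
      unfolding sheafify_map_def
    proof (rule G.sheafify_sectionI)
      fix x assume "x \<in> U"
      then obtain V s where V: "F.section_at x V s" "V \<subseteq> U" "\<forall>y\<in>V. \<sigma> y = germ T F y V s"
        using \<sigma> unfolding F.sheafify_sections by blast
      have "stalk_map T G \<phi> y (\<sigma> y) = germ T G y V (\<phi> V s)" if "y \<in> V" for y
        using V that stalk_map_germ[of y V s] by (simp add: F.section_at_def)
      then show "\<exists>V s. G.section_at x V s \<and> V \<subseteq> U \<and>
          (\<forall>y\<in>V. (\<lambda>x\<in>U. stalk_map T G \<phi> x (\<sigma> x)) y = germ T G y V s)"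
        using hom_at[OF V(1)] V(2) by (intro exI[of _ V] exI[of _ "\<phi> V s"]) auto
    qed simp
    show "sheafify_map T G \<phi> U (c \<odot>\<^bsub>sec (sheafify T F) U\<^esub> \<sigma>) =
        c \<odot>\<^bsub>sec (sheafify T G) U\<^esub> sheafify_map T G \<phi> U \<sigma>" for c
      by (auto simp: sheafify_map_def F.sheafify_simps G.sheafify_simps fun_eq_iff \<phi>_smult x st[OF \<sigma>])
    fix \<tau> assume \<tau>: "\<tau> \<in> sections (sheafify T F) U"
    show "sheafify_map T G \<phi> U (\<sigma> \<oplus>\<^bsub>sec (sheafify T F) U\<^esub> \<tau>) =
        sheafify_map T G \<phi> U \<sigma> \<oplus>\<^bsub>sec (sheafify T G) U\<^esub> sheafify_map T G \<phi> U \<tau>"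
      by (auto simp: sheafify_map_def F.sheafify_simps G.sheafify_simps fun_eq_iff \<phi>_add x st[OF \<sigma>] st[OF \<tau>])
  qed
qed (auto simp: sheafify_map_def F.sheafify_simps G.sheafify_simps fun_eq_iff)

section \<open>Cohomology sheaves and the Hom complex\<close>

locale presheaf_complex =
  fixes T :: "'a topology" and K :: "('a, complex, 'm) sheaf_complex"
  assumes ob_presheaf: "module_presheaf T (ob K k)"
    and dif_hom: "is_hom (const_space T) (ob K k) (ob K (k + 1)) (dif K k)"
    and dif_dif: "openin T U \<Longrightarrow> s \<in> sections (ob K k) U \<Longrightarrow>
      dif K (k + 1) U (dif K k U s) = \<zero>\<^bsub>sec (ob K (k + 2)) U\<^esub>"
begin

sublocale ob: module_presheaf T "ob K k" for k by (rule ob_presheaf)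

sublocale d: module_presheaf_hom T "ob K k" "ob K (k + 1)" "dif K k" for k
  by (intro module_presheaf_hom.intro ob_presheaf module_presheaf_hom_axioms.intro dif_hom)

lemma cocycle_simps [simp]:
  "s \<in> carrier (cocycle_mod K k U) \<longleftrightarrow> s \<in> sections (ob K k) U \<and> dif K k U s = \<zero>\<^bsub>sec (ob K (k + 1)) U\<^esub>"
  "\<zero>\<^bsub>cocycle_mod K k U\<^esub> = \<zero>\<^bsub>sec (ob K k) U\<^esub>" "s \<oplus>\<^bsub>cocycle_mod K k U\<^esub> t = s \<oplus>\<^bsub>sec (ob K k) U\<^esub> t"
  "c \<odot>\<^bsub>cocycle_mod K k U\<^esub> s = c \<odot>\<^bsub>sec (ob K k) U\<^esub> s"
  by (simp_all add: cocycle_mod_def)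

lemma complex_module_cocycle_mod:
  assumes U: "openin T U"
  shows "complex_module (cocycle_mod K k U)"
proof -
  interpret K': Module.module complex_ring "sec (ob K (k + 1)) U" by (rule ob.sec_module[OF U])
  show ?thesis
    unfolding cocycle_mod_def
    by (rule complex_submodule[OF ob.sec_module[OF U]])
      (use U complex_module_smult(3)[OF K'.module_axioms] in
        \<open>auto simp: ob.sec_closed d.hom_zero d.hom_add d.hom_smult\<close>)
qed

lemma coboundary_iff:
  "s \<in> coboundaries K k U \<longleftrightarrow> (\<exists>t\<in>sections (ob K (k - 1)) U. s = dif K (k - 1) U t)"
  by (auto simp: coboundaries_def)

lemma quotient_cohomology:
  assumes U: "openin T U"
  shows "quotient_module (cocycle_mod K k U) (coboundaries K k U)"
proof -
  interpret Module.module complex_ring "cocycle_mod K k U" by (rule complex_module_cocycle_mod[OF U])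
  \<comment> \<open>The differential out of degree \<open>k - 1\<close> is restated with target
    degree \<open>k\<close>, where the coboundaries live, instead of
    \<open>k - 1 + 1\<close>.\<close>
  have lin: "linear_map complex_ring (sec (ob K (k - 1)) U) (sec (ob K k) U) (dif K (k - 1) U)"
    using d.hom_linear[OF U, of "k - 1"] by simp
  show ?thesis
  proof
    show "coboundaries K k U \<subseteq> carrier (cocycle_mod K k U)"
      using lin dif_dif[OF U, of _ "k - 1"] by (auto simp: coboundaries_def linear_map_def add.commute)
    show "\<zero>\<^bsub>cocycle_mod K k U\<^esub> \<in> coboundaries K k U"
      using d.hom_zero[OF U, of "k - 1"] ob.sec_closed(1)[OF U, of "k - 1"]
      unfolding coboundary_iff by (metis cocycle_simps(2) diff_add_cancel)
    show "s \<oplus>\<^bsub>cocycle_mod K k U\<^esub> t \<in> coboundaries K k U"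
      if st: "s \<in> coboundaries K k U" "t \<in> coboundaries K k U" for s t
    proof -
      obtain s' t' where *: "s' \<in> sections (ob K (k - 1)) U" "t' \<in> sections (ob K (k - 1)) U"
        "s = dif K (k - 1) U s'" "t = dif K (k - 1) U t'"
        using st unfolding coboundary_iff by blast
      then show ?thesis
        using lin ob.sec_closed(2)[OF U *(1,2)] unfolding coboundary_iff linear_map_def
        by (intro bexI[of _ "s' \<oplus>\<^bsub>sec (ob K (k - 1)) U\<^esub> t'"]) auto
    qed
    show "c \<odot>\<^bsub>cocycle_mod K k U\<^esub> s \<in> coboundaries K k U" if s: "s \<in> coboundaries K k U" for c s
    proof -
      obtain s' where *: "s' \<in> sections (ob K (k - 1)) U" "s = dif K (k - 1) U s'"
        using s unfolding coboundary_iff by blast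
      then show ?thesis
        using lin ob.sec_closed(3)[OF U *(1)] unfolding coboundary_iff linear_map_def
        by (intro bexI[of _ "c \<odot>\<^bsub>sec (ob K (k - 1)) U\<^esub> s'"]) auto
    qed
  qed
qed

lemma quotient_map_res:
  assumes U: "openin T U" and V: "openin T V" "V \<subseteq> U"
  shows "quotient_module_map (cocycle_mod K k U) (coboundaries K k U) (cocycle_mod K k V) (coboundaries K k V)
    (res (ob K k) U V)"
proof (intro quotient_module_map.intro quotient_cohomology U V(1) quotient_module_map_axioms.intro)
  show "linear_map complex_ring (cocycle_mod K k U) (cocycle_mod K k V) (res (ob K k) U V)"
    using U V by (auto simp: linear_map_def ob.res_closed ob.res_add ob.res_smult d.hom_res ob.res_zero)
  fix s assume "s \<in> coboundaries K k U"
  then obtain t where t: "t \<in> sections (ob K (k - 1)) U" "s = dif K (k - 1) U t"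
    unfolding coboundary_iff by blast
  have "res (ob K k) U V s = dif K (k - 1) V (res (ob K (k - 1)) U V t)"
    using d.hom_res[OF U V, of t "k - 1"] t by simp
  then show "res (ob K k) U V s \<in> coboundaries K k V"
    using ob.res_closed[OF U V t(1)] unfolding coboundary_iff by blast
qed

lemma coh_presheaf_simps:
  "sec (coh_presheaf K k) U = quot_mod (cocycle_mod K k U) (coboundaries K k U)"
  "res (coh_presheaf K k) U V = quot_map (cocycle_mod K k V) (coboundaries K k V) (res (ob K k) U V)"
  by (simp_all add: coh_presheaf_def)

lemma presheaf_coh: "module_presheaf T (coh_presheaf K k)"
proof (rule module_presheaf.intro, rule is_presheafI)
  fix U assume U: "openin T U"
  interpret QU: quotient_module "cocycle_mod K k U" "coboundaries K k U" by (rule quotient_cohomology[OF U])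
  show "complex_module (sec (coh_presheaf K k) U)"
    unfolding coh_presheaf_simps by (rule QU.complex_module_quot)
  show "res (coh_presheaf K k) U U A = A" if A: "A \<in> sections (coh_presheaf K k) U" for A
  proof -
    obtain s where s: "s \<in> carrier (cocycle_mod K k U)" "A = QU.cls s"
      using A unfolding coh_presheaf_simps QU.carrier_quot by blast
    show ?thesis
      using quotient_module_map.quot_map_cls[OF quotient_map_res[OF U U subset_refl] s(1)] s U
      unfolding coh_presheaf_simps by (simp add: ob.res_self)
  qed
  fix V assume V: "openin T V" "V \<subseteq> U"
  note qm = quotient_map_res[OF U V, of k]
  note lin = quotient_module_map.linear_map_quot[OF qm, unfolded linear_map_def complex_ring_simps]
  show "res (coh_presheaf K k) U V A \<in> sections (coh_presheaf K k) V" if "A \<in> sections (coh_presheaf K k) U" for A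
    using lin that unfolding coh_presheaf_simps by blast
  show "res (coh_presheaf K k) U V (c \<odot>\<^bsub>sec (coh_presheaf K k) U\<^esub> A) =
      c \<odot>\<^bsub>sec (coh_presheaf K k) V\<^esub> res (coh_presheaf K k) U V A" if "A \<in> sections (coh_presheaf K k) U" for A c
    using lin that unfolding coh_presheaf_simps by blast
  show "res (coh_presheaf K k) U V (A \<oplus>\<^bsub>sec (coh_presheaf K k) U\<^esub> B) =
      res (coh_presheaf K k) U V A \<oplus>\<^bsub>sec (coh_presheaf K k) V\<^esub> res (coh_presheaf K k) U V B"
    if "A \<in> sections (coh_presheaf K k) U" "B \<in> sections (coh_presheaf K k) U" for A B
    using lin that unfolding coh_presheaf_simps by blast
  fix W assume W: "openin T W" "W \<subseteq> V"
  show "res (coh_presheaf K k) V W (res (coh_presheaf K k) U V A) = res (coh_presheaf K k) U W A"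
    if A: "A \<in> sections (coh_presheaf K k) U" for A
  proof -
    obtain s where s: "s \<in> carrier (cocycle_mod K k U)" "A = QU.cls s"
      using A unfolding coh_presheaf_simps QU.carrier_quot by blast
    have UW: "W \<subseteq> U" using V W by blast
    show ?thesis
      unfolding coh_presheaf_simps s(2) quotient_module_map.quot_map_cls[OF qm s(1)]
        quotient_module_map.quot_map_cls[OF quotient_map_res[OF V(1) W] quotient_module_map.f_closed[OF qm s(1)]]
        quotient_module_map.quot_map_cls[OF quotient_map_res[OF U W(1) UW] s(1)]
      using s(1) U V W by (simp add: ob.res_res)
  qed
qed

end

locale presheaf_chain_map = K: presheaf_complex T K + L: presheaf_complex T L
  for T :: "'a topology" and K :: "('a, complex, 'm) sheaf_complex" and L :: "('a, complex, 'k) sheaf_complex" +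
  fixes f :: "('a, 'm, 'k) chain_map"
  assumes chain_map: "is_chain_map (const_space T) K L f"
begin

sublocale f: module_presheaf_hom T "ob K k" "ob L k" "f k" for k
  using chain_map
  by (intro module_presheaf_hom.intro K.ob_presheaf L.ob_presheaf module_presheaf_hom_axioms.intro)
    (simp add: is_chain_map_def)

lemma f_dif: "openin T U \<Longrightarrow> s \<in> sections (ob K k) U \<Longrightarrow> f (k + 1) U (dif K k U s) = dif L k U (f k U s)"
  using chain_map by (simp add: is_chain_map_def)

lemma quotient_map_chain_map:
  assumes U: "openin T U"
  shows "quotient_module_map (cocycle_mod K k U) (coboundaries K k U) (cocycle_mod L k U) (coboundaries L k U) (f k U)"
proof (intro quotient_module_map.intro K.quotient_cohomology L.quotient_cohomology U quotient_module_map_axioms.intro)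
  show "linear_map complex_ring (cocycle_mod K k U) (cocycle_mod L k U) (f k U)"
    using U by (auto simp: linear_map_def f.hom_closed f.hom_add f.hom_smult f.hom_zero simp flip: f_dif)
  fix s assume "s \<in> coboundaries K k U"
  then obtain t where t: "t \<in> sections (ob K (k - 1)) U" "s = dif K (k - 1) U t"
    unfolding K.coboundary_iff by blast
  have "f k U s = dif L (k - 1) U (f (k - 1) U t)"
    using f_dif[OF U t(1)] t by simp
  then show "f k U s \<in> coboundaries L k U"
    using f.hom_closed[OF U t(1)] unfolding L.coboundary_iff by blast
qed

lemma hom_coh_presheaf:
  "module_presheaf_hom T (coh_presheaf K k) (coh_presheaf L k)
    (\<lambda>U. quot_map (cocycle_mod L k U) (coboundaries L k U) (f k U))"
proof (intro module_presheaf_hom.intro K.presheaf_coh L.presheaf_coh module_presheaf_hom_axioms.intro is_homI)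
  fix U assume U: "openin T U"
  note qm = quotient_map_chain_map[OF U, of k]
  interpret QU: quotient_module "cocycle_mod K k U" "coboundaries K k U" by (rule K.quotient_cohomology[OF U])
  show "linear_map complex_ring (sec (coh_presheaf K k) U) (sec (coh_presheaf L k) U)
      (quot_map (cocycle_mod L k U) (coboundaries L k U) (f k U))"
    unfolding K.coh_presheaf_simps L.coh_presheaf_simps by (rule quotient_module_map.linear_map_quot[OF qm])
  fix V A assume V: "openin T V" "V \<subseteq> U" and "A \<in> sections (coh_presheaf K k) U"
  then obtain s where s: "s \<in> carrier (cocycle_mod K k U)" "A = QU.cls s"
    unfolding K.coh_presheaf_simps QU.carrier_quot by blast
  note rK = K.quotient_map_res[OF U V, of k] and rL = L.quotient_map_res[OF U V, of k]
  show "quot_map (cocycle_mod L k V) (coboundaries L k V) (f k V) (res (coh_presheaf K k) U V A) =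
      res (coh_presheaf L k) U V (quot_map (cocycle_mod L k U) (coboundaries L k U) (f k U) A)"
    unfolding K.coh_presheaf_simps L.coh_presheaf_simps s(2)
      quotient_module_map.quot_map_cls[OF rK s(1)] quotient_module_map.quot_map_cls[OF qm s(1)]
      quotient_module_map.quot_map_cls[OF quotient_map_chain_map[OF V(1)] quotient_module_map.f_closed[OF rK s(1)]]
      quotient_module_map.quot_map_cls[OF rL quotient_module_map.f_closed[OF qm s(1)]]
    using s(1) U V by (simp add: f.hom_res)
qed

lemma hom_coh_sheaf:
  "module_presheaf_hom T (coh_sheaf T K k) (coh_sheaf T L k) (coh_sheaf_map T L f k)"
  unfolding coh_sheaf_def coh_sheaf_map_def by (rule module_presheaf_hom.hom_sheafify[OF hom_coh_presheaf])

end

text \<open>The constant functions make every presheaf of modules on such a space a presheaf of complex vector spaces.\<close>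

locale function_space =
  fixes X :: "('a, 'a \<Rightarrow> complex) ringed_space"
  assumes const_closed: "openin (base X) V \<Longrightarrow> (\<lambda>x\<in>V. c) \<in> carrier (ring_of X V)"
    and const_zero: "openin (base X) V \<Longrightarrow> \<zero>\<^bsub>ring_of X V\<^esub> = (\<lambda>x\<in>V. 0)"
    and const_one: "openin (base X) V \<Longrightarrow> \<one>\<^bsub>ring_of X V\<^esub> = (\<lambda>x\<in>V. 1)"
    and const_add: "openin (base X) V \<Longrightarrow> (\<lambda>x\<in>V. a) \<oplus>\<^bsub>ring_of X V\<^esub> (\<lambda>x\<in>V. b) = (\<lambda>x\<in>V. a + b)"
    and const_mult: "openin (base X) V \<Longrightarrow> (\<lambda>x\<in>V. a) \<otimes>\<^bsub>ring_of X V\<^esub> (\<lambda>x\<in>V. b) = (\<lambda>x\<in>V. a * b)"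
    and const_res: "openin (base X) V \<Longrightarrow> openin (base X) W \<Longrightarrow> W \<subseteq> V \<Longrightarrow> ring_res X V W (\<lambda>x\<in>V. c) = (\<lambda>x\<in>W. c)"
begin

abbreviation "T \<equiv> base X"

lemma forget_simps [simp]:
  "carrier (sec (forget G) V) = sections G V" "\<zero>\<^bsub>sec (forget G) V\<^esub> = \<zero>\<^bsub>sec G V\<^esub>"
  "s \<oplus>\<^bsub>sec (forget G) V\<^esub> t = s \<oplus>\<^bsub>sec G V\<^esub> t" "res (forget G) = res G"
  by (simp_all add: forget_def)

lemma forget_smult: "c \<odot>\<^bsub>sec (forget G) V\<^esub> s = (\<lambda>x\<in>V. c) \<odot>\<^bsub>sec G V\<^esub> s"
  by (simp add: forget_def)

text \<open>The additive inverse depends only on carrier, zero and addition, all of which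
  \<open>forget\<close> keeps.\<close>

lemma forget_minus: "\<ominus>\<^bsub>sec (forget G) V\<^esub> s = \<ominus>\<^bsub>sec G V\<^esub> s"
  by (simp add: a_inv_def m_inv_def forget_def)

lemma presheaf_module: "is_presheaf X G \<Longrightarrow> openin T U \<Longrightarrow> Module.module (ring_of X U) (sec G U)"
  by (simp add: is_presheaf_def)

lemma presheaf_forget:
  assumes G: "is_presheaf X G"
  shows "module_presheaf T (forget G)"
proof (rule module_presheaf.intro, rule is_presheafI)
  fix U assume U: "openin T U"
  interpret Module.module "ring_of X U" "sec G U" by (rule presheaf_module[OF G U])
  note c = const_closed[OF U]
  show "complex_module (sec (forget G) U)"
    by (rule complex_moduleI)
      (use c smult_l_distr[OF c c] smult_assoc1[OF c c] smult_one smult_l_null in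
        \<open>simp_all add: forget_smult M.a_ac const_add[OF U] const_mult[OF U] const_one[OF U]
          const_zero[OF U] smult_r_distr\<close>)
qed (use G const_closed in \<open>simp_all add: is_presheaf_def forget_smult const_res\<close>)

lemma is_hom_onI:
  assumes "\<And>V s. openin T V \<Longrightarrow> V \<subseteq> U \<Longrightarrow> s \<in> sections F V \<Longrightarrow> \<phi> V s \<in> sections G V"
    and "\<And>V s t. openin T V \<Longrightarrow> V \<subseteq> U \<Longrightarrow> s \<in> sections F V \<Longrightarrow> t \<in> sections F V \<Longrightarrow>
      \<phi> V (s \<oplus>\<^bsub>sec F V\<^esub> t) = \<phi> V s \<oplus>\<^bsub>sec G V\<^esub> \<phi> V t"
    and "\<And>V a s. openin T V \<Longrightarrow> V \<subseteq> U \<Longrightarrow> a \<in> carrier (ring_of X V) \<Longrightarrow> s \<in> sections F V \<Longrightarrow>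
      \<phi> V (a \<odot>\<^bsub>sec F V\<^esub> s) = a \<odot>\<^bsub>sec G V\<^esub> \<phi> V s"
    and "\<And>V W s. openin T V \<Longrightarrow> V \<subseteq> U \<Longrightarrow> openin T W \<Longrightarrow> W \<subseteq> V \<Longrightarrow> s \<in> sections F V \<Longrightarrow>
      \<phi> W (res F V W s) = res G V W (\<phi> V s)"
  shows "is_hom_on X U F G \<phi>"
  unfolding is_hom_on_def linear_map_def using assms by simp

lemma is_hom_onD:
  assumes "is_hom_on X U F G \<phi>" "openin T V" "V \<subseteq> U"
  shows "s \<in> sections F V \<Longrightarrow> \<phi> V s \<in> sections G V"
    and "s \<in> sections F V \<Longrightarrow> t \<in> sections F V \<Longrightarrow> \<phi> V (s \<oplus>\<^bsub>sec F V\<^esub> t) = \<phi> V s \<oplus>\<^bsub>sec G V\<^esub> \<phi> V t"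
    and "a \<in> carrier (ring_of X V) \<Longrightarrow> s \<in> sections F V \<Longrightarrow> \<phi> V (a \<odot>\<^bsub>sec F V\<^esub> s) = a \<odot>\<^bsub>sec G V\<^esub> \<phi> V s"
    and "openin T W \<Longrightarrow> W \<subseteq> V \<Longrightarrow> s \<in> sections F V \<Longrightarrow> \<phi> W (res F V W s) = res G V W (\<phi> V s)"
  using assms unfolding is_hom_on_def linear_map_def by simp_all

lemma is_hom_on_smult:
  assumes "is_hom_on X U F G \<phi>" "openin T V" "V \<subseteq> U" "s \<in> sections F V"
  shows "\<phi> V (c \<odot>\<^bsub>sec (forget F) V\<^esub> s) = c \<odot>\<^bsub>sec (forget G) V\<^esub> \<phi> V s"
  using is_hom_onD(3)[OF assms(1-3) const_closed[OF assms(2)] assms(4)] by (simp add: forget_smult)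

lemma is_hom_on_zero_section:
  assumes "is_presheaf X F" "is_presheaf X G" "is_hom_on X U F G \<phi>" "openin T V" "V \<subseteq> U"
  shows "\<phi> V \<zero>\<^bsub>sec F V\<^esub> = \<zero>\<^bsub>sec G V\<^esub>"
  using assms(3-5) linear_map_zero[OF presheaf_module[OF assms(1,4)] presheaf_module[OF assms(2,4)]]
  unfolding is_hom_on_def by blast

lemma is_hom_on_of_is_hom: "is_hom X F G \<phi> \<Longrightarrow> is_hom_on X U F G \<phi>"
  unfolding is_hom_def is_hom_on_def using openin_subset by blast

lemma is_hom_on_mono: "is_hom_on X U F G \<phi> \<Longrightarrow> V \<subseteq> U \<Longrightarrow> is_hom_on X V F G \<phi>"
  unfolding is_hom_on_def by (meson subset_trans)

lemma is_hom_on_comp: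
  "is_hom_on X U F G \<phi> \<Longrightarrow> is_hom_on X U G H \<psi> \<Longrightarrow> is_hom_on X U F H (\<lambda>V s. \<psi> V (\<phi> V s))"
  by (rule is_hom_onI) (simp_all add: is_hom_onD)

lemma is_hom_on_add:
  assumes G: "is_presheaf X G" and \<phi>: "is_hom_on X U F G \<phi>" and \<psi>: "is_hom_on X U F G \<psi>"
  shows "is_hom_on X U F G (\<lambda>V s. \<phi> V s \<oplus>\<^bsub>sec G V\<^esub> \<psi> V s)"
proof (rule is_hom_onI)
  fix V s assume V: "openin T V" "V \<subseteq> U" and s: "s \<in> sections F V"
  interpret Module.module "ring_of X V" "sec G V" by (rule presheaf_module[OF G V(1)])
  note c = is_hom_onD(1)[OF \<phi> V] is_hom_onD(1)[OF \<psi> V]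
  show "\<phi> V s \<oplus>\<^bsub>sec G V\<^esub> \<psi> V s \<in> sections G V" using c s by simp
  show "\<phi> V (s \<oplus>\<^bsub>sec F V\<^esub> t) \<oplus>\<^bsub>sec G V\<^esub> \<psi> V (s \<oplus>\<^bsub>sec F V\<^esub> t) =
      \<phi> V s \<oplus>\<^bsub>sec G V\<^esub> \<psi> V s \<oplus>\<^bsub>sec G V\<^esub> (\<phi> V t \<oplus>\<^bsub>sec G V\<^esub> \<psi> V t)" if "t \<in> sections F V" for t
    using c s that by (simp add: is_hom_onD(2)[OF \<phi> V] is_hom_onD(2)[OF \<psi> V] M.a_ac)
  show "\<phi> V (a \<odot>\<^bsub>sec F V\<^esub> s) \<oplus>\<^bsub>sec G V\<^esub> \<psi> V (a \<odot>\<^bsub>sec F V\<^esub> s) =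
      a \<odot>\<^bsub>sec G V\<^esub> (\<phi> V s \<oplus>\<^bsub>sec G V\<^esub> \<psi> V s)" if "a \<in> carrier (ring_of X V)" for a
    using c s that by (simp add: is_hom_onD(3)[OF \<phi> V] is_hom_onD(3)[OF \<psi> V] smult_r_distr)
  show "\<phi> W (res F V W s) \<oplus>\<^bsub>sec G W\<^esub> \<psi> W (res F V W s) = res G V W (\<phi> V s \<oplus>\<^bsub>sec G V\<^esub> \<psi> V s)"
    if "openin T W" "W \<subseteq> V" for W
    using that G V c s is_hom_onD(4)[OF \<phi> V] is_hom_onD(4)[OF \<psi> V] by (simp add: is_presheaf_def)
qed

text \<open>Linearity over the structure sheaf survives because the rings are commutative, and
  compatibility with restriction because constants restrict to constants.\<close>

lemma is_hom_on_const_smult: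
  assumes G: "is_presheaf X G" and \<phi>: "is_hom_on X U F G \<phi>"
  shows "is_hom_on X U F G (\<lambda>V s. c \<odot>\<^bsub>sec (forget G) V\<^esub> \<phi> V s)"
proof (rule is_hom_onI)
  fix V s assume V: "openin T V" "V \<subseteq> U" and s: "s \<in> sections F V"
  interpret Module.module "ring_of X V" "sec G V" by (rule presheaf_module[OF G V(1)])
  note c = is_hom_onD(1)[OF \<phi> V] and k = const_closed[OF V(1)]
  show "c \<odot>\<^bsub>sec (forget G) V\<^esub> \<phi> V s \<in> sections G V" using c s k by (simp add: forget_smult)
  show "c \<odot>\<^bsub>sec (forget G) V\<^esub> \<phi> V (s \<oplus>\<^bsub>sec F V\<^esub> t) =
      c \<odot>\<^bsub>sec (forget G) V\<^esub> \<phi> V s \<oplus>\<^bsub>sec G V\<^esub> c \<odot>\<^bsub>sec (forget G) V\<^esub> \<phi> V t" if "t \<in> sections F V" for t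
    using c s k that by (simp add: is_hom_onD(2)[OF \<phi> V] forget_smult smult_r_distr)
  show "c \<odot>\<^bsub>sec (forget G) V\<^esub> \<phi> V (a \<odot>\<^bsub>sec F V\<^esub> s) =
      a \<odot>\<^bsub>sec G V\<^esub> (c \<odot>\<^bsub>sec (forget G) V\<^esub> \<phi> V s)" if "a \<in> carrier (ring_of X V)" for a
    using c s k that
    by (simp add: is_hom_onD(3)[OF \<phi> V] forget_smult R.m_comm flip: smult_assoc1)
  show "c \<odot>\<^bsub>sec (forget G) W\<^esub> \<phi> W (res F V W s) = res G V W (c \<odot>\<^bsub>sec (forget G) V\<^esub> \<phi> V s)"
    if "openin T W" "W \<subseteq> V" for W
    using that G V c s k is_hom_onD(4)[OF \<phi> V] const_res[OF V(1)] by (simp add: is_presheaf_def forget_smult)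
qed

lemma is_hom_on_zero:
  assumes G: "is_presheaf X G"
  shows "is_hom_on X U F G (\<lambda>V s. \<zero>\<^bsub>sec G V\<^esub>)"
proof (rule is_hom_onI)
  fix V assume V: "openin T V"
  interpret Module.module "ring_of X V" "sec G V" by (rule presheaf_module[OF G V])
  show "\<zero>\<^bsub>sec G V\<^esub> \<in> sections G V" "\<zero>\<^bsub>sec G V\<^esub> = \<zero>\<^bsub>sec G V\<^esub> \<oplus>\<^bsub>sec G V\<^esub> \<zero>\<^bsub>sec G V\<^esub>"
    "\<And>a. a \<in> carrier (ring_of X V) \<Longrightarrow> \<zero>\<^bsub>sec G V\<^esub> = a \<odot>\<^bsub>sec G V\<^esub> \<zero>\<^bsub>sec G V\<^esub>" by simp_all
  show "\<zero>\<^bsub>sec G W\<^esub> = res G V W \<zero>\<^bsub>sec G V\<^esub>" if "openin T W" "W \<subseteq> V" for W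
    using module_presheaf.res_zero[OF presheaf_forget[OF G] V that] by simp
qed

lemma restr_hom_apply [simp]:
  "openin T V \<Longrightarrow> V \<subseteq> U \<Longrightarrow> s \<in> sections F V \<Longrightarrow> restr_hom T F U \<phi> V s = \<phi> V s"
  by (simp add: restr_hom_def)

lemma restr_hom_cong:
  "(\<And>V s. openin T V \<Longrightarrow> V \<subseteq> U \<Longrightarrow> s \<in> sections F V \<Longrightarrow> \<phi> V s = \<psi> V s) \<Longrightarrow>
    restr_hom T F U \<phi> = restr_hom T F U \<psi>"
  by (auto simp: restr_hom_def fun_eq_iff)

lemma is_hom_on_cong:
  assumes F: "is_presheaf X F"
    and eq: "\<And>V s. openin T V \<Longrightarrow> V \<subseteq> U \<Longrightarrow> s \<in> sections F V \<Longrightarrow> \<phi> V s = \<psi> V s"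
    and \<psi>: "is_hom_on X U F G \<psi>"
  shows "is_hom_on X U F G \<phi>"
proof (rule is_hom_onI)
  fix V s assume V: "openin T V" "V \<subseteq> U" and s: "s \<in> sections F V"
  interpret Module.module "ring_of X V" "sec F V" by (rule presheaf_module[OF F V(1)])
  show "\<phi> V s \<in> sections G V" using eq V s is_hom_onD(1)[OF \<psi> V s] by simp
  show "\<phi> V (s \<oplus>\<^bsub>sec F V\<^esub> t) = \<phi> V s \<oplus>\<^bsub>sec G V\<^esub> \<phi> V t" if "t \<in> sections F V" for t
    using eq V s that is_hom_onD(2)[OF \<psi> V s that] by simp
  show "\<phi> V (a \<odot>\<^bsub>sec F V\<^esub> s) = a \<odot>\<^bsub>sec G V\<^esub> \<phi> V s" if "a \<in> carrier (ring_of X V)" for a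
    using eq V s that is_hom_onD(3)[OF \<psi> V that s] by simp
  show "\<phi> W (res F V W s) = res G V W (\<phi> V s)" if "openin T W" "W \<subseteq> V" for W
    using eq V s that is_hom_onD(4)[OF \<psi> V that s] F by (auto simp: is_presheaf_def)
qed

lemma sheaf_hom_sections:
  "\<phi> \<in> sections (sheaf_hom X F G) U \<longleftrightarrow> is_hom_on X U F G \<phi> \<and> restr_hom T F U \<phi> = \<phi>"
  by (simp add: sheaf_hom_def hom_mod_def)

lemma sheaf_hom_simps:
  "\<zero>\<^bsub>sec (sheaf_hom X F G) U\<^esub> = restr_hom T F U (\<lambda>V s. \<zero>\<^bsub>sec G V\<^esub>)"
  "\<phi> \<oplus>\<^bsub>sec (sheaf_hom X F G) U\<^esub> \<psi> = restr_hom T F U (\<lambda>V s. \<phi> V s \<oplus>\<^bsub>sec G V\<^esub> \<psi> V s)"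
  "c \<odot>\<^bsub>sec (sheaf_hom X F G) U\<^esub> \<phi> = restr_hom T F U (\<lambda>V s. c \<odot>\<^bsub>sec (forget G) V\<^esub> \<phi> V s)"
  "res (sheaf_hom X F G) U V \<phi> = restr_hom T F V \<phi>"
  by (simp_all add: sheaf_hom_def hom_mod_def forget_smult)

lemma restr_hom_section:
  assumes "is_presheaf X F" "is_hom_on X U F G \<phi>"
  shows "restr_hom T F U \<phi> \<in> sections (sheaf_hom X F G) U"
  unfolding sheaf_hom_sections
  by (rule conjI[OF is_hom_on_cong[OF assms(1) _ assms(2)]]) (auto simp: restr_hom_def fun_eq_iff)

text \<open>Sections of the Hom sheaf are normalised by \<open>restr_hom\<close> to be
  \<open>undefined\<close> off their domain, so agreement on actual sections is equality of
  functions.\<close>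

lemma section_eqI:
  assumes "\<phi> \<in> sections (sheaf_hom X F G) U" "\<psi> \<in> sections (sheaf_hom X F G) U"
    and "\<And>V s. openin T V \<Longrightarrow> V \<subseteq> U \<Longrightarrow> s \<in> sections F V \<Longrightarrow> \<phi> V s = \<psi> V s"
  shows "\<phi> = \<psi>"
proof -
  have "restr_hom T F U \<phi> = restr_hom T F U \<psi>" by (rule restr_hom_cong[OF assms(3)])
  then show ?thesis using assms(1,2) by (simp add: sheaf_hom_sections)
qed

text \<open>A morphism is determined by its values on sections. Evaluation at a pair of an open set
  and a section over it lands in a complex vector space of sections of \<open>G\<close>, and the
  module laws are tested there.\<close>

lemma presheaf_sheaf_hom:
  assumes F: "is_presheaf X F" and G: "is_presheaf X G"
  shows "module_presheaf T (sheaf_hom X F G)"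
proof (rule module_presheaf.intro, rule is_presheafI)
  interpret G: module_presheaf T "forget G" by (rule presheaf_forget[OF G])
  note rs = restr_hom_section[OF F]
  fix U assume U: "openin T U"
  have hom: "is_hom_on X U F G \<phi>" if "\<phi> \<in> sections (sheaf_hom X F G) U" for \<phi>
    using that by (simp add: sheaf_hom_sections)
  show "complex_module (sec (sheaf_hom X F G) U)"
  proof (rule complex_module_of_evaluation[of "{(V, s). openin T V \<and> V \<subseteq> U \<and> s \<in> sections F V}"
        "\<lambda>(V, s). sec (forget G) V" _ "\<lambda>(V, s) \<phi>. \<phi> V s"])
    show "\<zero>\<^bsub>sec (sheaf_hom X F G) U\<^esub> \<in> sections (sheaf_hom X F G) U"
      unfolding sheaf_hom_simps by (intro rs is_hom_on_zero G)
    fix \<phi> assume \<phi>: "\<phi> \<in> sections (sheaf_hom X F G) U"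
    show "c \<odot>\<^bsub>sec (sheaf_hom X F G) U\<^esub> \<phi> \<in> sections (sheaf_hom X F G) U" for c
      unfolding sheaf_hom_simps by (intro rs is_hom_on_const_smult G hom \<phi>)
    fix \<psi> assume \<psi>: "\<psi> \<in> sections (sheaf_hom X F G) U"
    show "\<phi> \<oplus>\<^bsub>sec (sheaf_hom X F G) U\<^esub> \<psi> \<in> sections (sheaf_hom X F G) U"
      unfolding sheaf_hom_simps by (intro rs is_hom_on_add G hom \<phi> \<psi>)
    show "\<phi> = \<psi>" if "\<And>i. i \<in> {(V, s). openin T V \<and> V \<subseteq> U \<and> s \<in> sections F V} \<Longrightarrow>
        (case i of (V, s) \<Rightarrow> \<lambda>\<phi>. \<phi> V s) \<phi> = (case i of (V, s) \<Rightarrow> \<lambda>\<phi>. \<phi> V s) \<psi>"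
      by (rule section_eqI[OF \<phi> \<psi>]) (use that in auto)
  qed (auto simp: sheaf_hom_simps G.sec_module is_hom_onD(1)[OF hom])
  show "res (sheaf_hom X F G) U U \<phi> = \<phi>" if "\<phi> \<in> sections (sheaf_hom X F G) U" for \<phi>
    using that by (simp add: sheaf_hom_sections sheaf_hom_simps)
  fix V assume V: "openin T V" "V \<subseteq> U"
  show "res (sheaf_hom X F G) U V \<phi> \<in> sections (sheaf_hom X F G) V"
    if "\<phi> \<in> sections (sheaf_hom X F G) U" for \<phi>
    unfolding sheaf_hom_simps by (intro rs is_hom_on_mono[OF hom[OF that] V(2)])
qed (auto simp: sheaf_hom_simps restr_hom_def fun_eq_iff)

end

text \<open>The record is spelled out in the form used by \<open>hom_complex\<close>, whose terms
  are such products over the degree \<open>p\<close>.\<close>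

lemma product_presheaf:
  fixes H :: "'i \<Rightarrow> ('a, complex, 'm) presheaf"
  assumes H: "\<And>p. module_presheaf T (H p)"
  shows "module_presheaf T
    \<lparr>sec = (\<lambda>U. \<lparr>carrier = {\<Phi>. \<forall>p. \<Phi> p \<in> sections (H p) U}, mult = undefined, one = undefined,
       zero = (\<lambda>p. \<zero>\<^bsub>sec (H p) U\<^esub>), add = (\<lambda>\<Phi> \<Psi> p. \<Phi> p \<oplus>\<^bsub>sec (H p) U\<^esub> \<Psi> p),
       smult = (\<lambda>c \<Phi> p. c \<odot>\<^bsub>sec (H p) U\<^esub> \<Phi> p)\<rparr>),
     res = (\<lambda>U V \<Phi> p. res (H p) U V (\<Phi> p))\<rparr>" (is "module_presheaf T ?P")
proof (rule module_presheaf.intro, rule is_presheafI)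
  interpret H: module_presheaf T "H p" for p by (rule H)
  fix U assume U: "openin T U"
  show "complex_module (sec ?P U)"
    by (rule complex_module_of_evaluation[OF H.sec_module[OF U], of UNIV _ "\<lambda>p \<Phi>. \<Phi> p"])
      (auto simp: H.sec_closed[OF U])
qed (use module_presheaf.res_self[OF H] module_presheaf.res_closed[OF H] module_presheaf.res_add[OF H]
    module_presheaf.res_smult[OF H] module_presheaf.res_res[OF H] in simp_all)

section \<open>The Hom complex as a complex of presheaves of vector spaces\<close>

context function_space begin

lemma is_complexD:
  assumes "is_complex X K"
  shows "is_presheaf X (ob K k)" "is_hom_on X U (ob K k) (ob K (k + 1)) (dif K k)"
    and "openin T U \<Longrightarrow> s \<in> sections (ob K k) U \<Longrightarrow> dif K (k + 1) U (dif K k U s) = \<zero>\<^bsub>sec (ob K (k + 2)) U\<^esub>"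
proof -
  show "is_presheaf X (ob K k)" using assms by (simp add: is_complex_def is_sheaf_def)
  show "is_hom_on X U (ob K k) (ob K (k + 1)) (dif K k)"
    by (rule is_hom_on_of_is_hom) (use assms in \<open>simp add: is_complex_def\<close>)
  show "openin T U \<Longrightarrow> s \<in> sections (ob K k) U \<Longrightarrow> dif K (k + 1) U (dif K k U s) = \<zero>\<^bsub>sec (ob K (k + 2)) U\<^esub>"
    using assms by (simp add: is_complex_def)
qed

lemma is_chain_mapD:
  assumes "is_chain_map X K L f"
  shows "is_hom_on X U (ob K k) (ob L k) (f k)"
    and "openin T U \<Longrightarrow> s \<in> sections (ob K k) U \<Longrightarrow> f (k + 1) U (dif K k U s) = dif L k U (f k U s)"
proof -
  show "is_hom_on X U (ob K k) (ob L k) (f k)"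
    by (rule is_hom_on_of_is_hom) (use assms in \<open>simp add: is_chain_map_def\<close>)
  show "openin T U \<Longrightarrow> s \<in> sections (ob K k) U \<Longrightarrow> f (k + 1) U (dif K k U s) = dif L k U (f k U s)"
    using assms by (simp add: is_chain_map_def)
qed

end

text \<open>Degrees occur inside objects, operations and differentials. These rules fix normal forms
  for them, so that the two sides of an identity refer syntactically to the same modules.\<close>

lemma hom_degree: "p + (n + 1) = p + n + 1" "p + 1 + n = p + n + 1" "p + (n + 2) = p + n + 2"
    "p + 1 + 1 = p + 2" for p n :: int
  by simp_all

text \<open>The sign of the second summand in \<open>d \<Phi> = d \<circ> \<Phi> - (-1)^n \<Phi> \<circ> d\<close>.\<close>

definition hom_sign :: "int \<Rightarrow> complex" where
  "hom_sign n = (if even n then -1 else 1)"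

locale internal_hom = function_space X for X :: "('a, 'a \<Rightarrow> complex) ringed_space" +
  fixes F :: "('a, 'a \<Rightarrow> complex, 'm) sheaf_complex" and G :: "('a, 'a \<Rightarrow> complex, 'k) sheaf_complex"
  assumes F: "is_complex X F" and G: "is_complex X G"
begin

abbreviation "HC \<equiv> hom_complex X F G"

lemma ob_HC: "ob HC n =
    \<lparr>sec = (\<lambda>U. \<lparr>carrier = {\<Phi>. \<forall>p. \<Phi> p \<in> sections (sheaf_hom X (ob F p) (ob G (p + n))) U},
       mult = undefined, one = undefined,
       zero = (\<lambda>p. \<zero>\<^bsub>sec (sheaf_hom X (ob F p) (ob G (p + n))) U\<^esub>),
       add = (\<lambda>\<Phi> \<Psi> p. \<Phi> p \<oplus>\<^bsub>sec (sheaf_hom X (ob F p) (ob G (p + n))) U\<^esub> \<Psi> p),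
       smult = (\<lambda>c \<Phi> p. c \<odot>\<^bsub>sec (sheaf_hom X (ob F p) (ob G (p + n))) U\<^esub> \<Phi> p)\<rparr>),
     res = (\<lambda>U V \<Phi> p. res (sheaf_hom X (ob F p) (ob G (p + n))) U V (\<Phi> p))\<rparr>"
  by (simp add: hom_complex_def Let_def)

lemma presheaf_HC: "module_presheaf T (ob HC n)"
  unfolding ob_HC by (intro product_presheaf presheaf_sheaf_hom is_complexD(1)[OF F] is_complexD(1)[OF G])

sublocale HC: module_presheaf T "ob HC n" for n by (rule presheaf_HC)

sublocale G': module_presheaf T "forget (ob G n)" for n
  by (rule presheaf_forget[OF is_complexD(1)[OF G]])

lemma HC_sections: "\<Phi> \<in> sections (ob HC n) U \<longleftrightarrow>
    (\<forall>p. is_hom_on X U (ob F p) (ob G (p + n)) (\<Phi> p) \<and> restr_hom T (ob F p) U (\<Phi> p) = \<Phi> p)"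
  by (simp add: ob_HC sheaf_hom_sections)

lemma HC_hom: "\<Phi> \<in> sections (ob HC n) U \<Longrightarrow> is_hom_on X U (ob F p) (ob G (p + n)) (\<Phi> p)"
  by (simp add: HC_sections)

lemma HC_hom': "\<Phi> \<in> sections (ob HC n) U \<Longrightarrow> is_hom_on X U (ob F (p + 1)) (ob G (p + n + 1)) (\<Phi> (p + 1))"
  using HC_hom[of \<Phi> n U "p + 1"] by (simp only: hom_degree)

lemma HC_eqI:
  assumes "\<Phi> \<in> sections (ob HC n) U" "\<Psi> \<in> sections (ob HC n) U"
    and "\<And>p V s. openin T V \<Longrightarrow> V \<subseteq> U \<Longrightarrow> s \<in> sections (ob F p) V \<Longrightarrow> \<Phi> p V s = \<Psi> p V s"
  shows "\<Phi> = \<Psi>"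
proof
  fix p
  show "\<Phi> p = \<Psi> p"
    using assms by (intro section_eqI[of _ "ob F p" "ob G (p + n)" U]) (auto simp: ob_HC)
qed

text \<open>Translates the operations of the Hom complex into operations on values in
  \<open>G\<close>. Together with \<open>HC_eqI\<close> it reduces identities between cochains of
  morphisms to identities between sections of \<open>G\<close>.\<close>

lemma HC_apply:
  assumes "openin T V" "V \<subseteq> U" "s \<in> sections (ob F p) V"
  shows "\<zero>\<^bsub>sec (ob HC n) U\<^esub> p V s = \<zero>\<^bsub>sec (ob G (p + n)) V\<^esub>"
    "(\<Phi> \<oplus>\<^bsub>sec (ob HC n) U\<^esub> \<Psi>) p V s = \<Phi> p V s \<oplus>\<^bsub>sec (ob G (p + n)) V\<^esub> \<Psi> p V s"
    "(c \<odot>\<^bsub>sec (ob HC n) U\<^esub> \<Phi>) p V s = c \<odot>\<^bsub>sec (forget (ob G (p + n))) V\<^esub> \<Phi> p V s"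
    "res (ob HC n) W U \<Phi> p V s = \<Phi> p V s"
  using assms by (simp_all add: ob_HC sheaf_hom_simps)

text \<open>The differential before normalisation by \<open>restr_hom\<close>, with subtraction and
  \<open>signed\<close> merged into a single complex scalar. In this form it is a sum of a composite
  and a scalar multiple of a composite, for which the closure properties of morphisms are
  available.\<close>

definition dif_hom_at :: "int \<Rightarrow> ('a, 'm, 'k) chain_map \<Rightarrow> ('a, 'm, 'k) chain_map" where
  "dif_hom_at n \<Phi> p V s = dif G (p + n) V (\<Phi> p V s) \<oplus>\<^bsub>sec (ob G (p + n + 1)) V\<^esub>
    hom_sign n \<odot>\<^bsub>sec (forget (ob G (p + n + 1))) V\<^esub> \<Phi> (p + 1) V (dif F p V s)"

lemma dif_F: "openin T V \<Longrightarrow> s \<in> sections (ob F p) V \<Longrightarrow> dif F p V s \<in> sections (ob F (p + 1)) V"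
  using is_hom_onD(1)[OF is_complexD(2)[OF F]] by blast

lemma dif_G: "openin T V \<Longrightarrow> s \<in> sections (ob G p) V \<Longrightarrow> dif G p V s \<in> sections (ob G (p + 1)) V"
  using is_hom_onD(1)[OF is_complexD(2)[OF G]] by blast

lemma is_hom_on_dif_hom_at:
  assumes "\<Phi> \<in> sections (ob HC n) U"
  shows "is_hom_on X U (ob F p) (ob G (p + n + 1)) (dif_hom_at n \<Phi> p)"
  unfolding dif_hom_at_def[abs_def]
  by (intro is_hom_on_add is_hom_on_const_smult is_complexD(1)[OF G]
      is_hom_on_comp[OF HC_hom[OF assms] is_complexD(2)[OF G]]
      is_hom_on_comp[OF is_complexD(2)[OF F] HC_hom'[OF assms]])

lemma dif_HC:
  assumes \<Phi>: "\<Phi> \<in> sections (ob HC n) U"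
  shows "dif HC n U \<Phi> p = restr_hom T (ob F p) U (dif_hom_at n \<Phi> p)"
proof -
  have "dif HC n U \<Phi> p = restr_hom T (ob F p) U (\<lambda>V s.
        dif G (p + n) V (\<Phi> p V s) \<ominus>\<^bsub>sec (ob G (p + n + 1)) V\<^esub>
        signed (sec (ob G (p + n + 1)) V) n (\<Phi> (p + 1) V (dif F p V s)))"
    by (simp add: hom_complex_def)
  also have "\<dots> = restr_hom T (ob F p) U (dif_hom_at n \<Phi> p)"
  proof (rule restr_hom_cong)
    fix V s assume V: "openin T V" "V \<subseteq> U" and s: "s \<in> sections (ob F p) V"
    let ?t = "\<Phi> (p + 1) V (dif F p V s)"
    have t: "?t \<in> sections (ob G (p + n + 1)) V"
      by (rule is_hom_onD(1)[OF HC_hom'[OF \<Phi>] V dif_F[OF V(1) s]])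
    interpret Module.module complex_ring "sec (forget (ob G (p + n + 1))) V" by (rule G'.sec_module[OF V(1)])
    have minus: "\<ominus>\<^bsub>sec (ob G (p + n + 1)) V\<^esub> t = (-1) \<odot>\<^bsub>sec (forget (ob G (p + n + 1))) V\<^esub> t"
      if "t \<in> sections (ob G (p + n + 1)) V" for t
      using complex_module_minus[OF module_axioms, of t] that by (simp add: forget_minus)
    have smult: "c \<odot>\<^bsub>sec (forget (ob G (p + n + 1))) V\<^esub> ?t \<in> sections (ob G (p + n + 1)) V" for c
      using G'.sec_closed(3)[OF V(1), of ?t "p + n + 1" c] t by simp
    show "dif G (p + n) V (\<Phi> p V s) \<ominus>\<^bsub>sec (ob G (p + n + 1)) V\<^esub> signed (sec (ob G (p + n + 1)) V) n ?t =
      dif_hom_at n \<Phi> p V s"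
      using t smult complex_module_smult[OF module_axioms, of ?t]
      by (simp add: dif_hom_at_def a_minus_def signed_def hom_sign_def minus)
  qed
  finally show ?thesis .
qed

lemma dif_HC_apply:
  assumes "\<Phi> \<in> sections (ob HC n) U" "openin T V" "V \<subseteq> U" "s \<in> sections (ob F p) V"
  shows "dif HC n U \<Phi> p V s = dif_hom_at n \<Phi> p V s"
  using assms by (simp add: dif_HC)

lemma dif_HC_closed:
  assumes "\<Phi> \<in> sections (ob HC n) U"
  shows "dif HC n U \<Phi> \<in> sections (ob HC (n + 1)) U"
  using restr_hom_section[OF is_complexD(1)[OF F] is_hom_on_dif_hom_at[OF assms]]
  by (simp add: ob_HC dif_HC[OF assms] hom_degree)

text \<open>Expanding the square of the differential gives four terms. Two of them contain a squared
  differential of \<open>F\<close> or of \<open>G\<close> and vanish. The mixed term, with one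
  differential on each side of \<Phi>, occurs twice, with coefficients \<open>hom_sign n\<close> and
  \<open>hom_sign (n + 1)\<close>, whose sum is zero.\<close>

lemma presheaf_complex_HC: "presheaf_complex T HC"
proof (rule presheaf_complex.intro)
  show "module_presheaf T (ob HC n)" for n by (rule presheaf_HC)
  show "is_hom (const_space T) (ob HC n) (ob HC (n + 1)) (dif HC n)" for n
  proof (rule is_homI)
    fix U assume U: "openin T U"
    show "linear_map complex_ring (sec (ob HC n) U) (sec (ob HC (n + 1)) U) (dif HC n U)"
    proof (rule linear_mapI[OF HC.sec_module[OF U] HC.sec_module[OF U] dif_HC_closed])
      fix c \<Phi> \<Psi> assume \<Phi>: "\<Phi> \<in> sections (ob HC n) U" and \<Psi>: "\<Psi> \<in> sections (ob HC n) U"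
      let ?c\<Phi> = "c \<odot>\<^bsub>sec (ob HC n) U\<^esub> \<Phi>"
      note comb = HC.sec_closed(2)[OF U HC.sec_closed(3)[OF U \<Phi>] \<Psi>, of c]
      show "dif HC n U (?c\<Phi> \<oplus>\<^bsub>sec (ob HC n) U\<^esub> \<Psi>) =
        c \<odot>\<^bsub>sec (ob HC (n + 1)) U\<^esub> dif HC n U \<Phi> \<oplus>\<^bsub>sec (ob HC (n + 1)) U\<^esub> dif HC n U \<Psi>"
      proof (rule HC_eqI[OF dif_HC_closed[OF comb]
            HC.sec_closed(2)[OF U HC.sec_closed(3)[OF U dif_HC_closed[OF \<Phi>]] dif_HC_closed[OF \<Psi>]]])
        fix p V s assume V: "openin T V" "V \<subseteq> U" and s: "s \<in> sections (ob F p) V"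
        let ?G = "sec (forget (ob G (p + n + 1))) V"
        interpret G'': Module.module complex_ring ?G by (rule G'.sec_module[OF V(1)])
        note ds = dif_F[OF V(1) s]
        note c = is_hom_onD(1)[OF HC_hom[OF \<Phi>] V s] is_hom_onD(1)[OF HC_hom[OF \<Psi>] V s]
          and c' = is_hom_onD(1)[OF HC_hom'[OF \<Phi>] V ds] is_hom_onD(1)[OF HC_hom'[OF \<Psi>] V ds]
        note dc = dif_G[OF V(1) c(1)] dif_G[OF V(1) c(2)]
          and cc = G'.sec_closed(3)[OF V(1), of _ "p + n" c, simplified, OF c(1)]
        have "dif_hom_at n (?c\<Phi> \<oplus>\<^bsub>sec (ob HC n) U\<^esub> \<Psi>) p V s =
            c \<odot>\<^bsub>?G\<^esub> dif_hom_at n \<Phi> p V s \<oplus>\<^bsub>sec (ob G (p + n + 1)) V\<^esub> dif_hom_at n \<Psi> p V s"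
          unfolding dif_hom_at_def HC_apply[OF V s] HC_apply[OF V ds] hom_degree
            is_hom_onD(2)[OF is_complexD(2)[OF G] V cc c(2)] is_hom_on_smult[OF is_complexD(2)[OF G] V c(1)]
          using complex_module_rearrange[OF G''.module_axioms, of _ _ _ _ c "hom_sign n", simplified, OF dc(1) c'(1) dc(2) c'(2)] .
        then show "dif HC n U (?c\<Phi> \<oplus>\<^bsub>sec (ob HC n) U\<^esub> \<Psi>) p V s =
            (c \<odot>\<^bsub>sec (ob HC (n + 1)) U\<^esub> dif HC n U \<Phi> \<oplus>\<^bsub>sec (ob HC (n + 1)) U\<^esub> dif HC n U \<Psi>) p V s"
          unfolding HC_apply[OF V s] dif_HC_apply[OF comb V s] dif_HC_apply[OF \<Phi> V s] dif_HC_apply[OF \<Psi> V s]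
          by (simp only: hom_degree)
      qed
    qed
    fix V \<Phi> assume V: "openin T V" "V \<subseteq> U" and \<Phi>: "\<Phi> \<in> sections (ob HC n) U"
    note r = HC.res_closed[OF U V \<Phi>]
    show "dif HC n V (res (ob HC n) U V \<Phi>) = res (ob HC (n + 1)) U V (dif HC n U \<Phi>)"
    proof (rule HC_eqI[OF dif_HC_closed[OF r] HC.res_closed[OF U V dif_HC_closed[OF \<Phi>]]])
      fix p W s assume W: "openin T W" "W \<subseteq> V" and s: "s \<in> sections (ob F p) W"
      note ds = dif_F[OF W(1) s]
      have WU: "W \<subseteq> U" using W V by blast
      show "dif HC n V (res (ob HC n) U V \<Phi>) p W s = res (ob HC (n + 1)) U V (dif HC n U \<Phi>) p W s"
        unfolding HC_apply[OF W s] dif_HC_apply[OF r W s] dif_HC_apply[OF \<Phi> W(1) WU s]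
        by (simp only: dif_hom_at_def HC_apply[OF W s] HC_apply[OF W ds])
    qed
  qed
  fix U \<Phi> n assume U: "openin T U" and \<Phi>: "\<Phi> \<in> sections (ob HC n) U"
  note d\<Phi> = dif_HC_closed[OF \<Phi>]
  have dd\<Phi>: "dif HC (n + 1) U (dif HC n U \<Phi>) \<in> sections (ob HC (n + 2)) U"
    using dif_HC_closed[OF d\<Phi>] by (simp only: hom_degree(4))
  show "dif HC (n + 1) U (dif HC n U \<Phi>) = \<zero>\<^bsub>sec (ob HC (n + 2)) U\<^esub>"
  proof (rule HC_eqI[OF dd\<Phi> HC.sec_closed(1)[OF U]])
    fix p V s assume V: "openin T V" "V \<subseteq> U" and s: "s \<in> sections (ob F p) V"
    let ?m = "p + n"
    interpret G'': Module.module complex_ring "sec (forget (ob G (?m + 2))) V" by (rule G'.sec_module[OF V(1)])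
    note ds = dif_F[OF V(1) s]
    let ?a = "\<Phi> p V s" and ?b = "\<Phi> (p + 1) V (dif F p V s)"
    have a: "?a \<in> sections (ob G ?m) V" by (rule is_hom_onD(1)[OF HC_hom[OF \<Phi>] V s])
    have b: "?b \<in> sections (ob G (?m + 1)) V" by (rule is_hom_onD(1)[OF HC_hom'[OF \<Phi>] V ds])
    note da = dif_G[OF V(1) a]
    have sb: "hom_sign n \<odot>\<^bsub>sec (forget (ob G (?m + 1))) V\<^esub> ?b \<in> sections (ob G (?m + 1)) V"
      using G'.sec_closed(3)[OF V(1), of ?b "?m + 1"] b by simp
    have db: "dif G (?m + 1) V ?b \<in> sections (ob G (?m + 2)) V"
      using dif_G[OF V(1) b] by (simp only: hom_degree(4))
    have G2: "is_hom_on X U (ob G (?m + 1)) (ob G (?m + 2)) (dif G (?m + 1))"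
      using is_complexD(2)[OF G, of U "?m + 1"] by (simp only: hom_degree(4))
    have zero: "\<Phi> (p + 2) V (dif F (p + 1) V (dif F p V s)) = \<zero>\<^bsub>sec (ob G (?m + 2)) V\<^esub>"
      using is_hom_on_zero_section[OF is_complexD(1)[OF F] is_complexD(1)[OF G] HC_hom[OF \<Phi>, of "p + 2"] V]
        is_complexD(3)[OF F V(1) s] by (simp add: add_ac)
    have dp1: "dif HC n U \<Phi> (p + 1) V (dif F p V s) = dif G (?m + 1) V ?b \<oplus>\<^bsub>sec (ob G (?m + 2)) V\<^esub>
        hom_sign n \<odot>\<^bsub>sec (forget (ob G (?m + 2))) V\<^esub> \<Phi> (p + 2) V (dif F (p + 1) V (dif F p V s))"
      unfolding dif_HC_apply[OF \<Phi> V ds] dif_hom_at_def by (simp only: hom_degree(2)[of p n] hom_degree(4))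
    have "dif HC (n + 1) U (dif HC n U \<Phi>) p V s =
        dif G (?m + 1) V (dif HC n U \<Phi> p V s) \<oplus>\<^bsub>sec (ob G (?m + 2)) V\<^esub>
        hom_sign (n + 1) \<odot>\<^bsub>sec (forget (ob G (?m + 2))) V\<^esub> dif HC n U \<Phi> (p + 1) V (dif F p V s)"
      unfolding dif_HC_apply[OF d\<Phi> V s] dif_hom_at_def[of "n + 1"] by (simp only: hom_degree(1,4))
    also have "dif G (?m + 1) V (dif HC n U \<Phi> p V s) =
        \<zero>\<^bsub>sec (ob G (?m + 2)) V\<^esub> \<oplus>\<^bsub>sec (ob G (?m + 2)) V\<^esub> hom_sign n \<odot>\<^bsub>sec (forget (ob G (?m + 2))) V\<^esub> dif G (?m + 1) V ?b"
      unfolding dif_HC_apply[OF \<Phi> V s] dif_hom_at_def is_hom_onD(2)[OF G2 V da sb]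
        is_hom_on_smult[OF G2 V b] is_complexD(3)[OF G V(1) a] ..
    also have "dif HC n U \<Phi> (p + 1) V (dif F p V s) = dif G (?m + 1) V ?b"
      unfolding dp1 zero using db complex_module_smult(3)[OF G''.module_axioms, of "\<zero>\<^bsub>sec (forget (ob G (?m + 2))) V\<^esub>" "hom_sign n"]
        G''.M.zero_closed G''.M.r_zero by simp
    also have "\<zero>\<^bsub>sec (ob G (?m + 2)) V\<^esub> \<oplus>\<^bsub>sec (ob G (?m + 2)) V\<^esub> hom_sign n \<odot>\<^bsub>sec (forget (ob G (?m + 2))) V\<^esub> dif G (?m + 1) V ?b
        \<oplus>\<^bsub>sec (ob G (?m + 2)) V\<^esub> hom_sign (n + 1) \<odot>\<^bsub>sec (forget (ob G (?m + 2))) V\<^esub> dif G (?m + 1) V ?b =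
        \<zero>\<^bsub>sec (ob G (?m + 2)) V\<^esub>"
      using db G''.smult_l_distr[of "hom_sign n" "hom_sign (n + 1)" "dif G (?m + 1) V ?b"] G''.M.l_zero
        G''.smult_closed[of "hom_sign n"] complex_module_smult(2)[OF G''.module_axioms, of "dif G (?m + 1) V ?b"]
      by (simp add: hom_sign_def split: if_splits)
    finally show "dif HC (n + 1) U (dif HC n U \<Phi>) p V s = \<zero>\<^bsub>sec (ob HC (n + 2)) U\<^esub> p V s"
      unfolding HC_apply[OF V s] by (simp only: hom_degree(3))
  qed
qed

end

locale internal_hom_map = G: internal_hom X F G + H: internal_hom X F H
  for X :: "('a, 'a \<Rightarrow> complex) ringed_space" and F :: "('a, 'a \<Rightarrow> complex, 'm) sheaf_complex"
    and G :: "('a, 'a \<Rightarrow> complex, 'k) sheaf_complex" and H :: "('a, 'a \<Rightarrow> complex, 'l) sheaf_complex" +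
  fixes f :: "('a, 'k, 'l) chain_map"
  assumes f: "is_chain_map X G H f"
begin

abbreviation "f' \<equiv> hom_complex_map X F f"

lemma map_closed:
  assumes "\<Phi> \<in> sections (ob G.HC n) U"
  shows "f' n U \<Phi> \<in> sections (ob H.HC n) U"
  using G.restr_hom_section[OF G.is_complexD(1)[OF G.F]
      G.is_hom_on_comp[OF G.HC_hom[OF assms] G.is_chain_mapD(1)[OF f]]]
  by (simp add: H.ob_HC hom_complex_map_def)

lemma map_apply:
  "openin (base X) V \<Longrightarrow> V \<subseteq> U \<Longrightarrow> s \<in> sections (ob F p) V \<Longrightarrow> f' n U \<Phi> p V s = f (p + n) V (\<Phi> p V s)"
  by (simp add: hom_complex_map_def)

text \<open>Composition with \<open>f\<close> acts on the target side only. It commutes with the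
  differential of the target because \<open>f\<close> is a chain map, with composition by the
  differential of \<open>F\<close> by associativity, and with sums and constant scalars by
  linearity.\<close>

lemma presheaf_chain_map: "presheaf_chain_map (base X) G.HC H.HC f'"
proof (intro presheaf_chain_map.intro G.presheaf_complex_HC H.presheaf_complex_HC presheaf_chain_map_axioms.intro)
  let ?T = "base X"
  show "is_chain_map (const_space ?T) G.HC H.HC f'"
    unfolding is_chain_map_def const_space_simps
  proof (intro allI conjI impI ballI)
    fix n
    show "is_hom (const_space ?T) (ob G.HC n) (ob H.HC n) (f' n)"
    proof (rule is_homI)
      fix U assume U: "openin ?T U"
      show "linear_map complex_ring (sec (ob G.HC n) U) (sec (ob H.HC n) U) (f' n U)"
      proof (rule linear_mapI[OF G.HC.sec_module[OF U] H.HC.sec_module[OF U] map_closed])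
        fix c \<Phi> \<Psi> assume \<Phi>: "\<Phi> \<in> sections (ob G.HC n) U" and \<Psi>: "\<Psi> \<in> sections (ob G.HC n) U"
        show "f' n U (c \<odot>\<^bsub>sec (ob G.HC n) U\<^esub> \<Phi> \<oplus>\<^bsub>sec (ob G.HC n) U\<^esub> \<Psi>) =
          c \<odot>\<^bsub>sec (ob H.HC n) U\<^esub> f' n U \<Phi> \<oplus>\<^bsub>sec (ob H.HC n) U\<^esub> f' n U \<Psi>"
        proof (rule H.HC_eqI[OF map_closed[OF G.HC.sec_closed(2)[OF U G.HC.sec_closed(3)[OF U \<Phi>] \<Psi>]]
              H.HC.sec_closed(2)[OF U H.HC.sec_closed(3)[OF U map_closed[OF \<Phi>]] map_closed[OF \<Psi>]]])
          fix p V s assume V: "openin ?T V" "V \<subseteq> U" and s: "s \<in> sections (ob F p) V"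
          note cl = G.is_hom_onD(1)[OF G.HC_hom[OF \<Phi>] V s] G.is_hom_onD(1)[OF G.HC_hom[OF \<Psi>] V s]
          note hom = G.is_chain_mapD(1)[OF f, of U "p + n"]
          show "f' n U (c \<odot>\<^bsub>sec (ob G.HC n) U\<^esub> \<Phi> \<oplus>\<^bsub>sec (ob G.HC n) U\<^esub> \<Psi>) p V s =
              (c \<odot>\<^bsub>sec (ob H.HC n) U\<^esub> f' n U \<Phi> \<oplus>\<^bsub>sec (ob H.HC n) U\<^esub> f' n U \<Psi>) p V s"
            unfolding H.HC_apply[OF V s] map_apply[OF V s] G.HC_apply[OF V s] G.is_hom_on_smult[OF hom V cl(1), symmetric]
            by (rule G.is_hom_onD(2)[OF hom V G.G'.sec_closed(3)[OF V(1), simplified, OF cl(1)] cl(2)])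
        qed
      qed
      fix V \<Phi> assume V: "openin ?T V" "V \<subseteq> U" and \<Phi>: "\<Phi> \<in> sections (ob G.HC n) U"
      show "f' n V (res (ob G.HC n) U V \<Phi>) = res (ob H.HC n) U V (f' n U \<Phi>)"
      proof (rule H.HC_eqI[OF map_closed[OF G.HC.res_closed[OF U V \<Phi>]] H.HC.res_closed[OF U V map_closed[OF \<Phi>]]])
        fix p W s assume W: "openin ?T W" "W \<subseteq> V" and s: "s \<in> sections (ob F p) W"
        have WU: "W \<subseteq> U" using W V by blast
        show "f' n V (res (ob G.HC n) U V \<Phi>) p W s = res (ob H.HC n) U V (f' n U \<Phi>) p W s"
          unfolding H.HC_apply[OF W s] map_apply[OF W s] map_apply[OF W(1) WU s] G.HC_apply[OF W s] ..
      qed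
    qed
    fix U \<Phi> assume U: "openin ?T U" and \<Phi>: "\<Phi> \<in> sections (ob G.HC n) U"
    show "f' (n + 1) U (dif G.HC n U \<Phi>) = dif H.HC n U (f' n U \<Phi>)"
    proof (rule H.HC_eqI[OF map_closed[OF G.dif_HC_closed[OF \<Phi>]] H.dif_HC_closed[OF map_closed[OF \<Phi>]]])
      fix p V s assume V: "openin ?T V" "V \<subseteq> U" and s: "s \<in> sections (ob F p) V"
      note ds = G.dif_F[OF V(1) s]
      note a = G.is_hom_onD(1)[OF G.HC_hom[OF \<Phi>] V s] and b = G.is_hom_onD(1)[OF G.HC_hom'[OF \<Phi>] V ds]
      note hom = G.is_chain_mapD(1)[OF f, of U "p + n + 1"]
      have smult: "hom_sign n \<odot>\<^bsub>sec (forget (ob G (p + n + 1))) V\<^esub> \<Phi> (p + 1) V (dif F p V s) \<in> sections (ob G (p + n + 1)) V"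
        using G.G'.sec_closed(3)[OF V(1), of _ "p + n + 1"] b by simp
      show "f' (n + 1) U (dif G.HC n U \<Phi>) p V s = dif H.HC n U (f' n U \<Phi>) p V s"
        unfolding map_apply[OF V s] G.dif_HC_apply[OF \<Phi> V s] H.dif_HC_apply[OF map_closed[OF \<Phi>] V s]
          G.dif_hom_at_def H.dif_hom_at_def map_apply[OF V ds] hom_degree
          G.is_hom_onD(2)[OF hom V G.dif_G[OF V(1) a] smult] G.is_hom_on_smult[OF hom V b]
          G.is_chain_mapD(2)[OF f V(1) a] ..
    qed
  qed
qed

end

section \<open>Constant functions are holomorphic on a complex manifold\<close>

lemma Cspace_ball_subset:
  assumes S: "openin (top_of_set (Cspace n)) S" and z: "z \<in> S"
  shows "\<exists>d>0. \<forall>h\<in>Cspace n. Cnorm n h < d \<longrightarrow> (\<lambda>i. z i + h i) \<in> S"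
proof -
  obtain B where B: "open B" "S = Cspace n \<inter> B" using S by (auto simp: openin_open)
  have "openin (product_topology (\<lambda>i. euclidean) UNIV) B" using B(1) by (simp add: open_fun_def)
  then obtain Y where Y: "z \<in> Pi\<^sub>E UNIV Y" "\<And>i. open (Y i)" "Pi\<^sub>E UNIV Y \<subseteq> B"
    using product_topology_open_contains_basis[of "\<lambda>i. euclidean" UNIV B z] z B(2) by auto
  have "\<exists>e>0. ball (z i) e \<subseteq> Y i" for i
    using Y(1,2) by (metis PiE_mem UNIV_I openE)
  then obtain e where e: "\<And>i. e i > 0" "\<And>i. ball (z i) (e i) \<subseteq> Y i" by metis
  \<comment> \<open>Only the first \<open>n\<close> radii enter, since the coordinates of
    \<open>h\<close> from \<open>n\<close> on are zero. The \<open>1\<close> keeps the set nonempty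
    when \<open>n = 0\<close>.\<close>
  define d where "d = Min (insert 1 (e ` {..<n}))"
  have d: "d > 0" "\<And>i. i < n \<Longrightarrow> d \<le> e i" using e(1) by (auto simp: d_def)
  have "(\<lambda>i. z i + h i) \<in> S" if h: "h \<in> Cspace n" "Cnorm n h < d" for h
  proof -
    have "z i + h i \<in> Y i" for i
    proof (cases "i < n")
      case True
      have "cmod (h i) = sqrt ((cmod (h i))\<^sup>2)" by simp
      also have "\<dots> \<le> Cnorm n h"
        unfolding Cnorm_def using True by (intro real_sqrt_le_mono member_le_sum) auto
      also have "\<dots> < e i" using h(2) d(2)[OF True] by simp
      finally show ?thesis using e(2)[of i] by (auto simp: dist_norm)
    next
      case False
      then have "h i = 0" using h(1) by (simp add: Cspace_def)
      then show ?thesis using e[of i] by auto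
    qed
    then have "(\<lambda>i. z i + h i) \<in> B" using Y(3) by (auto simp: PiE_def)
    then show ?thesis using h(1) z B(2) by (auto simp: Cspace_def)
  qed
  then show ?thesis using d(1) by blast
qed

text \<open>The differential is zero, but the function is \<open>undefined\<close> outside
  \<open>V\<close>. The increments must therefore keep the point inside the image of
  \<open>V\<close>, which is possible because that image is open in the model space: charts are
  homeomorphisms onto open sets.\<close>

lemma holomorphic_const:
  assumes M: "complex_manifold M" and V: "openin (mtop M) V"
  shows "holomorphic_on_manifold M V (\<lambda>x\<in>V. c)"
  unfolding holomorphic_on_manifold_def holomorphic_in_def
proof (intro ballI)
  fix ch z assume ch: "ch \<in> atlas M" and z: "z \<in> snd ch ` (V \<inter> fst ch)"
  let ?S = "snd ch ` (V \<inter> fst ch)"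
  have open_ch: "openin (mtop M) (fst ch)" "openin (top_of_set (Cspace (mdim M))) (snd ch ` fst ch)"
    and hom: "homeomorphic_map (subtopology (mtop M) (fst ch)) (top_of_set (snd ch ` fst ch)) (snd ch)"
    using M ch by (auto simp: complex_manifold_def)
  have top: "topspace (subtopology (mtop M) (fst ch)) = fst ch"
    using openin_subset[OF open_ch(1)] by auto
  have inj: "inj_on (snd ch) (fst ch)"
    using hom top by (simp add: homeomorphic_eq_everything_map)
  have "openin (top_of_set (snd ch ` fst ch)) ?S"
    using homeomorphic_imp_open_map[OF hom] V by (auto simp: open_map_def openin_subtopology)
  then have "openin (top_of_set (Cspace (mdim M))) ?S"
    using open_ch(2) by (rule openin_trans)
  then obtain d where d: "d > 0" "\<And>h. h \<in> Cspace (mdim M) \<Longrightarrow> Cnorm (mdim M) h < d \<Longrightarrow> (\<lambda>i. z i + h i) \<in> ?S"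
    using Cspace_ball_subset[OF _ z] by blast
  have val: "(\<lambda>x\<in>V. c) (chart_inv ch w) = c" if "w \<in> ?S" for w
    using that inj by (auto simp: inv_into_f_f)
  have "has_complex_differential (mdim M) (\<lambda>z. (\<lambda>x\<in>V. c) (chart_inv ch z)) z (\<lambda>_. 0)"
    unfolding has_complex_differential_def
  proof (intro allI impI exI[of _ d] conjI ballI d(1))
    fix e :: real and h assume "0 < e" and h: "h \<in> Cspace (mdim M)" "Cnorm (mdim M) h < d"
    then show "cmod ((\<lambda>x\<in>V. c) (chart_inv ch (\<lambda>i. z i + h i)) - (\<lambda>x\<in>V. c) (chart_inv ch z) - (\<Sum>i<mdim M. 0 * h i))
        \<le> e * Cnorm (mdim M) h"
      unfolding val[OF d(2)[OF h]] val[OF z] by (simp add: Cnorm_def sum_nonneg)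
  qed
  then show "\<exists>a. has_complex_differential (mdim M) (\<lambda>z. (\<lambda>x\<in>V. c) (chart_inv ch z)) z a" by blast
qed

lemma function_space_hol_space:
  assumes "complex_manifold M"
  shows "function_space (hol_space M)"
  by (rule function_space.intro)
    (use holomorphic_const[OF assms] in \<open>auto simp: hol_space_def hol_ring_def fun_eq_iff\<close>)

theorem proposition4:
  fixes M :: "'a atlas_space" and n :: nat
    and B C D F I J :: "('a, 'a \<Rightarrow> complex, 'm) sheaf_complex"
    and u v w :: "('a, 'm) roof"
    and i j v' :: "('a, 'm, 'm) chain_map"
    and k :: int
  assumes kaehler: "compact_kaehler_manifold M" "mdim M = n"
    and triangle: "distinguished_triangle (hol_space M) B C D u v w"
    and F: "derived_object (hol_space M) F"
    and resolutions: "injective_resolution (hol_space M) C I i"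
      "injective_resolution (hol_space M) D J j"
    and lift: "lifts_to_resolutions (hol_space M) I i J j v v'"
  shows "let T = mtop M;
             ExtC = Ext_sheaf (hol_space M) k F I;
             ExtD = Ext_sheaf (hol_space M) k F J;
             \<beta> = Ext_map (hol_space M) k F J v';
             Ker = ker_sheaf ExtC ExtD \<beta>;
             Im = im_sheaf T ExtC ExtD \<beta>
         in \<exists>\<delta>. long_exact_sequence
              (sheaf_cohomology T Ker) (sheaf_cohomology T ExtC) (sheaf_cohomology T Im)
              (sheaf_cohomology_map T ExtC (\<lambda>U s. s)) (sheaf_cohomology_map T Im \<beta>) \<delta>"
proof -
  interpret function_space "hol_space M"
    using kaehler(1) by (intro function_space_hol_space) (simp add: compact_kaehler_manifold_def)
  interpret internal_hom_map "hol_space M" F I J v'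
    using F resolutions lift
    by unfold_locales (simp_all add: derived_object_def injective_resolution_def lifts_to_resolutions_def)
  have "base (hol_space M) = mtop M" by (simp add: hol_space_def)
  then show ?thesis
    using module_presheaf_hom.long_exact_cohomology[OF presheaf_chain_map.hom_coh_sheaf[OF presheaf_chain_map, of k]]
    by (simp add: Let_def Ext_sheaf_def Ext_map_def)
qed

end
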